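(* Let $T>0$, $M\in\mathbb{N}$, and for $i=1,\dots,M$ let $\boldsymbol{W}_i(t)=\boldsymbol{B}_{\Gamma_i}(t)+(x_i-c_it)\boldsymbol{1}_{\eta_i}$, $t\in[0,T]$, where $c_i,x_i\in\mathbb{R}$ and $\boldsymbol{B}_{\Gamma_1},\dots,\boldsymbol{B}_{\Gamma_M}$ are independent Brownian decision trees on $[0,T]$, $\boldsymbol{B}_{\Gamma_i}$ having branching points $\boldsymbol{\tau}_i$ and offspring numbers $\boldsymbol{N}_i$. Let $A$ be the set of indices $i\in\{1,\dots,M\}$ for which the tuple $(\boldsymbol{\tau}_i,\boldsymbol{N}_i,c_i,x_i)$ is maximal among all $M$ given tuples with respect to the order $\succcurlyeq$ (the lexicographic order on $(\mu_0(T)/P_\eta,\ x-cT,\ -P_\eta)$). Then, as $u\to\infty$, $$\mathbb{P}\{\exists\, i\in\{1,\dots,M\},\ t\in[0,T]:\ \boldsymbol{W}_i(t)>u\boldsymbol{1}_{\eta_i}\}\sim\sum_{i\in A}\mathbb{P}\{\exists\, t\in[0,T]:\ \boldsymbol{W}_i(t)>u\boldsymbol{1}_{\eta_i}\},$$ where the asymptotics of each term is given by $$\mathbb{P}\{\exists\, t\in[0,T]:\ \boldsymbol{W}_i(t)>u\boldsymbol{1}_{\eta_i}\}\sim\mathcal{H}_{P_{\eta_i},1/\mu_{0,i}(T)}\,\mathbb{P}\{\boldsymbol{W}_i(T)>u\boldsymbol{1}_{\eta_i}\}.$$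
   Context: Brownian decision tree. Fix $T>0$, an integer $\eta\ge 1$, deterministic branching points $\boldsymbol{\tau}=(\tau_1,\dots,\tau_\eta)$ with $0<\tau_1<\dots<\tau_\eta<T$ and offspring numbers $\boldsymbol{N}=(N_1,\dots,N_\eta)$, integers $\ge 1$. Conventions: $\tau_0=0$, $\tau_{\eta+1}=T$, $P_0=1$. Put $P_i=\prod_{j=1}^iN_j$, $\Gamma=\{0,1,\dots,P_\eta-1\}$, and let $i(t)=\max\{i\in\{1,\dots,\eta\}: t>\tau_i\}$ for $t>\tau_1$, $i(t)=0$ for $t\in[0,\tau_1]$. Let $B_0^*$ be a standard one-dimensional Brownian motion and, for $i=1,\dots,\eta$, let $\boldsymbol{B}_i^*$ be a standard $\mathbb{R}^{P_i}$-valued Brownian motion (independent components), all of these being mutually independent. Define $\widetilde{\boldsymbol{B}}_\Gamma(t)=B_0^*(t)$ for $t\in[0,\tau_1]$ and, recursively for $t\in(\tau_i,\tau_{i+1}]$, let $\widetilde{\boldsymbol{B}}_\Gamma(t)\in\mathbb{R}^{P_i}$ be the vector obtained by stacking $N_i$ copies of $\widetilde{\boldsymbol{B}}_\Gamma(\tau_i)\in\mathbb{R}^{P_{i-1}}$, plus $\boldsymbol{B}_i^*(t-\tau_i)$. The branch indexed by $\gamma\in\Gamma$ is $B_\gamma(t)=(\widetilde{\boldsymbol{B}}_\Gamma(t))_{(\gamma \bmod P_{i(t)})+1}$, and $\boldsymbol{B}_\Gamma(t)=(B_\gamma(t))_{\gamma\in\Gamma}\in\mathbb{R}^{P_\eta}$.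 Put $\mu_0(T)=(T-\tau_\eta)+\sum_{l=1}^{\eta}(\tau_l-\tau_{l-1})\prod_{j=l}^{\eta}N_j$. Forest notation. For the $i$-th tree of the forest, $\eta_i$, $P_{\eta_i}$, $\Gamma_i$ and $\mu_{0,i}(T)$ denote the quantities $\eta,P_\eta,\Gamma,\mu_0(T)$ built from $(\boldsymbol{\tau}_i,\boldsymbol{N}_i)$; $\boldsymbol{1}_{\eta_i}=(1,\dots,1)^\top\in\mathbb{R}^{P_{\eta_i}}$. Vector inequalities are componentwise. Order. $(\boldsymbol{\tau}_1,\boldsymbol{N}_1,c_1,x_1)\succcurlyeq(\boldsymbol{\tau}_2,\boldsymbol{N}_2,c_2,x_2)$ if one of the following holds: (i) $\mu_{0,1}(T)/P_{\eta_1}>\mu_{0,2}(T)/P_{\eta_2}$; (ii) $\mu_{0,1}(T)/P_{\eta_1}=\mu_{0,2}(T)/P_{\eta_2}$ and $c_1T-x_1<c_2T-x_2$; (iii) $\mu_{0,1}(T)/P_{\eta_1}=\mu_{0,2}(T)/P_{\eta_2}$, $c_1T-x_1=c_2T-x_2$ and $P_{\eta_1}\le P_{\eta_2}$. Any two tuples are comparable, and $i\in A$ means that the $i$-th tuple is $\succcurlyeq$ every other one. Constant: for $\mathcal{N}\in\mathbb{N}$, $\lambda>0$, $\mathcal{H}_{\mathcal{N},\lambda}=\int_{\mathbb{R}^{\mathcal{N}}}\mathbb{P}\{\exists\, t\in(0,\infty)\ \forall\, k\in\{1,\dots,\mathcal{N}\}:\ \lambda B_k^*(t)-\lambda^2t>x_k\}\,e^{\sum_{k=1}^{\mathcal{N}}x_k}\,d\boldsymbol{x}$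 with $B_1^*,\dots,B_{\mathcal{N}}^*$ independent standard Brownian motions on $[0,\infty)$. The notation $f(u)\sim g(u)$ means $f(u)/g(u)\to1$. *)

theory Defs
  imports "HOL-Probability.Probability"
begin

text \<open>Every path (not just almost every one) is continuous and starts at \<open>0\<close>. So the events
  \<open>\<exists>t. ...\<close> below are measurable without completing the probability space.\<close>

locale brownian_motion = prob_space M for M :: "'w measure" +
  fixes B :: "real \<Rightarrow> 'w \<Rightarrow> real"
  assumes measurable: "0 \<le> t \<Longrightarrow> B t \<in> borel_measurable M"
    and starts_at_0: "\<omega> \<in> space M \<Longrightarrow> B 0 \<omega> = 0"
    and continuous_paths: "\<omega> \<in> space M \<Longrightarrow> continuous_on {0..} (\<lambda>t. B t \<omega>)"
    and normal_increments: "0 \<le> s \<Longrightarrow> s < t \<Longrightarrow>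
      distributed M lborel (\<lambda>\<omega>. B t \<omega> - B s \<omega>) (normal_density 0 (sqrt (t - s)))"
    and independent_increments: "0 \<le> ts 0 \<Longrightarrow> (\<forall>j<n. ts j \<le> ts (Suc j)) \<Longrightarrow>
      indep_vars (\<lambda>_. borel) (\<lambda>j \<omega>. B (ts (Suc j)) \<omega> - B (ts j) \<omega>) {..<n::nat}"

definition indep_brownian_motions ::
    "'w measure \<Rightarrow> 'i set \<Rightarrow> ('i \<Rightarrow> real \<Rightarrow> 'w \<Rightarrow> real) \<Rightarrow> bool" where
  "indep_brownian_motions M I B \<longleftrightarrow>
    (\<forall>i\<in>I. brownian_motion M (B i)) \<and>
    prob_space.indep_vars M (\<lambda>_. \<Pi>\<^sub>M t\<in>{0..}. borel) (\<lambda>i \<omega>. \<lambda>t\<in>{0..}. B i t \<omega>) I"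

text \<open>A branching structure is given by \<open>\<eta>\<close>, \<open>\<tau>\<close>, \<open>N\<close>, indexed from \<open>1\<close>; the sequence \<open>\<tau>\<close> also
  carries the conventional end points \<open>\<tau> 0 = 0\<close> and \<open>\<tau> (\<eta> + 1) = T\<close>. Values of \<open>\<tau>\<close> and \<open>N\<close> at
  other indices are irrelevant.\<close>

definition branching_structure :: "real \<Rightarrow> nat \<Rightarrow> (nat \<Rightarrow> real) \<Rightarrow> (nat \<Rightarrow> nat) \<Rightarrow> bool" where
  "branching_structure T \<eta> \<tau> N \<longleftrightarrow>
    1 \<le> \<eta> \<and> \<tau> 0 = 0 \<and> \<tau> (Suc \<eta>) = T \<and> (\<forall>i\<le>\<eta>. \<tau> i < \<tau> (Suc i)) \<and> (\<forall>i\<in>{1..\<eta>}. 1 \<le> N i)"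

definition num_branches :: "(nat \<Rightarrow> nat) \<Rightarrow> nat \<Rightarrow> nat" where
  "num_branches N i = (\<Prod>j=1..i. N j)"

definition branching_level :: "nat \<Rightarrow> (nat \<Rightarrow> real) \<Rightarrow> real \<Rightarrow> nat" where
  "branching_level \<eta> \<tau> t = (if \<tau> 1 < t then Max {i\<in>{1..\<eta>}. \<tau> i < t} else 0)"

text \<open>The driving Brownian motions of a tree: \<open>B (i, k)\<close> is the component number \<open>k\<close> (counted
  from \<open>0\<close>) of the \<open>i\<close>-th one, which has values in \<open>num_branches N i\<close> dimensions.\<close>

definition driver_index :: "nat \<Rightarrow> (nat \<Rightarrow> nat) \<Rightarrow> (nat \<times> nat) set" where
  "driver_index \<eta> N = {(i, k). i \<le> \<eta> \<and> k < num_branches N i}"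

text \<open>\<open>stacked_tree \<tau> N B i t \<omega>\<close> is the vector of branches, with components counted from \<open>0\<close>, at
  a time \<open>t\<close> in \<open>{\<tau> i <.. \<tau> (i + 1)}\<close> (in \<open>{0..\<tau> 1}\<close> if \<open>i = 0\<close>). Component \<open>k\<close> of a stack of
  copies of a \<open>p\<close>-dimensional vector is component \<open>k mod p\<close> of that vector.\<close>

primrec stacked_tree :: "(nat \<Rightarrow> real) \<Rightarrow> (nat \<Rightarrow> nat) \<Rightarrow> (nat \<times> nat \<Rightarrow> real \<Rightarrow> 'w \<Rightarrow> real) \<Rightarrow>
    nat \<Rightarrow> real \<Rightarrow> 'w \<Rightarrow> nat \<Rightarrow> real" where
  "stacked_tree \<tau> N B 0 t \<omega> k = B (0, k) t \<omega>"
| "stacked_tree \<tau> N B (Suc i) t \<omega> k =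
    stacked_tree \<tau> N B i (\<tau> (Suc i)) \<omega> (k mod num_branches N i) + B (Suc i, k) (t - \<tau> (Suc i)) \<omega>"

definition decision_tree :: "nat \<Rightarrow> (nat \<Rightarrow> real) \<Rightarrow> (nat \<Rightarrow> nat) \<Rightarrow>
    (nat \<times> nat \<Rightarrow> real \<Rightarrow> 'w \<Rightarrow> real) \<Rightarrow> nat \<Rightarrow> real \<Rightarrow> 'w \<Rightarrow> real" where
  "decision_tree \<eta> \<tau> N B \<gamma> t \<omega> =
    (let i = branching_level \<eta> \<tau> t in stacked_tree \<tau> N B i t \<omega> (\<gamma> mod num_branches N i))"

definition drifted_tree :: "nat \<Rightarrow> (nat \<Rightarrow> real) \<Rightarrow> (nat \<Rightarrow> nat) \<Rightarrow>
    (nat \<times> nat \<Rightarrow> real \<Rightarrow> 'w \<Rightarrow> real) \<Rightarrow> real \<Rightarrow> real \<Rightarrow> nat \<Rightarrow> real \<Rightarrow> 'w \<Rightarrow> real" where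
  "drifted_tree \<eta> \<tau> N B c x \<gamma> t \<omega> = decision_tree \<eta> \<tau> N B \<gamma> t \<omega> + (x - c * t)"

definition leaves :: "nat \<Rightarrow> (nat \<Rightarrow> nat) \<Rightarrow> nat set" where
  "leaves \<eta> N = {0..<num_branches N \<eta>}"

definition mu0 :: "real \<Rightarrow> nat \<Rightarrow> (nat \<Rightarrow> real) \<Rightarrow> (nat \<Rightarrow> nat) \<Rightarrow> real" where
  "mu0 T \<eta> \<tau> N = (T - \<tau> \<eta>) + (\<Sum>l=1..\<eta>. (\<tau> l - \<tau> (l - 1)) * (\<Prod>j=l..\<eta>. real (N j)))"

type_synonym tree_data = "nat \<times> (nat \<Rightarrow> real) \<times> (nat \<Rightarrow> nat) \<times> real \<times> real"

fun tree_succeq :: "real \<Rightarrow> tree_data \<Rightarrow> tree_data \<Rightarrow> bool" where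
  "tree_succeq T (\<eta>1, \<tau>1, N1, c1, x1) (\<eta>2, \<tau>2, N2, c2, x2) \<longleftrightarrow>
    (let r1 = mu0 T \<eta>1 \<tau>1 N1 / real (num_branches N1 \<eta>1);
         r2 = mu0 T \<eta>2 \<tau>2 N2 / real (num_branches N2 \<eta>2)
     in r1 > r2 \<or>
        r1 = r2 \<and> c1 * T - x1 < c2 * T - x2 \<or>
        r1 = r2 \<and> c1 * T - x1 = c2 * T - x2 \<and> num_branches N1 \<eta>1 \<le> num_branches N2 \<eta>2)"

definition maximal_trees :: "real \<Rightarrow> nat \<Rightarrow> (nat \<Rightarrow> tree_data) \<Rightarrow> nat set" where
  "maximal_trees T M D = {i\<in>{1..M}. \<forall>j\<in>{1..M}. tree_succeq T (D i) (D j)}"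

text \<open>\<open>B 1, ..., B n\<close> are meant to be independent standard Brownian motions on \<open>M\<close>; the value
  depends only on their joint law. The integral is over \<open>n\<close>-dimensional Lebesgue measure.\<close>

definition H_const :: "'v measure \<Rightarrow> (nat \<Rightarrow> real \<Rightarrow> 'v \<Rightarrow> real) \<Rightarrow> nat \<Rightarrow> real \<Rightarrow> real" where
  "H_const M B n a =
    (\<integral>x. measure M {\<omega> \<in> space M. \<exists>t\<in>{0<..}. \<forall>k\<in>{1..n}. a * B k t \<omega> - a\<^sup>2 * t > x k} *
         exp (\<Sum>k=1..n. x k) \<partial>(\<Pi>\<^sub>M k\<in>{1..n}. lborel))"

end

theory Submission
  imports Defs "HOL-Real_Asymp.Real_Asymp"
begin



text \<open>The branches of a tree at a fixed time form a Gaussian vector in which every leaf is the sum of the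
increments along its path from the root. For all leaves to be above a high level \<open>u\<close>, the cheapest
way is to shift the whole path of drivers: an increment of variance \<open>v\<close> that is shared by \<open>m\<close> of the
leaves is shifted by an amount proportional to \<open>v * m\<close>. A leaf then moves by the sum of these
amounts along its path, which is the same for all leaves and proportional to \<open>\<mu> = mu0 T\<close>, the common
row sum of the covariance matrix. So the all-ones vector is an eigenvector, the exponential rate of
the end point is \<open>u\<^sup>2 * P / (2 * \<mu>)\<close> with \<open>P\<close> leaves, and the Cameron-Martin factor depends on the
driver only through the sum of the final positions of the leaves.

This makes the behaviour near the end point explicit. Shift by \<open>u\<close>, condition on the position at
time \<open>T - K / u\<^sup>2\<close>, integrate over that position and rescale space by \<open>1 / u\<close> and time by
\<open>1 / u\<^sup>2\<close>. The probability that all leaves are above \<open>u\<close> at one of the times \<open>T - t / u\<^sup>2\<close> with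
\<open>t \<in> Q\<close> becomes, up to an explicit factor, an integral of
\<open>exp (x 1 + ... + x P)\<close> over the event that \<open>Bstar k t / \<mu> - t / \<mu>\<^sup>2\<close> exceeds \<open>x k\<close> for all \<open>k\<close>
at some \<open>t \<in> Q\<close>, weighted with a bounded Gaussian density. The formula is exact: it is proved in
\<open>tree_grid_formula\<close> for finitely many normal variables, in \<open>exit_grid_formula\<close> for finite \<open>Q\<close> and in
\<open>hit_interval\<close> for \<open>Q = {0..K}\<close>. Only the density depends on \<open>u\<close>, and it tends to a constant, so
dominated convergence gives the limits \<open>hit_limits\<close>. The set \<open>{0}\<close> gives the end point, \<open>{0..K}\<close> gives
the last stretch of the path.

Earlier times are negligible. A tree that is above \<open>u\<close> at some time has, at each later time, a
probability bounded below to be still above \<open>u\<close>, because it is enough that finitely many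
independent normal variables are large. So the probability of an exit before \<open>T - K / u\<^sup>2\<close> is at most
a constant times the probability to be above \<open>u\<close> at that very time (\<open>exit_bounded_by_endpoint\<close>), and
\<open>Q = {K}\<close> shows that this is a fraction \<open>exp (- K * P / (2 * \<mu>\<^sup>2))\<close> of the whole. The same bound shows that
the integrals for \<open>{0..K}\<close> stay bounded, so they increase to the finite constant \<open>H_const\<close>. A
drift changes the level by \<open>O(1 / u\<^sup>2)\<close> on the last stretch, which does not change the limit. This
yields \<open>exit_prob_asymptotics\<close> for one tree.

The explicit rates also compare two trees: the order on the tuples is the lexicographic order of
\<open>\<mu> / P\<close> (the rate), of the drift term (a factor \<open>exp (const * u)\<close>) and of \<open>P\<close> (a power of \<open>u\<close>), so a tree that is
not maximal is negligible. For independent trees, the probability of the union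
differs from the sum of the probabilities by at most the square of the sum, which is negligible because the sum tends to \<open>0\<close>.\<close>

section \<open>Independence of a family of families\<close>

text \<open>An event about all \<open>Y d j (X d)\<close> splits over \<open>d\<close>, because the \<open>X d\<close> are independent, and then over \<open>j\<close>.
With \<open>X d\<close> a process and \<open>Y d j\<close> an increment, independent processes with independent increments
have jointly independent increments.\<close>

lemma (in prob_space) indep_vars_Sigma:
  assumes ind: "indep_vars N X D" and D: "finite D" and J: "\<And>d. d \<in> D \<Longrightarrow> finite (J d)"
    and inner: "\<And>d. d \<in> D \<Longrightarrow> indep_vars (M' d) (\<lambda>j \<omega>. Y d j (X d \<omega>)) (J d)"
    and meas: "\<And>d j. d \<in> D \<Longrightarrow> j \<in> J d \<Longrightarrow> Y d j \<in> measurable (N d) (M' d j)"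
  shows "indep_vars (\<lambda>(d, j). M' d j) (\<lambda>(d, j) \<omega>. Y d j (X d \<omega>)) (SIGMA d:D. J d)"
proof (cases "Sigma D J = {}")
  case True
  then show ?thesis by (simp add: indep_vars_def indep_sets_def)
next
  case False
  then have Dne: "D \<noteq> {}" by auto
  have X: "X d \<in> measurable M (N d)" if "d \<in> D" for d using ind that by (auto simp: indep_vars_def)
  show ?thesis
  proof (subst indep_vars_finite[where E="\<lambda>(d,j). sets (M' d j)"])
    show "Sigma D J \<noteq> {}" by fact
    show "finite (Sigma D J)" using D J by auto
    show "\<forall>A\<in>\<Pi> i\<in>Sigma D J. (case i of (d, j) \<Rightarrow> sets (M' d j)).
       prob (\<Inter>j\<in>Sigma D J. (case j of (d, j) \<Rightarrow> \<lambda>\<omega>. Y d j (X d \<omega>)) -` A j \<inter> space M) =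
       (\<Prod>j\<in>Sigma D J. prob ((case j of (d, j) \<Rightarrow> \<lambda>\<omega>. Y d j (X d \<omega>)) -` A j \<inter> space M))"
    proof
      fix A assume "A \<in> (\<Pi> i\<in>Sigma D J. case i of (d, j) \<Rightarrow> sets (M' d j))"
      then have A: "A (d,j) \<in> sets (M' d j)" if "d \<in> D" "j \<in> J d" for d j using that by auto
      define B where "B d = {x \<in> space (N d). \<forall>j\<in>J d. Y d j x \<in> A (d, j)}" for d
      have B: "B d \<in> sets (N d)" if "d \<in> D" for d
        unfolding B_def using J[OF that] A[OF that] meas[OF that]
        by (intro sets.sets_Collect_finite_All' sets.sets_Collect_finite_All) (auto intro: measurable_sets_Collect)
      have "prob (\<Inter>j\<in>Sigma D J. (case j of (d, j) \<Rightarrow> \<lambda>\<omega>. Y d j (X d \<omega>)) -` A j \<inter> space M)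
         = prob (\<Inter>d\<in>D. X d -` B d \<inter> space M)"
        using False X[THEN measurable_space] by (intro arg_cong[of _ _ prob]) (auto simp: B_def; blast)
      also have "\<dots> = (\<Prod>d\<in>D. prob (X d -` B d \<inter> space M))"
        by (rule indep_varsD_finite[OF ind Dne D B])
      also have "\<dots> = (\<Prod>d\<in>D. \<Prod>j\<in>J d. prob ((\<lambda>\<omega>. Y d j (X d \<omega>)) -` A (d,j) \<inter> space M))"
      proof (rule prod.cong[OF refl])
        fix d assume d: "d \<in> D"
        show "prob (X d -` B d \<inter> space M) = (\<Prod>j\<in>J d. prob ((\<lambda>\<omega>. Y d j (X d \<omega>)) -` A (d,j) \<inter> space M))"
        proof (cases "J d = {}")
          case True
          then have "X d -` B d \<inter> space M = space M" using X[OF d, THEN measurable_space] by (auto simp: B_def)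
          then show ?thesis using True by (simp add: prob_space)
        next
          case J': False
          have "X d -` B d \<inter> space M = (\<Inter>j\<in>J d. (\<lambda>\<omega>. Y d j (X d \<omega>)) -` A (d,j) \<inter> space M)"
            using J' X[OF d, THEN measurable_space] by (auto simp: B_def)
          then show ?thesis using indep_varsD_finite[OF inner[OF d] J' J[OF d] A[OF d]] by simp
        qed
      qed
      also have "\<dots> = (\<Prod>j\<in>Sigma D J. prob ((case j of (d, j) \<Rightarrow> \<lambda>\<omega>. Y d j (X d \<omega>)) -` A j \<inter> space M))"
        using D J by (subst prod.Sigma) (auto intro!: prod.cong)
      finally show "prob (\<Inter>j\<in>Sigma D J. (case j of (d, j) \<Rightarrow> \<lambda>\<omega>. Y d j (X d \<omega>)) -` A j \<inter> space M) = \<dots>" .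
    qed
  qed (use meas X in \<open>auto simp: sets.sigma_sets_eq sets.Int_stable dest: sets.sets_into_space intro: measurable_compose\<close>)
qed

lemma (in prob_space) indep_vars_inj:
  assumes ind: "indep_vars M' X K" and e: "inj_on e I" "e ` I \<subseteq> K"
  shows "indep_vars (\<lambda>i. M' (e i)) (\<lambda>i. X (e i)) I"
proof -
  have *: "bij_betw e J (e ` J)" if "J \<subseteq> I" for J using e that by (meson bij_betw_imageI inj_on_subset)
  show ?thesis
    unfolding indep_vars_def2 indep_sets_def
  proof (intro conjI ballI allI impI)
    fix i assume "i \<in> I"
    then show "random_variable (M' (e i)) (X (e i))" using ind e by (auto simp: indep_vars_def2)
    then show "{X (e i) -` A \<inter> space M |A. A \<in> sets (M' (e i))} \<subseteq> events"
      by (auto intro: measurable_sets)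
  next
    fix J A assume J: "J \<subseteq> I" "J \<noteq> {}" "finite J" and A: "A \<in> (\<Pi> j\<in>J. {X (e j) -` A \<inter> space M |A. A \<in> sets (M' (e j))})"
    define A' where "A' k = A (the_inv_into J e k)" for k
    have inj: "inj_on e J" using e J by (meson inj_on_subset)
    have A': "A' (e j) = A j" if "j \<in> J" for j using that inj by (simp add: A'_def the_inv_into_f_f)
    have "A' \<in> (\<Pi> k\<in>e ` J. {X k -` A \<inter> space M |A. A \<in> sets (M' k)})"
      using A by (auto simp: A' Pi_iff)
    moreover have "e ` J \<subseteq> K" "e ` J \<noteq> {}" "finite (e ` J)" using J e by auto
    ultimately have "prob (\<Inter>k\<in>e ` J. A' k) = (\<Prod>k\<in>e`J. prob (A' k))"
      using ind unfolding indep_vars_def2 indep_sets_def by blast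
    then show "prob (\<Inter>j\<in>J. A j) = (\<Prod>j\<in>J. prob (A j))"
      by (simp add: prod.reindex[OF inj] A')
  qed
qed

section \<open>Lebesgue measure on finite products\<close>

lemma product_sigma_finite_lborel: "product_sigma_finite (\<lambda>_. lborel :: real measure)"
  by standard

text \<open>On a box the claim is the one-dimensional substitution in each coordinate, and boxes determine the
measure. The bijection \<open>e\<close> renames the coordinates: one side is indexed by the
normal variables of a tree, the other one by \<open>{1..P}\<close>.\<close>

lemma nn_integral_PiM_lborel_affine:
  fixes F :: "('i \<Rightarrow> real) \<Rightarrow> ennreal" and r :: real
  assumes I: "finite I" and e: "bij_betw e I J" and r: "r \<noteq> 0" and F: "F \<in> borel_measurable (PiM I (\<lambda>_. lborel))"
  shows "(\<integral>\<^sup>+y. F y \<partial>PiM I (\<lambda>_. lborel)) =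
    ennreal (\<bar>r\<bar> ^ card I) * (\<integral>\<^sup>+x. F (\<lambda>i\<in>I. b i + r * x (e i)) \<partial>PiM J (\<lambda>_. lborel))"
proof -
  interpret product_sigma_finite "\<lambda>_::'i. lborel :: real measure" by (rule product_sigma_finite_lborel)
  interpret J: product_sigma_finite "\<lambda>_. lborel :: real measure" by (rule product_sigma_finite_lborel)
  let ?f = "\<lambda>x. \<lambda>i\<in>I. b i + r * x (e i)"
  let ?L = "PiM I (\<lambda>_. lborel)" and ?LJ = "PiM J (\<lambda>_. lborel)"
  have finJ: "finite J" using I e by (simp add: bij_betw_finite)
  have eJ: "e i \<in> J" if "i \<in> I" for i using e that by (auto simp: bij_betw_def)
  have f[measurable]: "?f \<in> measurable ?LJ ?L"
    by (intro measurable_restrict borel_measurable_add borel_measurable_times borel_measurable_const)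
       (use eJ in simp_all)
  have "density (distr ?LJ ?L ?f) (\<lambda>_. ennreal (\<bar>r\<bar> ^ card I)) = ?L"
  proof (rule PiM_eqI[OF I])
    fix A assume A: "\<And>i. i \<in> I \<Longrightarrow> A i \<in> sets (lborel :: real measure)"
    define e' where "e' = the_inv_into I e"
    have e': "e' (e i) = i" if "i \<in> I" for i using e that by (simp add: e'_def the_inv_into_f_f bij_betw_def)
    have e'I: "e' j \<in> I \<and> e (e' j) = j" if "j \<in> J" for j
      using e that unfolding e'_def by (metis bij_betw_def f_the_inv_into_f the_inv_into_into subset_refl)
    have pre: "?f -` (Pi\<^sub>E I A) \<inter> space ?LJ = Pi\<^sub>E J (\<lambda>j. (\<lambda>x. b (e' j) + r * x) -` A (e' j))"
    proof (intro set_eqI iffI)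
      fix x assume x: "x \<in> ?f -` (Pi\<^sub>E I A) \<inter> space ?LJ"
      have "b (e' j) + r * x j \<in> A (e' j)" if "j \<in> J" for j
      proof -
        have "(\<lambda>i\<in>I. b i + r * x (e i)) (e' j) \<in> A (e' j)" using x e'I[OF that] by blast
        then show ?thesis using e'I[OF that] by simp
      qed
      then show "x \<in> Pi\<^sub>E J (\<lambda>j. (\<lambda>x. b (e' j) + r * x) -` A (e' j))"
        using x by (auto simp: space_PiM PiE_iff)
    next
      fix x assume x: "x \<in> Pi\<^sub>E J (\<lambda>j. (\<lambda>x. b (e' j) + r * x) -` A (e' j))"
      have "b i + r * x (e i) \<in> A i" if "i \<in> I" for i
        using PiE_mem[OF x eJ[OF that]] e'[OF that] by simp
      then show "x \<in> ?f -` (Pi\<^sub>E I A) \<inter> space ?LJ"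
        using x by (auto simp: space_PiM PiE_iff)
    qed
    have meas1: "(\<lambda>x. b i + r * x) -` A i \<in> sets lborel" if "i \<in> I" for i
      using measurable_sets[of "\<lambda>x. b i + r * x" lborel lborel "A i"] A[OF that] by simp
    have "emeasure (density (distr ?LJ ?L ?f) (\<lambda>_. ennreal (\<bar>r\<bar> ^ card I))) (Pi\<^sub>E I A) =
        ennreal (\<bar>r\<bar> ^ card I) * emeasure ?LJ (?f -` (Pi\<^sub>E I A) \<inter> space ?LJ)"
      using A I by (subst emeasure_density) (auto simp: nn_integral_cmult emeasure_distr intro!: sets_PiM_I_finite)
    also have "\<dots> = (\<Prod>i\<in>I. ennreal \<bar>r\<bar>) * (\<Prod>j\<in>J. emeasure lborel ((\<lambda>x. b (e' j) + r * x) -` A (e' j)))"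
      unfolding pre using finJ e'I meas1 by (subst J.emeasure_PiM) (auto simp: ennreal_power)
    also have "(\<Prod>j\<in>J. emeasure lborel ((\<lambda>x. b (e' j) + r * x) -` A (e' j))) = (\<Prod>i\<in>I. emeasure lborel ((\<lambda>x. b i + r * x) -` A i))"
      by (subst prod.reindex_bij_betw[OF e, symmetric]) (simp add: e')
    also have "(\<Prod>i\<in>I. ennreal \<bar>r\<bar>) * \<dots> = (\<Prod>i\<in>I. ennreal \<bar>r\<bar> * emeasure lborel ((\<lambda>x. b i + r * x) -` A i))"
      by (simp add: prod.distrib)
    also have "\<dots> = (\<Prod>i\<in>I. emeasure lborel (A i))"
    proof (rule prod.cong[OF refl])
      fix i assume i: "i \<in> I"
      have "emeasure lborel (A i) = emeasure (density (distr lborel borel (\<lambda>x. b i + r * x)) (\<lambda>_. ennreal \<bar>r\<bar>)) (A i)"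
        using lborel_real_affine[OF r, of "b i"] by simp
      also have "\<dots> = ennreal \<bar>r\<bar> * emeasure lborel ((\<lambda>x. b i + r * x) -` A i)"
        using A[OF i] by (subst emeasure_density) (auto simp: nn_integral_cmult emeasure_distr)
      finally show "ennreal \<bar>r\<bar> * emeasure lborel ((\<lambda>x. b i + r * x) -` A i) = emeasure lborel (A i)" by simp
    qed
    finally show "emeasure (density (distr ?LJ ?L ?f) (\<lambda>_. ennreal (\<bar>r\<bar> ^ card I))) (Pi\<^sub>E I A) = (\<Prod>i\<in>I. emeasure lborel (A i))" .
  qed simp
  then have "(\<integral>\<^sup>+y. F y \<partial>?L) = (\<integral>\<^sup>+y. F y \<partial>density (distr ?LJ ?L ?f) (\<lambda>_. ennreal (\<bar>r\<bar> ^ card I)))" by simp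
  also have "\<dots> = ennreal (\<bar>r\<bar> ^ card I) * (\<integral>\<^sup>+x. F (?f x) \<partial>?LJ)"
    using F by (subst nn_integral_density) (auto simp: nn_integral_cmult nn_integral_distr)
  finally show ?thesis .
qed

lemma PiM_density_lborel:
  fixes g :: "'i \<Rightarrow> real \<Rightarrow> ennreal"
  assumes I: "finite I" and g: "\<And>i. i \<in> I \<Longrightarrow> g i \<in> borel_measurable lborel"
    and fin: "\<And>i. i \<in> I \<Longrightarrow> sigma_finite_measure (density lborel (g i))"
  shows "PiM I (\<lambda>i. density lborel (g i)) = density (PiM I (\<lambda>_. lborel)) (\<lambda>x. \<Prod>i\<in>I. g i (x i))"
proof -
  define g' where "g' i = (if i \<in> I then g i else (\<lambda>_. 1))" for i
  have lb: "density lborel (\<lambda>_. 1) = (lborel :: real measure)" by (rule density_1)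
  interpret L: product_sigma_finite "\<lambda>_::'i. lborel :: real measure" by (rule product_sigma_finite_lborel)
  interpret product_sigma_finite "\<lambda>i. density lborel (g' i)"
    using fin by (auto simp: product_sigma_finite_def g'_def lb sigma_finite_lborel)
  have gm[measurable]: "g' i \<in> borel_measurable borel" for i using g by (auto simp: g'_def)
  have "density (PiM I (\<lambda>_. lborel)) (\<lambda>x. \<Prod>i\<in>I. g' i (x i)) = PiM I (\<lambda>i. density lborel (g' i))"
  proof (rule PiM_eqI[OF I])
    have "sets (Pi\<^sub>M I (\<lambda>_. lborel)) = sets (Pi\<^sub>M I (\<lambda>i. density lborel (g' i)))" by (intro sets_PiM_cong) auto
    then show "sets (density (Pi\<^sub>M I (\<lambda>_. lborel)) (\<lambda>x. \<Prod>i\<in>I. g' i (x i))) = sets (Pi\<^sub>M I (\<lambda>i. density lborel (g' i)))" by simp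
    fix A assume "\<And>i. i \<in> I \<Longrightarrow> A i \<in> sets (density lborel (g' i))"
    then have A: "\<And>i. i \<in> I \<Longrightarrow> A i \<in> sets borel" by auto
    then have PA: "Pi\<^sub>E I A \<in> sets (Pi\<^sub>M I (\<lambda>_. lborel))" using I by (auto intro!: sets_PiM_I_finite)
    have "emeasure (density (PiM I (\<lambda>_. lborel)) (\<lambda>x. \<Prod>i\<in>I. g' i (x i))) (Pi\<^sub>E I A) =
       (\<integral>\<^sup>+x. (\<Prod>i\<in>I. g' i (x i)) * indicator (Pi\<^sub>E I A) x \<partial>PiM I (\<lambda>_. lborel))"
      using PA I by (subst emeasure_density) (auto)
    also have "\<dots> = (\<integral>\<^sup>+x. (\<Prod>i\<in>I. g' i (x i) * indicator (A i) (x i)) \<partial>PiM I (\<lambda>_. lborel))"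
    proof (rule nn_integral_cong)
      fix x assume x: "x \<in> space (PiM I (\<lambda>_. lborel :: real measure))"
      have "indicator (Pi\<^sub>E I A) x = (\<Prod>i\<in>I. indicator (A i) (x i) :: ennreal)"
      proof (cases "x \<in> Pi\<^sub>E I A")
        case True then show ?thesis by (auto simp: PiE_iff intro!: prod.neutral[symmetric])
      next
        case False
        then obtain i where "i \<in> I" "x i \<notin> A i" using x by (auto simp: space_PiM PiE_iff)
        then show ?thesis using I False by (auto intro!: prod_zero[symmetric] simp: indicator_def)
      qed
      then show "(\<Prod>i\<in>I. g' i (x i)) * indicator (Pi\<^sub>E I A) x = (\<Prod>i\<in>I. g' i (x i) * indicator (A i) (x i))"
        by (simp add: prod.distrib)
    qed
    also have "\<dots> = (\<Prod>i\<in>I. \<integral>\<^sup>+x. g' i x * indicator (A i) x \<partial>lborel)"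
      using I A by (subst L.product_nn_integral_prod) auto
    also have "\<dots> = (\<Prod>i\<in>I. emeasure (density lborel (g' i)) (A i))"
      using A by (intro prod.cong refl) (simp add: emeasure_density)
    finally show "emeasure (density (Pi\<^sub>M I (\<lambda>_. lborel)) (\<lambda>x. \<Prod>i\<in>I. g' i (x i))) (Pi\<^sub>E I A) =
         (\<Prod>i\<in>I. emeasure (density lborel (g' i)) (A i))" .
  qed
  moreover have "PiM I (\<lambda>i. density lborel (g' i)) = PiM I (\<lambda>i. density lborel (g i))"
    by (intro PiM_cong) (auto simp: g'_def)
  moreover have "(\<lambda>x. \<Prod>i\<in>I. g' i (x i)) = (\<lambda>x. \<Prod>i\<in>I. g i (x i))" by (auto simp: g'_def intro!: prod.cong)
  ultimately show ?thesis by simp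
qed



section \<open>Shifts of Gaussian families\<close>

text \<open>The parameter is the variance, because variances add up along a branch.\<close>

definition gauss :: "real \<Rightarrow> real measure" where
  "gauss v = density lborel (\<lambda>x. ennreal (normal_density 0 (sqrt v) x))"

lemma sets_gauss[measurable_cong, simp]: "sets (gauss v) = sets borel"
  and space_gauss[simp]: "space (gauss v) = UNIV"
  by (simp_all add: gauss_def)

lemma prob_space_gauss: "0 < v \<Longrightarrow> prob_space (gauss v)"
  unfolding gauss_def by (intro prob_space_normal_density) simp

lemma (in prob_space) nn_integral_indep_gauss:
  assumes ind: "indep_vars (\<lambda>_. borel) Y I" and I: "I \<noteq> {}"
    and Y: "\<And>i. i \<in> I \<Longrightarrow> distributed M lborel (Y i) (normal_density 0 (sqrt (v i)))"
    and F: "F \<in> borel_measurable (PiM I (\<lambda>_. borel :: real measure))"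
  shows "(\<integral>\<^sup>+\<omega>. F (\<lambda>i\<in>I. Y i \<omega>) \<partial>M) = (\<integral>\<^sup>+y. F y \<partial>PiM I (\<lambda>i. gauss (v i)))"
proof -
  have rv: "random_variable borel (Y i)" if "i \<in> I" for i using ind that by (auto simp: indep_vars_def)
  have "(\<integral>\<^sup>+\<omega>. F (\<lambda>i\<in>I. Y i \<omega>) \<partial>M) = (\<integral>\<^sup>+y. F y \<partial>distr M (PiM I (\<lambda>_. borel)) (\<lambda>\<omega>. \<lambda>i\<in>I. Y i \<omega>))"
    using rv F by (subst nn_integral_distr) (auto intro!: measurable_restrict)
  also have "distr M (PiM I (\<lambda>_. borel)) (\<lambda>\<omega>. \<lambda>i\<in>I. Y i \<omega>) = PiM I (\<lambda>i. distr M borel (Y i))"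
    using indep_vars_iff_distr_eq_PiM'[OF I, where M'="\<lambda>_. borel" and X=Y, OF rv] ind by simp
  also have "\<dots> = PiM I (\<lambda>i. gauss (v i))"
  proof (rule PiM_cong[OF refl])
    fix i assume "i \<in> I"
    have "distr M borel (Y i) = distr M lborel (Y i)" by (rule distr_cong) auto
    then show "distr M borel (Y i) = gauss (v i)"
      using Y[OF \<open>i \<in> I\<close>] by (simp add: gauss_def distributed_def)
  qed
  finally show ?thesis .
qed

lemma nn_integral_PiM_gauss:
  assumes I: "finite I" and v: "\<And>i. i \<in> I \<Longrightarrow> 0 < v i"
    and F: "F \<in> borel_measurable (PiM I (\<lambda>_. borel :: real measure))"
  shows "(\<integral>\<^sup>+y. F y \<partial>PiM I (\<lambda>i. gauss (v i))) =
    (\<integral>\<^sup>+y. ennreal (\<Prod>i\<in>I. normal_density 0 (sqrt (v i)) (y i)) * F y \<partial>PiM I (\<lambda>_. lborel))"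
proof -
  have s: "sigma_finite_measure (density lborel (\<lambda>x. ennreal (normal_density 0 (sqrt (v i)) x)))" if "i \<in> I" for i
    using prob_space_gauss[OF v[OF that]] by (simp add: gauss_def prob_space_imp_sigma_finite)
  have F': "F \<in> borel_measurable (PiM I (\<lambda>_. lborel))"
    using F by (subst measurable_cong_sets[OF sets_PiM_cong[OF refl sets_lborel] refl]) auto
  have "(\<integral>\<^sup>+y. F y \<partial>PiM I (\<lambda>i. gauss (v i))) =
     (\<integral>\<^sup>+y. (\<Prod>i\<in>I. ennreal (normal_density 0 (sqrt (v i)) (y i))) * F y \<partial>PiM I (\<lambda>_. lborel))"
    unfolding gauss_def using I s F'
    by (subst PiM_density_lborel) (auto intro!: nn_integral_density)
  also have "\<dots> = (\<integral>\<^sup>+y. ennreal (\<Prod>i\<in>I. normal_density 0 (sqrt (v i)) (y i)) * F y \<partial>PiM I (\<lambda>_. lborel))"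
    by (intro nn_integral_cong) (simp add: prod_ennreal)
  finally show ?thesis .
qed

lemma normal_density_shift:
  assumes "0 < v"
  shows "normal_density 0 (sqrt v) (b + x) = normal_density 0 (sqrt v) x * exp (- (b * x / v) - b\<^sup>2 / (2 * v))"
  using assms by (simp add: normal_density_def power2_sum add_divide_distrib field_simps flip: exp_add)

text \<open>The Cameron-Martin formula in finitely many coordinates: translate Lebesgue measure by \<open>b\<close> and
expand the square in the exponent of the density.\<close>

lemma nn_integral_PiM_gauss_shift:
  assumes I: "finite I" and v: "\<And>i. i \<in> I \<Longrightarrow> 0 < v i"
    and F: "F \<in> borel_measurable (PiM I (\<lambda>_. borel :: real measure))"
  shows "(\<integral>\<^sup>+y. F y \<partial>PiM I (\<lambda>i. gauss (v i))) =
    (\<integral>\<^sup>+y. F (\<lambda>i\<in>I. b i + y i) * ennreal (exp (- (\<Sum>i\<in>I. b i * y i / v i) - (\<Sum>i\<in>I. (b i)\<^sup>2 / (2 * v i)))) \<partial>PiM I (\<lambda>i. gauss (v i)))"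
    (is "_ = (\<integral>\<^sup>+y. ?G y \<partial>_)")
proof -
  have F'[measurable]: "F \<in> borel_measurable (PiM I (\<lambda>_. lborel))"
    using F by (subst measurable_cong_sets[OF sets_PiM_cong[OF refl sets_lborel] refl]) auto
  have G: "?G \<in> borel_measurable (PiM I (\<lambda>_. borel))"
  proof (rule borel_measurable_times_ennreal)
    show "(\<lambda>y. F (\<lambda>i\<in>I. b i + y i)) \<in> borel_measurable (PiM I (\<lambda>_. borel))"
      by (intro measurable_compose[OF _ F] measurable_restrict) measurable
  qed measurable
  have "(\<integral>\<^sup>+y. F y \<partial>PiM I (\<lambda>i. gauss (v i))) =
     (\<integral>\<^sup>+y. ennreal (\<Prod>i\<in>I. normal_density 0 (sqrt (v i)) (b i + y i)) * F (\<lambda>i\<in>I. b i + y i) \<partial>PiM I (\<lambda>_. lborel))"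
    using nn_integral_PiM_lborel_affine[OF I bij_betw_id, of 1 "\<lambda>y. ennreal (\<Prod>i\<in>I. normal_density 0 (sqrt (v i)) (y i)) * F y" b]
    by (simp add: nn_integral_PiM_gauss[OF I v F])
  also have "\<dots> = (\<integral>\<^sup>+y. ennreal (\<Prod>i\<in>I. normal_density 0 (sqrt (v i)) (y i)) * ?G y \<partial>PiM I (\<lambda>_. lborel))"
  proof (rule nn_integral_cong)
    fix y
    have "(\<Prod>i\<in>I. normal_density 0 (sqrt (v i)) (b i + y i)) =
        (\<Prod>i\<in>I. normal_density 0 (sqrt (v i)) (y i)) * exp (- (\<Sum>i\<in>I. b i * y i / v i) - (\<Sum>i\<in>I. (b i)\<^sup>2 / (2 * v i)))"
      using I v by (simp add: normal_density_shift prod.distrib exp_sum flip: sum_negf sum_subtractf cong: prod.cong)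
    then show "ennreal (\<Prod>i\<in>I. normal_density 0 (sqrt (v i)) (b i + y i)) * F (\<lambda>i\<in>I. b i + y i) =
        ennreal (\<Prod>i\<in>I. normal_density 0 (sqrt (v i)) (y i)) * ?G y"
      by (simp add: ennreal_mult prod_nonneg ac_simps)
  qed
  also have "\<dots> = (\<integral>\<^sup>+y. ?G y \<partial>PiM I (\<lambda>i. gauss (v i)))"
    by (rule nn_integral_PiM_gauss[OF I v G, symmetric])
  finally show ?thesis .
qed

text \<open>Among the leaves \<open>\<gamma> < P\<close>, each branch \<open>k < p\<close> of a level with \<open>p\<close> branches is the ancestor
\<open>\<gamma> mod p\<close> of equally many.\<close>

lemma sum_mod_dvd:
  fixes f :: "nat \<Rightarrow> real"
  assumes "p dvd P" "0 < p"
  shows "(\<Sum>\<gamma><P. f (\<gamma> mod p)) = (\<Sum>k<p. f k) * (real P / real p)"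
proof -
  obtain q where P: "P = p * q" using assms by (elim dvdE)
  have "(\<Sum>\<gamma><p * q. f (\<gamma> mod p)) = real q * (\<Sum>k<p. f k)"
  proof (induction q)
    case (Suc q)
    have "(\<Sum>\<gamma><p * Suc q. f (\<gamma> mod p)) = (\<Sum>\<gamma><p * q. f (\<gamma> mod p)) + (\<Sum>\<gamma>=p*q..<p*q + p. f (\<gamma> mod p))"
      by (simp add: lessThan_atLeast0 sum.atLeastLessThan_concat add.commute)
    also have "(\<Sum>\<gamma>=p*q..<p*q + p. f (\<gamma> mod p)) = (\<Sum>k<p. f ((k + p * q) mod p))"
      using sum.shift_bounds_nat_ivl[of "\<lambda>\<gamma>. f (\<gamma> mod p)" 0 "p*q" p] by (simp add: add.commute lessThan_atLeast0)
    also have "\<dots> = (\<Sum>k<p. f k)" by (intro sum.cong) auto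
    finally show ?case using Suc by (simp add: algebra_simps)
  qed simp
  then show ?thesis using P assms by simp
qed

text \<open>Coordinate \<open>(i, k)\<close> is the increment along branch \<open>k\<close> of level \<open>i\<close>. Its variance depends only on the level.\<close>

abbreviation gauss_levels :: "(nat \<Rightarrow> real) \<Rightarrow> (nat \<times> nat) set \<Rightarrow> (nat \<times> nat \<Rightarrow> real) measure" where
  "gauss_levels v K \<equiv> PiM K (\<lambda>(i, k). gauss (v i))"

text \<open>The increment \<open>(i, k)\<close> is inherited by \<open>P / p i\<close> leaves, and it is shifted proportionally to its variance times
this number, so that every leaf \<open>\<gamma>\<close>, whose position is the sum of the \<open>y (i, \<gamma> mod p i)\<close>, moves by
exactly \<open>u\<close>. With this choice the linear term of the Cameron-Martin exponent is a multiple of the sum of the positions of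
the leaves.\<close>

lemma nn_integral_tree_tilt:
  fixes L :: nat and p :: "nat \<Rightarrow> nat" and v :: "nat \<Rightarrow> real"
  defines "I \<equiv> SIGMA i:{..<L}. {..<p i}"
  assumes v: "\<And>i. i < L \<Longrightarrow> 0 < v i" and p: "\<And>i. i < L \<Longrightarrow> 0 < p i" "\<And>i. i < L \<Longrightarrow> p i dvd P"
    and P: "0 < P" and \<mu>: "\<mu> = (\<Sum>i<L. v i * (real P / real (p i)))" and \<mu>0: "0 < \<mu>"
    and F: "F \<in> borel_measurable (PiM I (\<lambda>_. borel :: real measure))"
  shows "(\<integral>\<^sup>+y. F y \<partial>gauss_levels v I) =
    ennreal (exp (- (u\<^sup>2 * real P / (2 * \<mu>)))) *
    (\<integral>\<^sup>+y. F (\<lambda>(i, k)\<in>I. u * v i * (real P / real (p i)) / \<mu> + y (i, k)) *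
      ennreal (exp (- (u / \<mu>) * (\<Sum>\<gamma><P. \<Sum>i<L. y (i, \<gamma> mod p i)))) \<partial>gauss_levels v I)"
proof -
  define b where "b = (\<lambda>(i, k::nat). u * v i * (real P / real (p i)) / \<mu>)"
  have fI: "finite I" by (simp add: I_def)
  have v': "0 < (case x of (i, k) \<Rightarrow> v i)" if "x \<in> I" for x using that v by (auto simp: I_def)
  have eqI: "(\<lambda>(i, k). gauss (v i)) = (\<lambda>x. gauss (case x of (i, k) \<Rightarrow> v i))" by auto
  have lin: "(\<Sum>x\<in>I. b x * y x / (case x of (i, k) \<Rightarrow> v i)) = u / \<mu> * (\<Sum>\<gamma><P. \<Sum>i<L. y (i, \<gamma> mod p i))" for y
  proof -
    have "(\<Sum>x\<in>I. b x * y x / (case x of (i, k) \<Rightarrow> v i)) = (\<Sum>i<L. \<Sum>k<p i. b (i, k) * y (i, k) / v i)"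
      unfolding I_def by (subst sum.Sigma) (auto intro!: sum.cong)
    also have "\<dots> = (\<Sum>i<L. u / \<mu> * ((\<Sum>k<p i. y (i, k)) * (real P / real (p i))))"
    proof (rule sum.cong[OF refl])
      fix i assume "i \<in> {..<L}"
      then have "v i \<noteq> 0" using v[of i] by auto
      then have "b (i, k) * y (i, k) / v i = u / \<mu> * (real P / real (p i)) * y (i, k)" for k
        by (simp add: b_def ac_simps)
      then show "(\<Sum>k<p i. b (i, k) * y (i, k) / v i) = u / \<mu> * ((\<Sum>k<p i. y (i, k)) * (real P / real (p i)))"
        by (simp add: sum_distrib_left sum_distrib_right mult.assoc mult.left_commute mult.commute)
    qed
    also have "\<dots> = (\<Sum>i<L. u / \<mu> * (\<Sum>\<gamma><P. y (i, \<gamma> mod p i)))"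
      using p by (intro sum.cong refl) (simp add: sum_mod_dvd[where f="\<lambda>k. y (_, k)"])
    also have "\<dots> = u / \<mu> * (\<Sum>\<gamma><P. \<Sum>i<L. y (i, \<gamma> mod p i))"
      by (subst sum.swap) (simp add: sum_distrib_left)
    finally show ?thesis .
  qed
  have quad: "(\<Sum>x\<in>I. (b x)\<^sup>2 / (2 * (case x of (i, k) \<Rightarrow> v i))) = u\<^sup>2 * real P / (2 * \<mu>)"
  proof -
    have "(\<Sum>x\<in>I. (b x)\<^sup>2 / (2 * (case x of (i, k) \<Rightarrow> v i))) = (\<Sum>i<L. \<Sum>k<p i. (b (i, k))\<^sup>2 / (2 * v i))"
      unfolding I_def by (subst sum.Sigma) (auto intro!: sum.cong)
    also have "\<dots> = (\<Sum>i<L. u\<^sup>2 * real P / (2 * \<mu>\<^sup>2) * (v i * (real P / real (p i))))"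
    proof (rule sum.cong[OF refl])
      fix i assume i: "i \<in> {..<L}"
      then have "v i > 0" "real (p i) > 0" using v[of i] p(1)[of i] by auto
      then show "(\<Sum>k<p i. (b (i, k))\<^sup>2 / (2 * v i)) = u\<^sup>2 * real P / (2 * \<mu>\<^sup>2) * (v i * (real P / real (p i)))"
        using \<mu>0 by (simp add: b_def field_simps power2_eq_square)
    qed
    also have "\<dots> = u\<^sup>2 * real P / (2 * \<mu>\<^sup>2) * \<mu>" unfolding \<mu> by (simp add: sum_distrib_left)
    also have "\<dots> = u\<^sup>2 * real P / (2 * \<mu>)" using \<mu>0 by (simp add: power2_eq_square)
    finally show ?thesis .
  qed
  have F': "(\<lambda>y. F (\<lambda>i\<in>I. b i + y i)) \<in> borel_measurable (gauss_levels v I)"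
    unfolding eqI by (intro measurable_compose[OF _ F] measurable_restrict) measurable
  have "(\<lambda>y. \<Sum>x\<in>I. b x * y x / (case x of (i, k) \<Rightarrow> v i)) \<in> borel_measurable (PiM I (\<lambda>x. gauss (case x of (i, k) \<Rightarrow> v i)))"
    by measurable
  then have E: "(\<lambda>y. exp (- (u / \<mu>) * (\<Sum>\<gamma><P. \<Sum>i<L. y (i, \<gamma> mod p i)))) \<in> borel_measurable (gauss_levels v I)"
    unfolding lin eqI by simp
  have br: "(\<lambda>i\<in>I. b i + y i) = (\<lambda>(i, k)\<in>I. u * v i * (real P / real (p i)) / \<mu> + y (i, k))" for y
    by (auto simp: b_def restrict_def fun_eq_iff)
  let ?S = "\<lambda>y. \<Sum>\<gamma><P. \<Sum>i<L. y (i, \<gamma> mod p i)"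
  have "(\<integral>\<^sup>+y. F y \<partial>gauss_levels v I) =
      (\<integral>\<^sup>+y. F (\<lambda>i\<in>I. b i + y i) * ennreal (exp (- (u / \<mu> * ?S y) - u\<^sup>2 * real P / (2 * \<mu>))) \<partial>gauss_levels v I)"
    using nn_integral_PiM_gauss_shift[where b=b and v="\<lambda>(i, k). v i", OF fI v' F] unfolding lin quad eqI by simp
  also have "\<dots> = (\<integral>\<^sup>+y. ennreal (exp (- (u\<^sup>2 * real P / (2 * \<mu>)))) *
      (F (\<lambda>i\<in>I. b i + y i) * ennreal (exp (- (u / \<mu>) * ?S y))) \<partial>gauss_levels v I)"
  proof (rule nn_integral_cong)
    fix y
    have "exp (- (u / \<mu> * ?S y) - u\<^sup>2 * real P / (2 * \<mu>)) = exp (- (u\<^sup>2 * real P / (2 * \<mu>))) * exp (- (u / \<mu>) * ?S y)"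
      unfolding exp_add[symmetric] by (rule arg_cong[of _ _ exp]) algebra
    then show "F (\<lambda>i\<in>I. b i + y i) * ennreal (exp (- (u / \<mu> * ?S y) - u\<^sup>2 * real P / (2 * \<mu>))) =
      ennreal (exp (- (u\<^sup>2 * real P / (2 * \<mu>)))) * (F (\<lambda>i\<in>I. b i + y i) * ennreal (exp (- (u / \<mu>) * ?S y)))"
      by (simp only: ennreal_mult'[OF exp_ge_zero] mult.left_commute)
  qed
  also have "\<dots> = ennreal (exp (- (u\<^sup>2 * real P / (2 * \<mu>)))) *
      (\<integral>\<^sup>+y. F (\<lambda>i\<in>I. b i + y i) * ennreal (exp (- (u / \<mu>) * ?S y)) \<partial>gauss_levels v I)"
    by (rule nn_integral_cmult, rule borel_measurable_times_ennreal[OF F']) (use E in simp)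
  finally show ?thesis unfolding br .
qed



section \<open>All leaves of a Gaussian tree above a level\<close>

lemma borel_measurable_of_bool_Ex_All:
  assumes "finite J" "finite K" "\<And>j k. j \<in> J \<Longrightarrow> k \<in> K \<Longrightarrow> f j k \<in> borel_measurable N"
    "\<And>j k. j \<in> J \<Longrightarrow> k \<in> K \<Longrightarrow> g j k \<in> borel_measurable N"
  shows "(\<lambda>y. of_bool (\<exists>j\<in>J. \<forall>k\<in>K. (f j k y :: real) < g j k y) :: ennreal) \<in> borel_measurable N"
proof -
  have "{y \<in> space N. \<exists>j\<in>J. \<forall>k\<in>K. f j k y < g j k y} \<in> sets N"
    using assms by (intro sets.sets_Collect_finite_Ex sets.sets_Collect_finite_All borel_measurable_less) auto
  then have "(\<lambda>y. indicator {y \<in> space N. \<exists>j\<in>J. \<forall>k\<in>K. f j k y < g j k y} y :: ennreal) \<in> borel_measurable N"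
    by simp
  then show ?thesis
    by (rule measurable_cong[THEN iffD1, rotated]) (auto simp: indicator_def)
qed

text \<open>What is left of the event, of the Cameron-Martin factor and of the density of one level, of variance
\<open>\<sigma>2\<close>, after the shift by \<open>u\<close> and the substitution that sends the positions of the leaves to \<open>- (\<mu> / u) * x\<close>. The
sums \<open>z1\<close> come from the earlier levels, \<open>z2 j\<close> from the first \<open>j\<close> of the \<open>n\<close> later levels, and \<open>V j\<close>
is the variance of \<open>z2 j\<close>.\<close>

definition tilted_integrand ::
    "real \<Rightarrow> real \<Rightarrow> real \<Rightarrow> nat \<Rightarrow> nat \<Rightarrow> nat set \<Rightarrow> (nat \<Rightarrow> real) \<Rightarrow> (nat \<Rightarrow> real) \<Rightarrow> (nat \<Rightarrow> nat \<Rightarrow> real) \<Rightarrow> (nat \<Rightarrow> real) \<Rightarrow> ennreal" where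
  "tilted_integrand \<sigma>2 \<mu> u P n J V z1 z2 x = ennreal (\<Prod>\<gamma><P. normal_density 0 (sqrt \<sigma>2) (- (\<mu> / u) * x (Suc \<gamma>) - z1 \<gamma> - z2 n \<gamma>)) *
     (ennreal (exp (\<Sum>k=1..P. x k)) * of_bool (\<exists>j\<in>J. \<forall>\<gamma>\<in>{..<P}. x (Suc \<gamma>) < - (u / \<mu>) * z2 j \<gamma> - (u / \<mu>)\<^sup>2 * V j))"

text \<open>Levels \<open>i < \<eta>\<close> are the branching part, level \<open>\<eta>\<close> is the increment up to the time \<open>T - K / u\<^sup>2\<close>, and
the levels \<open>\<eta> + 1 + l\<close> subdivide the rest, counted backwards from \<open>T\<close>: leaving out the
levels \<open>\<eta> + 1 + l\<close> with \<open>l < j\<close> gives the position at the \<open>j\<close>-th observation time before \<open>T\<close>. After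
the shift by \<open>u\<close> the position at that time lacks the part of the shift that belongs to the omitted levels, which
turns into the drift \<open>V j\<close>. The level \<open>\<eta>\<close> has one independent coordinate per leaf, so it can be traded for
the final positions of the leaves.\<close>

lemma tree_grid_formula:
  fixes \<eta> n P :: nat and p :: "nat \<Rightarrow> nat" and v :: "nat \<Rightarrow> real"
  defines "I1 \<equiv> SIGMA i:{..<\<eta>}. {..<p i}" and "I2 \<equiv> {\<eta> + 1..<\<eta> + 1 + n} \<times> {..<P}" and "I3 \<equiv> {\<eta>} \<times> {..<P}"
  defines "\<mu> \<equiv> (\<Sum>i<\<eta>. v i * (real P / real (p i))) + v \<eta> + (\<Sum>l<n. v (\<eta> + 1 + l))"
  assumes v: "\<And>i. 0 < v i" and p: "\<And>i. i < \<eta> \<Longrightarrow> 0 < p i" "\<And>i. i < \<eta> \<Longrightarrow> p i dvd P"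
    and P: "0 < P" and u: "0 < u" and J: "J \<subseteq> {..n}"
  shows "(\<integral>\<^sup>+y. of_bool (\<exists>j\<in>J. \<forall>\<gamma>\<in>{..<P}. u < (\<Sum>i<\<eta>. y (i, \<gamma> mod p i)) + y (\<eta>, \<gamma>) + (\<Sum>l=j..<n. y (\<eta> + 1 + l, \<gamma>)))
        \<partial>gauss_levels v (I1 \<union> I2 \<union> I3)) =
    ennreal (exp (- (u\<^sup>2 * real P / (2 * \<mu>)))) *
    (\<integral>\<^sup>+y1. \<integral>\<^sup>+y2. ennreal ((\<mu> / u) ^ P) * (\<integral>\<^sup>+x. tilted_integrand (v \<eta>) \<mu> u P n J (\<lambda>j. \<Sum>l<j. v (\<eta> + 1 + l))
        (\<lambda>\<gamma>. \<Sum>i<\<eta>. y1 (i, \<gamma> mod p i)) (\<lambda>j \<gamma>. \<Sum>l<j. y2 (\<eta> + 1 + l, \<gamma>)) x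
      \<partial>PiM {1..P} (\<lambda>_. lborel)) \<partial>gauss_levels v I2 \<partial>gauss_levels v I1)"
proof -
  \<comment> \<open>From level \<open>\<eta>\<close> on, every leaf has a branch of its own.\<close>
  define p' where "p' i = (if i < \<eta> then p i else P)" for i
  define L where "L = \<eta> + 1 + n"
  define I where "I = (SIGMA i:{..<L}. {..<p' i})"
  define X where "X y \<gamma> = (\<Sum>i<\<eta>. y (i, \<gamma> mod p i)) + y (\<eta>, \<gamma>) + (\<Sum>l<n. y (\<eta> + 1 + l, \<gamma>))" for y :: "nat \<times> nat \<Rightarrow> real" and \<gamma>
  have I: "I = I1 \<union> I2 \<union> I3" "(I1 \<union> I2) \<inter> I3 = {}" "I1 \<inter> I2 = {}" "finite I1" "finite I2" "finite I3"
    by (auto simp: I_def I1_def I2_def I3_def p'_def L_def split: if_splits)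
  have finJ: "finite J" using J finite_subset by blast
  have p'0: "0 < p' i" "p' i dvd P" for i using p P by (auto simp: p'_def)
  have split_sum: "(\<Sum>i<L. f i) = (\<Sum>i<\<eta>. f i) + f \<eta> + (\<Sum>l<n. f (\<eta> + 1 + l))" for f :: "nat \<Rightarrow> real"
    unfolding L_def by (induction n) (simp_all add: ac_simps)
  have \<mu>: "\<mu> = (\<Sum>i<L. v i * (real P / real (p' i)))"
    unfolding split_sum \<mu>_def using P by (simp add: p'_def)
  have \<mu>0: "0 < \<mu>"
    unfolding \<mu>_def using v p P
    by (intro add_nonneg_pos add_pos_nonneg sum_nonneg) (auto intro: less_imp_le)
  have mem: "(i, \<gamma> mod p i) \<in> I1" if "i < \<eta>" for i \<gamma> using that p by (auto simp: I1_def)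
  have mem3: "(\<eta>, \<gamma>) \<in> I3" if "\<gamma> < P" for \<gamma> using that by (auto simp: I3_def)
  have mem2: "(Suc (\<eta> + l), \<gamma>) \<in> I2" if "l < n" "\<gamma> < P" for l \<gamma> using that by (auto simp: I2_def)
  have Xsum: "(\<Sum>i<L. y (i, \<gamma> mod p' i)) = X y \<gamma>" if "\<gamma> < P" for y \<gamma>
    unfolding split_sum X_def using that by (simp add: p'_def)
  have cm: "(\<lambda>y. y x) \<in> borel_measurable (PiM K (\<lambda>_. borel))" if "x \<in> K" for x and K :: "(nat \<times> nat) set"
    using that by (rule measurable_component_singleton)
  let ?E = "\<lambda>y. of_bool (\<exists>j\<in>J. \<forall>\<gamma>\<in>{..<P}. u < (\<Sum>i<\<eta>. y (i, \<gamma> mod p i)) + y (\<eta>, \<gamma>) + (\<Sum>l=j..<n. y (\<eta> + 1 + l, \<gamma>))) :: ennreal"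
  let ?E' = "\<lambda>y. of_bool (\<exists>j\<in>J. \<forall>\<gamma>\<in>{..<P}. (\<Sum>l<j. y (\<eta> + 1 + l, \<gamma>)) + u / \<mu> * (\<Sum>l<j. v (\<eta> + 1 + l)) < X y \<gamma>) :: ennreal"
  have ES: "?E \<in> borel_measurable (PiM I (\<lambda>_. borel))"
    using J finJ mem mem2 mem3 unfolding I
    by (intro borel_measurable_of_bool_Ex_All borel_measurable_add borel_measurable_sum cm borel_measurable_const) auto
  have XS: "(\<lambda>y. X y \<gamma>) \<in> borel_measurable (PiM I (\<lambda>_. borel))" if "\<gamma> < P" for \<gamma>
    using J finJ mem mem2 mem3 that unfolding I X_def
    by (intro borel_measurable_add borel_measurable_sum cm) auto
  have E'S: "?E' \<in> borel_measurable (PiM I (\<lambda>_. borel))"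
    using J finJ mem2 unfolding I(1)
    by (intro borel_measurable_of_bool_Ex_All XS[unfolded I(1)] borel_measurable_add borel_measurable_sum cm borel_measurable_const) auto
  \<comment> \<open>The shift moves the position at the end by \<open>u\<close>, which cancels the level.\<close>
  have tilted: "?E (\<lambda>(i, k)\<in>I. u * v i * (real P / real (p' i)) / \<mu> + y (i, k)) = ?E' y" for y
  proof -
    let ?y = "\<lambda>(i, k)\<in>I. u * v i * (real P / real (p' i)) / \<mu> + y (i, k)"
    have "(u < (\<Sum>i<\<eta>. ?y (i, \<gamma> mod p i)) + ?y (\<eta>, \<gamma>) + (\<Sum>l=j..<n. ?y (\<eta> + 1 + l, \<gamma>))) \<longleftrightarrow>
       ((\<Sum>l<j. y (\<eta> + 1 + l, \<gamma>)) + u / \<mu> * (\<Sum>l<j. v (\<eta> + 1 + l)) < X y \<gamma>)" if j: "j \<in> J" and \<gamma>: "\<gamma> < P" for j \<gamma>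
    proof -
      have jn: "j \<le> n" using j J by auto
      have spl: "(\<Sum>l<n. f l) = (\<Sum>l<j. f l) + (\<Sum>l=j..<n. f l)" for f :: "nat \<Rightarrow> real"
        using jn by (simp add: lessThan_atLeast0 sum.atLeastLessThan_concat)
      have "(\<Sum>i<\<eta>. ?y (i, \<gamma> mod p i)) + ?y (\<eta>, \<gamma>) + (\<Sum>l<n. ?y (\<eta> + 1 + l, \<gamma>)) =
        (\<Sum>i<\<eta>. u * v i * (real P / real (p i)) / \<mu> + y (i, \<gamma> mod p i)) + (u * v \<eta> / \<mu> + y (\<eta>, \<gamma>)) + (\<Sum>l<n. u * v (\<eta> + 1 + l) / \<mu> + y (\<eta> + 1 + l, \<gamma>))"
        using mem mem2 mem3 \<gamma> P by (simp add: I p'_def)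
      also have "\<dots> = X y \<gamma> + u / \<mu> * \<mu>"
      proof -
        have "u / m * \<mu> = (\<Sum>i<\<eta>. u * v i * (real P / real (p i)) / m) + u * v \<eta> / m + (\<Sum>l<n. u * v (\<eta> + 1 + l) / m)" for m
          unfolding \<mu>_def by (simp add: distrib_left sum_distrib_left ac_simps)
        then show ?thesis unfolding X_def by (simp add: sum.distrib)
      qed
      finally have tot: "(\<Sum>i<\<eta>. ?y (i, \<gamma> mod p i)) + ?y (\<eta>, \<gamma>) + (\<Sum>l<n. ?y (\<eta> + 1 + l, \<gamma>)) = X y \<gamma> + u"
        using \<mu>0 by simp
      have "(\<Sum>l<j. ?y (\<eta> + 1 + l, \<gamma>)) = (\<Sum>l<j. u / \<mu> * v (\<eta> + 1 + l) + y (\<eta> + 1 + l, \<gamma>))"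
        using mem2 \<gamma> P jn by (intro sum.cong) (auto simp: I p'_def)
      then have "(\<Sum>l<j. ?y (\<eta> + 1 + l, \<gamma>)) = u / \<mu> * (\<Sum>l<j. v (\<eta> + 1 + l)) + (\<Sum>l<j. y (\<eta> + 1 + l, \<gamma>))"
        by (simp add: sum.distrib sum_distrib_left)
      then show ?thesis using tot unfolding spl[of "\<lambda>l. ?y (\<eta> + 1 + l, \<gamma>)"] by linarith
    qed
    then show ?thesis by (intro arg_cong[of _ _ of_bool] bex_cong ball_cong refl) auto
  qed
  have eqI: "(\<lambda>(i, k::nat). gauss (v i)) = (\<lambda>x. gauss (case x of (i, k) \<Rightarrow> v i))" by auto
  interpret product_sigma_finite "\<lambda>(i, k::nat). gauss (v i)"
    unfolding product_sigma_finite_def eqI using v by (auto intro!: prob_space_imp_sigma_finite prob_space_gauss)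
  have setsI: "sets (gauss_levels v K) = sets (PiM K (\<lambda>_. borel))" for K
    by (rule sets_PiM_cong) auto
  let ?W = "\<lambda>y. ?E' y * ennreal (exp (- (u / \<mu>) * (\<Sum>\<gamma><P. X y \<gamma>)))"
  have WS: "?W \<in> borel_measurable (PiM I (\<lambda>_. borel))"
    using XS by (intro borel_measurable_times_ennreal E'S measurable_compose[OF _ measurable_ennreal] 
       borel_measurable_exp[THEN measurable_compose[rotated]] borel_measurable_times borel_measurable_const borel_measurable_sum) auto
  \<comment> \<open>Integrate out level \<open>\<eta>\<close> by substituting the scaled final positions of the leaves for it.\<close>
  have inner: "(\<integral>\<^sup>+y3. ?W (merge (I1 \<union> I2) I3 (merge I1 I2 (y1, y2), y3)) \<partial>gauss_levels v I3) =
     ennreal ((\<mu> / u) ^ P) * (\<integral>\<^sup>+x. tilted_integrand (v \<eta>) \<mu> u P n J (\<lambda>j. \<Sum>l<j. v (\<eta> + 1 + l))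
        (\<lambda>\<gamma>. \<Sum>i<\<eta>. y1 (i, \<gamma> mod p i)) (\<lambda>j \<gamma>. \<Sum>l<j. y2 (\<eta> + 1 + l, \<gamma>)) x
      \<partial>PiM {1..P} (\<lambda>_. lborel))"
    if y1: "y1 \<in> space (gauss_levels v I1)" and y2: "y2 \<in> space (gauss_levels v I2)" for y1 y2
  proof -
    let ?m = "\<lambda>y3. merge (I1 \<union> I2) I3 (merge I1 I2 (y1, y2), y3)"
    let ?b = "\<lambda>(i::nat, \<gamma>). - (\<Sum>i<\<eta>. y1 (i, \<gamma> mod p i)) - (\<Sum>l<n. y2 (\<eta> + 1 + l, \<gamma>))"
    let ?e = "\<lambda>(i::nat, \<gamma>). Suc \<gamma>"
    have bij: "bij_betw ?e I3 {1..P}"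
      unfolding bij_betw_def inj_on_def I3_def
      by (auto simp: image_iff Bex_def) (metis Suc_le_D less_Suc_eq_le Suc_le_lessD le_simps(2) One_nat_def)
    have m1: "?m y3 x = y1 x" if "x \<in> I1" for x y3 using that I by (auto simp: merge_def)
    have m2: "?m y3 x = y2 x" if "x \<in> I2" for x y3 using that I by (auto simp: merge_def)
    have m3: "?m y3 x = y3 x" if "x \<in> I3" for x y3 using that I by (auto simp: merge_def)
    have mm: "?m \<in> measurable (PiM I3 (\<lambda>_. borel)) (PiM I (\<lambda>_. borel))"
    proof -
      have "merge I1 I2 (y1, y2) \<in> space (PiM (I1 \<union> I2) (\<lambda>_. borel :: real measure))"
        using y1 y2 by (auto simp: space_PiM PiE_iff extensional_def merge_def)
      then have "(\<lambda>y3. (merge I1 I2 (y1, y2), y3)) \<in> measurable (PiM I3 (\<lambda>_. borel :: real measure)) (PiM (I1 \<union> I2) (\<lambda>_. borel) \<Otimes>\<^sub>M PiM I3 (\<lambda>_. borel :: real measure))"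
        by (intro measurable_Pair measurable_const measurable_ident_sets refl)
      from measurable_compose[OF this measurable_merge] show ?thesis by (simp add: I)
    qed
    have Wm: "(\<lambda>y3. ?W (?m y3)) \<in> borel_measurable (PiM I3 (\<lambda>_. borel))"
      by (rule measurable_compose[OF mm WS])
    have Wm': "(\<lambda>y3. ennreal (\<Prod>i\<in>I3. normal_density 0 (sqrt (case i of (i, k) \<Rightarrow> v i)) (y3 i)) * ?W (?m y3)) \<in> borel_measurable (PiM I3 (\<lambda>_. lborel))"
      using Wm unfolding measurable_cong_sets[OF sets_PiM_cong[OF refl sets_lborel] refl, symmetric]
      by (rule borel_measurable_times_ennreal[rotated]) measurable
    have r: "- (\<mu> / u) \<noteq> 0" using \<mu>0 u by simp
    have cI3: "card I3 = P" by (simp add: I3_def)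
    have "(\<integral>\<^sup>+y3. ?W (?m y3) \<partial>gauss_levels v I3) =
       (\<integral>\<^sup>+y3. ennreal (\<Prod>i\<in>I3. normal_density 0 (sqrt (case i of (i, k) \<Rightarrow> v i)) (y3 i)) * ?W (?m y3) \<partial>PiM I3 (\<lambda>_. lborel))"
      unfolding eqI by (rule nn_integral_PiM_gauss[OF I(6) _ Wm]) (auto simp: v)
    also have "\<dots> = ennreal ((\<mu> / u) ^ P) * (\<integral>\<^sup>+x. ennreal (\<Prod>i\<in>I3. normal_density 0 (sqrt (case i of (i, k) \<Rightarrow> v i)) ((\<lambda>i\<in>I3. ?b i + - (\<mu> / u) * x (?e i)) i))
        * ?W (?m (\<lambda>i\<in>I3. ?b i + - (\<mu> / u) * x (?e i))) \<partial>PiM {1..P} (\<lambda>_. lborel))"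
      using nn_integral_PiM_lborel_affine[OF I(6) bij r Wm', of ?b] \<mu>0 u by (simp add: cI3)
    also have "\<dots> = ennreal ((\<mu> / u) ^ P) * (\<integral>\<^sup>+x. tilted_integrand (v \<eta>) \<mu> u P n J (\<lambda>j. \<Sum>l<j. v (\<eta> + 1 + l))
        (\<lambda>\<gamma>. \<Sum>i<\<eta>. y1 (i, \<gamma> mod p i)) (\<lambda>j \<gamma>. \<Sum>l<j. y2 (\<eta> + 1 + l, \<gamma>)) x
      \<partial>PiM {1..P} (\<lambda>_. lborel))"
    proof (intro arg_cong[of _ _ "(*) _"] nn_integral_cong)
      fix x :: "nat \<Rightarrow> real"
      let ?y3 = "\<lambda>i\<in>I3. ?b i + - (\<mu> / u) * x (?e i)"
      have XX: "X (?m ?y3) \<gamma> = - (\<mu> / u) * x (Suc \<gamma>)" if "\<gamma> < P" for \<gamma>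
        using that mem mem2 mem3 by (simp add: X_def m1 m2 m3)
      have sX: "- (u / \<mu>) * (\<Sum>\<gamma><P. X (?m ?y3) \<gamma>) = (\<Sum>k=1..P. x k)"
      proof -
        have "(\<Sum>\<gamma><P. X (?m ?y3) \<gamma>) = - (\<mu> / u) * (\<Sum>\<gamma><P. x (Suc \<gamma>))"
          unfolding sum_distrib_left by (rule sum.cong[OF refl], rule XX) simp
        also have "(\<Sum>\<gamma><P. x (Suc \<gamma>)) = (\<Sum>k=1..P. x k)"
          by (rule sum.reindex_bij_witness[of _ "\<lambda>k. k - 1" Suc]) auto
        finally have *: "(\<Sum>\<gamma><P. X (?m ?y3) \<gamma>) = - (\<mu> / u) * (\<Sum>k=1..P. x k)" .
        show ?thesis unfolding * using \<mu>0 u by simp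
      qed
      have prd: "(\<Prod>i\<in>I3. normal_density 0 (sqrt (case i of (i, k) \<Rightarrow> v i)) (?y3 i)) = (\<Prod>\<gamma><P. normal_density 0 (sqrt (v \<eta>))
         (- (\<mu> / u) * x (Suc \<gamma>) - (\<Sum>i<\<eta>. y1 (i, \<gamma> mod p i)) - (\<Sum>l<n. y2 (\<eta> + 1 + l, \<gamma>))))"
        by (rule prod.reindex_bij_witness[of _ "\<lambda>\<gamma>. (\<eta>, \<gamma>)" snd]) (auto simp: I3_def intro!: arg_cong[where f="normal_density 0 (sqrt (v \<eta>))"])
      have ev: "((\<Sum>l<j. ?m ?y3 (\<eta> + 1 + l, \<gamma>)) + u / \<mu> * (\<Sum>l<j. v (\<eta> + 1 + l)) < X (?m ?y3) \<gamma>) \<longleftrightarrow>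
          (x (Suc \<gamma>) < - (u / \<mu>) * (\<Sum>l<j. y2 (\<eta> + 1 + l, \<gamma>)) - (u / \<mu>)\<^sup>2 * (\<Sum>l<j. v (\<eta> + 1 + l)))"
        if j: "j \<in> J" and \<gamma>: "\<gamma> < P" for j \<gamma>
      proof -
        have s: "(\<Sum>l<j. ?m ?y3 (\<eta> + 1 + l, \<gamma>)) = (\<Sum>l<j. y2 (\<eta> + 1 + l, \<gamma>))"
          using j J \<gamma> mem2 by (intro sum.cong) (auto simp: m2)
        have "(a + u / \<mu> * c < - (\<mu> / u) * z) \<longleftrightarrow> (z < - (u / \<mu>) * a - (u / \<mu>)\<^sup>2 * c)" for a c z
        proof -
          have "(a + u / \<mu> * c < - (\<mu> / u) * z) \<longleftrightarrow> (u / \<mu>) * (a + u / \<mu> * c) < (u / \<mu>) * (- (\<mu> / u) * z)"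
            using \<mu>0 u by (intro mult_less_cancel_left_pos[symmetric]) simp
          also have "(u / \<mu>) * (- (\<mu> / u) * z) = - z" using \<mu>0 u by simp
          finally show ?thesis by (auto simp: power2_eq_square algebra_simps)
        qed
        then show ?thesis unfolding s XX[OF \<gamma>] by blast
      qed
      have "?E' (?m ?y3) = of_bool (\<exists>j\<in>J. \<forall>\<gamma>\<in>{..<P}. x (Suc \<gamma>) < - (u / \<mu>) * (\<Sum>l<j. y2 (\<eta> + 1 + l, \<gamma>)) - (u / \<mu>)\<^sup>2 * (\<Sum>l<j. v (\<eta> + 1 + l)))"
        using ev by (intro arg_cong[of _ _ of_bool] bex_cong ball_cong refl) auto
      then show "ennreal (\<Prod>i\<in>I3. normal_density 0 (sqrt (case i of (i, k) \<Rightarrow> v i)) (?y3 i)) * ?W (?m ?y3) =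
        tilted_integrand (v \<eta>) \<mu> u P n J (\<lambda>j. \<Sum>l<j. v (\<eta> + 1 + l))
        (\<lambda>\<gamma>. \<Sum>i<\<eta>. y1 (i, \<gamma> mod p i)) (\<lambda>j \<gamma>. \<Sum>l<j. y2 (\<eta> + 1 + l, \<gamma>)) x"
        unfolding prd sX tilted_integrand_def by (simp only: mult.commute)
    qed
    finally show ?thesis .
  qed
  have "(\<integral>\<^sup>+y. ?E y \<partial>gauss_levels v (I1 \<union> I2 \<union> I3)) =
      ennreal (exp (- (u\<^sup>2 * real P / (2 * \<mu>)))) * (\<integral>\<^sup>+y. ?E' y * ennreal (exp (- (u / \<mu>) * (\<Sum>\<gamma><P. \<Sum>i<L. y (i, \<gamma> mod p' i)))) \<partial>gauss_levels v I)"
    using nn_integral_tree_tilt[of L v p' P \<mu> ?E u, folded I_def, OF v p'0 P \<mu> \<mu>0 ES]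
    unfolding I(1) tilted[unfolded I(1)] .
  also have "(\<integral>\<^sup>+y. ?E' y * ennreal (exp (- (u / \<mu>) * (\<Sum>\<gamma><P. \<Sum>i<L. y (i, \<gamma> mod p' i)))) \<partial>gauss_levels v I) =
     (\<integral>\<^sup>+y. ?W y \<partial>gauss_levels v (I1 \<union> I2 \<union> I3))"
    by (simp add: Xsum I)
  also have "\<dots> = (\<integral>\<^sup>+y12. \<integral>\<^sup>+y3. ?W (merge (I1 \<union> I2) I3 (y12, y3)) \<partial>gauss_levels v I3 \<partial>gauss_levels v (I1 \<union> I2))"
    using I WS by (intro product_nn_integral_fold) (auto simp: measurable_cong_sets[OF setsI refl])
  also have "\<dots> = (\<integral>\<^sup>+y1. \<integral>\<^sup>+y2. \<integral>\<^sup>+y3. ?W (merge (I1 \<union> I2) I3 (merge I1 I2 (y1, y2), y3)) \<partial>gauss_levels v I3 \<partial>gauss_levels v I2 \<partial>gauss_levels v I1)"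
  proof (rule product_nn_integral_fold[OF I(3,4,5)])
    interpret I3: sigma_finite_measure "gauss_levels v I3" by (rule sigma_finite) (rule I(6))
    have "(\<lambda>z. ?W (merge (I1 \<union> I2) I3 z)) \<in> borel_measurable (gauss_levels v (I1 \<union> I2) \<Otimes>\<^sub>M gauss_levels v I3)"
      by (rule measurable_compose[OF measurable_merge]) (use WS in \<open>simp add: measurable_cong_sets[OF setsI refl] I\<close>)
    then show "(\<lambda>y12. \<integral>\<^sup>+y3. ?W (merge (I1 \<union> I2) I3 (y12, y3)) \<partial>gauss_levels v I3) \<in> borel_measurable (gauss_levels v (I1 \<union> I2))"
      by (intro I3.borel_measurable_nn_integral) (simp add: split_beta')
  qed
  also have "\<dots> = (\<integral>\<^sup>+y1. \<integral>\<^sup>+y2. ennreal ((\<mu> / u) ^ P) * (\<integral>\<^sup>+x. tilted_integrand (v \<eta>) \<mu> u P n J (\<lambda>j. \<Sum>l<j. v (\<eta> + 1 + l))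
        (\<lambda>\<gamma>. \<Sum>i<\<eta>. y1 (i, \<gamma> mod p i)) (\<lambda>j \<gamma>. \<Sum>l<j. y2 (\<eta> + 1 + l, \<gamma>)) x
      \<partial>PiM {1..P} (\<lambda>_. lborel)) \<partial>gauss_levels v I2 \<partial>gauss_levels v I1)"
    by (intro nn_integral_cong inner)
  finally show ?thesis .
qed



section \<open>Brownian motions on a tree\<close>

lemma indep_vars_brownian_increments:
  assumes M: "prob_space M" and B: "indep_brownian_motions M D B" and D: "finite D"
    and ts0: "\<And>d. d \<in> D \<Longrightarrow> 0 \<le> ts d 0" and ts: "\<And>d j. d \<in> D \<Longrightarrow> j < n d \<Longrightarrow> ts d j \<le> ts d (Suc j)"
  shows "prob_space.indep_vars M (\<lambda>_. borel) (\<lambda>(d, j) \<omega>. B d (ts d (Suc j)) \<omega> - B d (ts d j) \<omega>) (SIGMA d:D. {..<n d})"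
proof -
  interpret prob_space M by fact
  have nn: "0 \<le> ts d j" if d: "d \<in> D" and j: "j \<le> n d" for d j
    using j
  proof (induction j)
    case (Suc j)
    then show ?case using ts[OF d, of j] by simp
  qed (use ts0[OF d] in simp)
  have "indep_vars (\<lambda>(d, j). borel) (\<lambda>(d, j) \<omega>. (\<lambda>f. f (ts d (Suc j)) - f (ts d j)) (\<lambda>t\<in>{0..}. B d t \<omega>)) (SIGMA d:D. {..<n d})"
  proof (rule indep_vars_Sigma[where N="\<lambda>_. \<Pi>\<^sub>M t\<in>{0..}. borel" and X="\<lambda>d \<omega>. \<lambda>t\<in>{0..}. B d t \<omega>"
      and M'="\<lambda>_ _. borel" and Y="\<lambda>d j f. f (ts d (Suc j)) - f (ts d j)" and J="\<lambda>d. {..<n d}" and D=D])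
    show "indep_vars (\<lambda>_. \<Pi>\<^sub>M t\<in>{0..}. borel) (\<lambda>i \<omega>. \<lambda>t\<in>{0..}. B i t \<omega>) D"
      using B by (simp add: indep_brownian_motions_def)
    fix d assume d: "d \<in> D"
    interpret b: brownian_motion M "B d" using B d by (simp add: indep_brownian_motions_def)
    have "indep_vars (\<lambda>_. borel) (\<lambda>j \<omega>. B d (ts d (Suc j)) \<omega> - B d (ts d j) \<omega>) {..<n d}"
      using b.independent_increments[of "ts d" "n d"] ts0 ts d by auto
    then show "indep_vars (\<lambda>_. borel) (\<lambda>j \<omega>. (\<lambda>t\<in>{0..}. B d t \<omega>) (ts d (Suc j)) - (\<lambda>t\<in>{0..}. B d t \<omega>) (ts d j)) {..<n d}"
      by (rule indep_vars_cong[THEN iffD1, rotated -1]) (use nn[OF d] in auto)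
  next
    fix d j assume d: "d \<in> D" and j: "j \<in> {..<n d}"
    then show "(\<lambda>f. f (ts d (Suc j)) - f (ts d j)) \<in> (\<Pi>\<^sub>M t\<in>{0..}. borel) \<rightarrow>\<^sub>M (borel :: real measure)"
      using nn by (intro borel_measurable_diff measurable_component_singleton) auto
  qed (use D in auto)
  then have 1: "indep_vars (\<lambda>_. borel) (\<lambda>(d, j) \<omega>. (\<lambda>f. f (ts d (Suc j)) - f (ts d j)) (\<lambda>t\<in>{0..}. B d t \<omega>)) (SIGMA d:D. {..<n d})"
    by (simp add: case_prod_beta')
  show ?thesis
    by (rule indep_vars_cong[THEN iffD1, OF refl _ _ 1]) (use nn in \<open>auto simp: fun_eq_iff\<close>)
qed

text \<open>One tree on \<open>\<Omega>\<close>, together with the Brownian motions on a second space \<open>\<Omega>'\<close> that describe the limit.\<close>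

locale brownian_tree = \<Omega>: prob_space \<Omega> + \<Omega>': prob_space \<Omega>'
  for \<Omega> :: "'w measure" and \<Omega>' :: "'v measure" +
  fixes T :: real and \<eta> :: nat and \<tau> :: "nat \<Rightarrow> real" and N :: "nat \<Rightarrow> nat"
    and B :: "nat \<times> nat \<Rightarrow> real \<Rightarrow> 'w \<Rightarrow> real" and Bstar :: "nat \<Rightarrow> real \<Rightarrow> 'v \<Rightarrow> real"
  assumes branching: "branching_structure T \<eta> \<tau> N"
    and drivers: "indep_brownian_motions \<Omega> (driver_index \<eta> N) B"
    and local_motions: "indep_brownian_motions \<Omega>' {1..num_branches N \<eta>} Bstar"
begin

abbreviation "p \<equiv> num_branches N"
abbreviation "P \<equiv> num_branches N \<eta>"
abbreviation "\<mu> \<equiv> mu0 T \<eta> \<tau> N"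
abbreviation "S \<equiv> T - \<tau> \<eta>"

text \<open>The position that a leaf inherits from the last branching point.\<close>

definition stem :: "'w \<Rightarrow> nat \<Rightarrow> real" where
  "stem \<omega> \<gamma> = (\<Sum>i<\<eta>. B (i, \<gamma> mod p i) (\<tau> (Suc i) - \<tau> i) \<omega>)"

text \<open>The position of leaf \<open>\<gamma>\<close> at time \<open>T - s\<close>, for times after the last branching point.\<close>

abbreviation tip :: "'w \<Rightarrow> nat \<Rightarrow> real \<Rightarrow> real" where
  "tip \<omega> \<gamma> s \<equiv> stem \<omega> \<gamma> + B (\<eta>, \<gamma>) (S - s) \<omega>"

lemma eta_pos: "0 < \<eta>" and tau_0: "\<tau> 0 = 0" and tau_end: "\<tau> (Suc \<eta>) = T"
  and tau_less: "i \<le> \<eta> \<Longrightarrow> \<tau> i < \<tau> (Suc i)" and N_pos: "i \<in> {1..\<eta>} \<Longrightarrow> 0 < N i"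
  using branching by (auto simp: branching_structure_def Suc_le_eq)

lemma S_pos: "0 < S" using tau_less[of \<eta>] tau_end by simp

lemma p_pos: "i \<le> \<eta> \<Longrightarrow> 0 < p i"
  using N_pos by (auto simp: num_branches_def intro!: prod_pos)

lemma p_dvd: "i \<le> j \<Longrightarrow> p i dvd p j"
  unfolding num_branches_def by (rule prod_dvd_prod_subset) auto

lemma P_pos: "0 < P" using p_pos by simp

text \<open>This is the sum of a row of the covariance matrix of the leaves at time \<open>T\<close>: a branch of level \<open>i\<close> is
shared by \<open>P / p i\<close> leaves.\<close>

lemma mu_eq: "\<mu> = (\<Sum>i<\<eta>. (\<tau> (Suc i) - \<tau> i) * (real P / real (p i))) + S"
proof -
  have "(\<Sum>l=1..\<eta>. (\<tau> l - \<tau> (l - 1)) * (\<Prod>j=l..\<eta>. real (N j))) = (\<Sum>i<\<eta>. (\<tau> (Suc i) - \<tau> i) * (\<Prod>j=Suc i..\<eta>. real (N j)))"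
    by (rule sum.reindex_bij_witness[of _ Suc "\<lambda>l. l - 1"]) auto
  also have "\<dots> = (\<Sum>i<\<eta>. (\<tau> (Suc i) - \<tau> i) * (real P / real (p i)))"
  proof (intro sum.cong refl arg_cong[of _ _ "(*) _"])
    fix i assume i: "i \<in> {..<\<eta>}"
    have "P = p i * (\<Prod>j=Suc i..\<eta>. N j)"
    proof -
      have "{1..\<eta>} = {1..i} \<union> {Suc i..\<eta>}" using i by auto
      then show ?thesis unfolding num_branches_def by (simp add: prod.union_disjoint)
    qed
    then show "(\<Prod>j=Suc i..\<eta>. real (N j)) = real P / real (p i)" using p_pos[of i] i by simp
  qed
  finally show ?thesis by (simp add: mu0_def)
qed

lemma mu_pos: "0 < \<mu>"
  unfolding mu_eq using S_pos tau_less by (intro add_nonneg_pos sum_nonneg mult_nonneg_nonneg) (auto intro: less_imp_le)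

lemma finite_drivers: "finite (driver_index \<eta> N)"
proof -
  have "driver_index \<eta> N = (SIGMA i:{..\<eta>}. {..<p i})" by (auto simp: driver_index_def)
  then show ?thesis by simp
qed

lemma driver: "i \<le> \<eta> \<Longrightarrow> k < p i \<Longrightarrow> brownian_motion \<Omega> (B (i, k))"
  using drivers by (auto simp: indep_brownian_motions_def driver_index_def)

lemma local_motion: "k \<in> {1..P} \<Longrightarrow> brownian_motion \<Omega>' (Bstar k)"
  using local_motions by (auto simp: indep_brownian_motions_def)

lemma driver_measurable: "i \<le> \<eta> \<Longrightarrow> k < p i \<Longrightarrow> 0 \<le> t \<Longrightarrow> B (i, k) t \<in> borel_measurable \<Omega>"
  using brownian_motion.measurable[OF driver] by blast

lemma local_measurable: "k \<in> {1..P} \<Longrightarrow> 0 \<le> t \<Longrightarrow> Bstar k t \<in> borel_measurable \<Omega>'"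
  using brownian_motion.measurable[OF local_motion] by blast

lemma stem_measurable: "(\<lambda>\<omega>. stem \<omega> \<gamma>) \<in> borel_measurable \<Omega>"
  unfolding stem_def using p_pos tau_less
  by (intro borel_measurable_sum driver_measurable) (auto intro: less_imp_le)

text \<open>The event in the definition of the limit constant, with the times restricted to \<open>Q\<close>.\<close>

definition ladder_event :: "real set \<Rightarrow> 'v \<Rightarrow> (nat \<Rightarrow> real) \<Rightarrow> bool" where
  "ladder_event Q \<omega> x \<longleftrightarrow> (\<exists>t\<in>Q. \<forall>k\<in>{1..P}. x k < Bstar k t \<omega> / \<mu> - t / \<mu>\<^sup>2)"

text \<open>The density, given \<open>stem\<close>, of the leaves at time \<open>T - K / u\<^sup>2\<close>, taken at the point from which the last
increment \<open>- Bstar K / u\<close> leads to the final position \<open>- (\<mu> / u) * x\<close>.\<close>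

definition density_factor :: "real \<Rightarrow> real \<Rightarrow> 'w \<Rightarrow> 'v \<Rightarrow> (nat \<Rightarrow> real) \<Rightarrow> real" where
  "density_factor K u \<omega> \<omega>' x = (\<Prod>\<gamma><P. normal_density 0 (sqrt (S - K / u\<^sup>2))
      ((Bstar (Suc \<gamma>) K \<omega>' - \<mu> * x (Suc \<gamma>)) / u - stem \<omega> \<gamma>))"

text \<open>This is \<open>tree_grid_formula\<close> for the increments of the drivers. The increments after \<open>T - K / u\<^sup>2\<close>, read backwards, are independent
of the past and have the law of the increments of \<open>- Bstar / u\<close>, with time scaled by \<open>u\<^sup>2\<close>, so they can be moved to \<open>\<Omega>'\<close>, where the law
of the path does not depend on \<open>u\<close>. The sum over the other levels stays on \<open>\<Omega>\<close> as \<open>stem\<close>.\<close>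

lemma exit_grid_formula:
  fixes q :: "nat \<Rightarrow> real"
  assumes n: "0 < n" and q: "q 0 = 0" "q n = K" "\<And>l. l < n \<Longrightarrow> q l < q (Suc l)"
    and u: "0 < u" "K / u\<^sup>2 < S" and J: "J \<subseteq> {..n}"
  shows "emeasure \<Omega> {\<omega> \<in> space \<Omega>. \<exists>t\<in>q ` J. \<forall>\<gamma><P. u < tip \<omega> \<gamma> (t / u\<^sup>2)} =
    ennreal (exp (- (u\<^sup>2 * real P / (2 * \<mu>)))) * (\<integral>\<^sup>+\<omega>. \<integral>\<^sup>+\<omega>'. ennreal ((\<mu> / u) ^ P) * (\<integral>\<^sup>+x. ennreal (density_factor K u \<omega> \<omega>' x) *
      (ennreal (exp (\<Sum>k=1..P. x k)) * of_bool (ladder_event (q ` J) \<omega>' x)) \<partial>PiM {1..P} (\<lambda>_. lborel)) \<partial>\<Omega>' \<partial>\<Omega>)"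
proof -
  define h where "h = K / u\<^sup>2"
  define v where "v i = (if i < \<eta> then \<tau> (Suc i) - \<tau> i else if i = \<eta> then S - h else
     if i < \<eta> + 1 + n then (q (Suc (i - \<eta> - 1)) - q (i - \<eta> - 1)) / u\<^sup>2 else 1)" for i
  define I1 where "I1 = (SIGMA i:{..<\<eta>}. {..<p i})"
  define I2 where "I2 = {\<eta> + 1..<\<eta> + 1 + n} \<times> {..<P}"
  define I3 where "I3 = {\<eta>} \<times> {..<P}"
  define ts where "ts = (\<lambda>(i, k :: nat) j. if i < \<eta> then (if j = 0 then 0 else \<tau> (Suc i) - \<tau> i)
     else (case j of 0 \<Rightarrow> 0 | Suc m \<Rightarrow> S - q (n - m) / u\<^sup>2))"
  define nn where "nn = (\<lambda>(i, k :: nat). if i < \<eta> then 1 else Suc n)"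
  \<comment> \<open>Level \<open>\<eta> + 1 + l\<close> is the increment number \<open>n - l\<close> of a driver of the last generation.\<close>
  define e where "e = (\<lambda>(i, k :: nat). if i \<le> \<eta> then ((i, k), 0) else ((\<eta>, k), n - (i - \<eta> - 1)))"
  define Y where "Y = (\<lambda>(d, j) \<omega>. B d (ts d (Suc j)) \<omega> - B d (ts d j) \<omega>)"
  have qmono: "q i < q j" if "i < j" "j \<le> n" for i j
    using that by (induction j) (use q(3) in \<open>force simp: less_Suc_eq intro: less_trans\<close>)+
  have vpos: "0 < v i" for i using tau_less[of i] u q(3) by (auto simp: v_def h_def)
  have hsum: "(\<Sum>l<n. v (\<eta> + 1 + l)) = h"
  proof -
    have "(\<Sum>l<n. v (\<eta> + 1 + l)) = (\<Sum>l<n. q (Suc l) / u\<^sup>2 - q l / u\<^sup>2)"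
      by (intro sum.cong) (auto simp: v_def diff_divide_distrib)
    also have "\<dots> = h" using sum_lessThan_telescope[of "\<lambda>l. q l / u\<^sup>2" n] q by (simp add: h_def)
    finally show ?thesis .
  qed
  have vsum: "(\<Sum>l<j. v (\<eta> + 1 + l)) = q j / u\<^sup>2" if "j \<le> n" for j
  proof -
    have "(\<Sum>l<j. v (\<eta> + 1 + l)) = (\<Sum>l<j. q (Suc l) / u\<^sup>2 - q l / u\<^sup>2)"
      using that by (intro sum.cong) (auto simp: v_def diff_divide_distrib)
    also have "\<dots> = q j / u\<^sup>2" using sum_lessThan_telescope[of "\<lambda>l. q l / u\<^sup>2" j] q by simp
    finally show ?thesis .
  qed
  have mu: "\<mu> = (\<Sum>i<\<eta>. v i * (real P / real (p i))) + v \<eta> + (\<Sum>l<n. v (\<eta> + 1 + l))"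
    unfolding mu_eq hsum by (simp add: v_def)
  have ts_mono: "ts d j \<le> ts d (Suc j)" if "d \<in> driver_index \<eta> N" "j < nn d" for d j
  proof -
    obtain i k where d: "d = (i, k)" by force
    show ?thesis
    proof (cases "i < \<eta>")
      case True then show ?thesis using that d tau_less[of i] by (auto simp: ts_def nn_def)
    next
      case False
      show ?thesis
      proof (cases j)
        case 0
        then show ?thesis using False d u q by (simp add: ts_def)
      next
        case (Suc m)
        then have "q (n - Suc m) < q (n - m)" using that d False by (intro qmono) (auto simp: nn_def)
        then show ?thesis using False d u Suc by (simp add: ts_def divide_right_mono)
      qed
    qed
  qed
  have ind: "\<Omega>.indep_vars (\<lambda>_. borel) Y (SIGMA d:driver_index \<eta> N. {..<nn d})"
    unfolding Y_def
    by (rule indep_vars_brownian_increments[where ts=ts and n=nn, OF \<Omega>.prob_space_axioms drivers finite_drivers _ ts_mono])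
       (auto simp: ts_def)
  define I where "I = I1 \<union> I2 \<union> I3"
  have finI: "finite I1" "finite I2" "finite I3" by (auto simp: I1_def I2_def I3_def)
  have I1sub: "I1 \<subseteq> I" by (auto simp: I_def)
  have I1ne: "I1 \<noteq> {}" using eta_pos p_pos[of 0] by (auto simp: I1_def)
  have I2ne: "I2 \<noteq> {}" using n P_pos by (auto simp: I2_def)
  have e: "inj_on e I" "e ` I \<subseteq> (SIGMA d:driver_index \<eta> N. {..<nn d})"
    by (auto simp: inj_on_def I_def I1_def I2_def I3_def e_def nn_def driver_index_def split: if_splits)
  have indY: "\<Omega>.indep_vars (\<lambda>_. borel) (\<lambda>x. Y (e x)) I"
    using \<Omega>.indep_vars_inj[OF ind e] .
  have zero: "B (i, k) 0 \<omega> = 0" if "i \<le> \<eta>" "k < p i" "\<omega> \<in> space \<Omega>" for i k \<omega>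
    using brownian_motion.starts_at_0[OF driver] that by blast
  have zero': "Bstar k 0 \<omega> = 0" if "k \<in> {1..P}" "\<omega> \<in> space \<Omega>'" for k \<omega>
    using brownian_motion.starts_at_0[OF local_motion] that by blast
  have Y1: "Y (e (i, k)) \<omega> = B (i, k) (\<tau> (Suc i) - \<tau> i) \<omega>" if "i < \<eta>" "k < p i" "\<omega> \<in> space \<Omega>" for i k \<omega>
    using that zero by (simp add: Y_def e_def ts_def)
  have Y3: "Y (e (\<eta>, k)) \<omega> = B (\<eta>, k) (S - h) \<omega>" if "k < P" "\<omega> \<in> space \<Omega>" for k \<omega>
    using that zero q by (simp add: Y_def e_def ts_def h_def)
  have Y2: "Y (e (\<eta> + 1 + l, k)) \<omega> = B (\<eta>, k) (S - q l / u\<^sup>2) \<omega> - B (\<eta>, k) (S - q (Suc l) / u\<^sup>2) \<omega>" if l: "l < n" for l k \<omega>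
  proof -
    obtain m where m: "n - l = Suc m" using l by (cases "n - l") auto
    then have "n - m = Suc l" "n - Suc m = l" using l by auto
    then show ?thesis using l by (simp add: Y_def e_def ts_def m)
  qed
  have dist: "distributed \<Omega> lborel (Y (e x)) (normal_density 0 (sqrt (case x of (i, k) \<Rightarrow> v i)))" if x: "x \<in> I" for x
  proof -
    obtain i k where ik: "x = (i, k)" by force
    define d j where "d = fst (e x)" and "j = snd (e x)"
    have dj: "e x = (d, j)" by (simp add: d_def j_def)
    have d: "d \<in> driver_index \<eta> N" "j < nn d" using e x dj by force+
    have v: "v i = ts d (Suc j) - ts d j"
    proof -
      consider "i < \<eta>" | "i = \<eta>" | l where "i = \<eta> + 1 + l" "l < n"
        using x ik by (auto simp: I_def I1_def I2_def I3_def) (metis add_Suc less_iff_Suc_add nat_add_left_cancel_less less_eq_Suc_le le_add_diff_inverse)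
      then show ?thesis
      proof cases
        case 1 then show ?thesis using dj ik by (auto simp: v_def e_def ts_def)
      next
        case 2 then show ?thesis using dj ik q by (auto simp: v_def e_def ts_def h_def)
      next
        case (3 l)
        obtain m where m: "n - l = Suc m" using 3 by (cases "n - l") auto
        then have "n - m = Suc l" "n - Suc m = l" using 3 by auto
        then show ?thesis using 3 dj ik m by (auto simp: v_def e_def ts_def diff_divide_distrib)
      qed
    qed
    interpret b: brownian_motion \<Omega> "B d" using drivers d by (auto simp: indep_brownian_motions_def)
    have ts_nn: "0 \<le> ts d j'" if "j' \<le> j" for j'
      using that
    proof (induction j')
      case 0 show ?case by (auto simp: ts_def split: prod.split)
    next
      case (Suc j') then show ?case using ts_mono[OF d(1), of j'] d(2) by auto
    qed
    have "distributed \<Omega> lborel (\<lambda>\<omega>. B d (ts d (Suc j)) \<omega> - B d (ts d j) \<omega>) (normal_density 0 (sqrt (ts d (Suc j) - ts d j)))"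
      using v vpos[of i] ts_nn[of j] by (intro b.normal_increments) auto
    then show ?thesis using v by (simp add: ik Y_def dj[unfolded ik])
  qed
  have eqI: "(\<lambda>(i, k::nat). gauss (v i)) = (\<lambda>x. gauss (case x of (i, k) \<Rightarrow> v i))" by auto
  have law: "(\<integral>\<^sup>+\<omega>. F (\<lambda>x\<in>K. Y (e x) \<omega>) \<partial>\<Omega>) = (\<integral>\<^sup>+y. F y \<partial>gauss_levels v K)"
    if "K \<subseteq> I" "K \<noteq> {}" "F \<in> borel_measurable (PiM K (\<lambda>_. borel))" for K F
    unfolding eqI using that dist
    by (intro \<Omega>.nn_integral_indep_gauss \<Omega>.indep_vars_subset[OF indY]) auto
  \<comment> \<open>The sign and the factor \<open>1 / u\<close> turn increments of \<open>Bstar\<close> into increments with the variances of the time-reversed tree.\<close>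
  define Y' where "Y' = (\<lambda>(i, \<gamma>) \<omega>. - (1 / u) * (Bstar (Suc \<gamma>) (q (Suc (i - \<eta> - 1))) \<omega> - Bstar (Suc \<gamma>) (q (i - \<eta> - 1)) \<omega>))"
  have q_le: "q l \<le> q (Suc l)" if "l < n" for l using q(3)[OF that] by simp
  have q_nn: "0 \<le> q l" if "l \<le> n" for l using that q(1) qmono[of 0 l] by (cases l) auto
  have ind': "\<Omega>'.indep_vars (\<lambda>_. borel) (\<lambda>(k, l) \<omega>. Bstar k (q (Suc l)) \<omega> - Bstar k (q l) \<omega>) (SIGMA k:{1..P}. {..<n})"
    by (rule indep_vars_brownian_increments[OF \<Omega>'.prob_space_axioms local_motions, of "\<lambda>_. q" "\<lambda>_. n"]) (use q q_le in auto)
  have "\<Omega>'.indep_vars (\<lambda>_. borel) (\<lambda>x. (\<lambda>(k, l) \<omega>. Bstar k (q (Suc l)) \<omega> - Bstar k (q l) \<omega>) ((\<lambda>(i, \<gamma>). (Suc \<gamma>, i - \<eta> - 1)) x)) I2"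
    by (rule \<Omega>'.indep_vars_inj[OF ind']) (auto simp: inj_on_def I2_def)
  from \<Omega>'.indep_vars_compose2[OF this, of "\<lambda>_ z. - (1 / u) * z" "\<lambda>_. borel"]
  have indY': "\<Omega>'.indep_vars (\<lambda>_. borel) Y' I2"
    by (rule \<Omega>'.indep_vars_cong[THEN iffD1, rotated -1]) (auto simp: Y'_def fun_eq_iff)
  have dist': "distributed \<Omega>' lborel (Y' x) (normal_density 0 (sqrt (case x of (i, k) \<Rightarrow> v i)))" if x: "x \<in> I2" for x
  proof -
    obtain l \<gamma> where ik: "x = (\<eta> + 1 + l, \<gamma>)" "l < n" "\<gamma> < P"
      using x by (auto simp: I2_def) (metis add_Suc le_Suc_ex less_diff_conv2 add_less_cancel_left plus_nat.simps(2))
    interpret b: brownian_motion \<Omega>' "Bstar (Suc \<gamma>)" using ik by (intro local_motion) auto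
    have D: "distributed \<Omega>' lborel (\<lambda>\<omega>. Bstar (Suc \<gamma>) (q (Suc l)) \<omega> - Bstar (Suc \<gamma>) (q l) \<omega>) (normal_density 0 (sqrt (q (Suc l) - q l)))"
      using ik q(3) q_nn by (intro b.normal_increments) auto
    have "v (Suc (\<eta> + l)) = (q (Suc l) - q l) / u\<^sup>2" using ik by (simp add: v_def)
    then have "sqrt (v (Suc (\<eta> + l))) = \<bar>- (1 / u)\<bar> * sqrt (q (Suc l) - q l)" using u by (simp add: real_sqrt_divide)
    with \<Omega>'.normal_density_affine[OF D, of "- (1 / u)" 0] show ?thesis
      using u q(3) ik by (simp add: Y'_def)
  qed
  have law': "(\<integral>\<^sup>+\<omega>. F (\<lambda>x\<in>I2. Y' x \<omega>) \<partial>\<Omega>') = (\<integral>\<^sup>+y. F y \<partial>gauss_levels v I2)"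
    if "F \<in> borel_measurable (PiM I2 (\<lambda>_. borel))" for F
    unfolding eqI using that dist' indY' I2ne by (intro \<Omega>'.nn_integral_indep_gauss) auto
  have Y'_sum: "(\<Sum>l<j. Y' (\<eta> + 1 + l, \<gamma>) \<omega>) = - (1 / u) * Bstar (Suc \<gamma>) (q j) \<omega>" if "\<gamma> < P" "\<omega> \<in> space \<Omega>'" for j \<gamma> \<omega>
  proof -
    have "(\<Sum>l<j. Y' (\<eta> + 1 + l, \<gamma>) \<omega>) = - (1 / u) * (\<Sum>l<j. Bstar (Suc \<gamma>) (q (Suc l)) \<omega> - Bstar (Suc \<gamma>) (q l) \<omega>)"
      by (simp add: Y'_def sum_distrib_left)
    then show ?thesis using zero'[of "Suc \<gamma>" \<omega>] that q(1) sum_lessThan_telescope[of "\<lambda>l. Bstar (Suc \<gamma>) (q l) \<omega>" j] by simp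
  qed
  let ?f = "tilted_integrand (v \<eta>) \<mu> u P n J (\<lambda>j. \<Sum>l<j. v (\<eta> + 1 + l))"
  define G where "G y1 y2 = ennreal ((\<mu> / u) ^ P) * (\<integral>\<^sup>+x. ?f (\<lambda>\<gamma>. \<Sum>i<\<eta>. y1 (i, \<gamma> mod p i)) (\<lambda>j \<gamma>. \<Sum>l<j. y2 (\<eta> + 1 + l, \<gamma>)) x \<partial>PiM {1..P} (\<lambda>_. lborel))" for y1 y2 :: "nat \<times> nat \<Rightarrow> real"
  interpret L: product_sigma_finite "\<lambda>_::nat. lborel :: real measure" by (rule product_sigma_finite_lborel)
  interpret L: sigma_finite_measure "PiM {1..P} (\<lambda>_. lborel :: real measure)" by (rule L.sigma_finite) simp
  have finJ: "finite J" using J finite_subset by blast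
  have Gm: "(\<lambda>(y1, y2). G y1 y2) \<in> borel_measurable (PiM I1 (\<lambda>_. borel) \<Otimes>\<^sub>M PiM I2 (\<lambda>_. borel))"
  proof -
    let ?N = "(PiM I1 (\<lambda>_. borel :: real measure) \<Otimes>\<^sub>M PiM I2 (\<lambda>_. borel :: real measure)) \<Otimes>\<^sub>M PiM {1..P} (\<lambda>_. lborel :: real measure)"
    have c1: "(\<lambda>z. \<Sum>i<\<eta>. fst (fst z) (i, \<gamma> mod p i)) \<in> borel_measurable ?N" for \<gamma>
      using p_pos by (intro borel_measurable_sum measurable_compose[OF measurable_fst] measurable_compose[OF measurable_fst measurable_component_singleton]) (auto simp: I1_def)
    have c2: "(\<lambda>z. \<Sum>l<j. snd (fst z) (\<eta> + 1 + l, \<gamma>)) \<in> borel_measurable ?N" if "j \<le> n" "\<gamma> < P" for \<gamma> j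
      using that by (intro borel_measurable_sum measurable_compose[OF measurable_fst] measurable_compose[OF measurable_snd measurable_component_singleton]) (auto simp: I2_def)
    have c3: "(\<lambda>z. snd z k) \<in> borel_measurable ?N" if "k \<in> {1..P}" for k
      using measurable_compose[OF measurable_snd measurable_component_singleton[OF that], of "PiM I1 (\<lambda>_. borel :: real measure) \<Otimes>\<^sub>M PiM I2 (\<lambda>_. borel :: real measure)" "\<lambda>_. lborel"] by simp
    have "(\<lambda>z. ?f (\<lambda>\<gamma>. \<Sum>i<\<eta>. fst (fst z) (i, \<gamma> mod p i)) (\<lambda>j \<gamma>. \<Sum>l<j. snd (fst z) (\<eta> + 1 + l, \<gamma>)) (snd z)) \<in> borel_measurable ?N"
      unfolding tilted_integrand_def using J
      by (intro borel_measurable_times_ennreal measurable_compose[OF _ measurable_ennreal] borel_measurable_of_bool_Ex_All finJ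
         borel_measurable_prod measurable_compose[OF _ borel_measurable_normal_density] borel_measurable_diff borel_measurable_times borel_measurable_const c1 c2 c3
         borel_measurable_exp[THEN measurable_compose[rotated]] borel_measurable_sum) auto
    then have "(\<lambda>z. \<integral>\<^sup>+x. ?f (\<lambda>\<gamma>. \<Sum>i<\<eta>. fst z (i, \<gamma> mod p i)) (\<lambda>j \<gamma>. \<Sum>l<j. snd z (\<eta> + 1 + l, \<gamma>)) x \<partial>PiM {1..P} (\<lambda>_. lborel))
       \<in> borel_measurable (PiM I1 (\<lambda>_. borel) \<Otimes>\<^sub>M PiM I2 (\<lambda>_. borel))"
      by (intro L.borel_measurable_nn_integral) (simp add: split_beta')
    then show ?thesis unfolding G_def by (simp add: split_beta')
  qed
  have "emeasure \<Omega> {\<omega> \<in> space \<Omega>. \<exists>t\<in>q ` J. \<forall>\<gamma><P. u < tip \<omega> \<gamma> (t / u\<^sup>2)} =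
    (\<integral>\<^sup>+\<omega>. indicator {\<omega> \<in> space \<Omega>. \<exists>t\<in>q ` J. \<forall>\<gamma><P. u < tip \<omega> \<gamma> (t / u\<^sup>2)} \<omega> \<partial>\<Omega>)"
  proof (rule nn_integral_indicator[symmetric])
    have "{\<omega> \<in> space \<Omega>. \<exists>j\<in>J. \<forall>\<gamma>\<in>{..<P}. u < tip \<omega> \<gamma> (q j / u\<^sup>2)} \<in> sets \<Omega>"
    proof (intro sets.sets_Collect_finite_Ex sets.sets_Collect_finite_All borel_measurable_less borel_measurable_add stem_measurable driver_measurable finJ)
      fix j assume "j \<in> J"
      then have "q j \<le> q n" using J qmono[of j n] by (cases "j = n") auto
      then have "q j / u\<^sup>2 \<le> K / u\<^sup>2" using q by (simp add: divide_right_mono)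
      then show "0 \<le> S - q j / u\<^sup>2" using u by linarith
    qed auto
    then show "{\<omega> \<in> space \<Omega>. \<exists>t\<in>q ` J. \<forall>\<gamma><P. u < tip \<omega> \<gamma> (t / u\<^sup>2)} \<in> sets \<Omega>"
      by (rule back_subst[of "\<lambda>A. A \<in> sets \<Omega>"]) auto
  qed
  also have "\<dots> = (\<integral>\<^sup>+\<omega>. (\<lambda>y. of_bool (\<exists>j\<in>J. \<forall>\<gamma>\<in>{..<P}. u < (\<Sum>i<\<eta>. y (i, \<gamma> mod p i)) + y (\<eta>, \<gamma>) + (\<Sum>l=j..<n. y (\<eta> + 1 + l, \<gamma>)))) (\<lambda>x\<in>I. Y (e x) \<omega>) \<partial>\<Omega>)"
  proof (rule nn_integral_cong)
    fix \<omega> assume w: "\<omega> \<in> space \<Omega>"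
    let ?y = "\<lambda>x\<in>I. Y (e x) \<omega>"
    have "(\<Sum>i<\<eta>. ?y (i, \<gamma> mod p i)) + ?y (\<eta>, \<gamma>) + (\<Sum>l=j..<n. ?y (\<eta> + 1 + l, \<gamma>)) = tip \<omega> \<gamma> (q j / u\<^sup>2)"
      if j: "j \<in> J" and g: "\<gamma> < P" for j \<gamma>
    proof -
      have jn: "j \<le> n" using j J by auto
      have 1: "(\<Sum>i<\<eta>. ?y (i, \<gamma> mod p i)) = stem \<omega> \<gamma>"
        unfolding stem_def using w p_pos by (intro sum.cong) (auto simp: I_def I1_def Y1)
      have 2: "?y (\<eta>, \<gamma>) = B (\<eta>, \<gamma>) (S - h) \<omega>" using g w by (simp add: I_def I3_def Y3)
      have "(\<Sum>l=j..<n. ?y (\<eta> + 1 + l, \<gamma>)) = (\<Sum>l=j..<n. (- B (\<eta>, \<gamma>) (S - q (Suc l) / u\<^sup>2) \<omega>) - (- B (\<eta>, \<gamma>) (S - q l / u\<^sup>2) \<omega>))"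
      proof (rule sum.cong[OF refl])
        fix l assume l: "l \<in> {j..<n}"
        then have "(\<eta> + 1 + l, \<gamma>) \<in> I" using g by (auto simp: I_def I2_def)
        then show "?y (\<eta> + 1 + l, \<gamma>) = (- B (\<eta>, \<gamma>) (S - q (Suc l) / u\<^sup>2) \<omega>) - (- B (\<eta>, \<gamma>) (S - q l / u\<^sup>2) \<omega>)"
          using Y2[of l \<gamma> \<omega>] l by simp
      qed
      also have "\<dots> = (- B (\<eta>, \<gamma>) (S - q n / u\<^sup>2) \<omega>) - (- B (\<eta>, \<gamma>) (S - q j / u\<^sup>2) \<omega>)"
        by (rule sum_Suc_diff'[OF jn])
      finally show ?thesis unfolding 1 2 using q(2) by (simp add: h_def)
    qed
    then have "(\<exists>j\<in>J. \<forall>\<gamma>\<in>{..<P}. u < (\<Sum>i<\<eta>. ?y (i, \<gamma> mod p i)) + ?y (\<eta>, \<gamma>) + (\<Sum>l=j..<n. ?y (\<eta> + 1 + l, \<gamma>))) \<longleftrightarrow>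
       (\<exists>t\<in>q ` J. \<forall>\<gamma><P. u < tip \<omega> \<gamma> (t / u\<^sup>2))"
      by (simp add: Ball_def cong: bex_cong)
    then show "indicator {\<omega> \<in> space \<Omega>. \<exists>t\<in>q ` J. \<forall>\<gamma><P. u < tip \<omega> \<gamma> (t / u\<^sup>2)} \<omega> = 
      ((\<lambda>y. of_bool (\<exists>j\<in>J. \<forall>\<gamma>\<in>{..<P}. u < (\<Sum>i<\<eta>. y (i, \<gamma> mod p i)) + y (\<eta>, \<gamma>) + (\<Sum>l=j..<n. y (\<eta> + 1 + l, \<gamma>)))) ?y :: ennreal)"
      using w by (simp add: indicator_def of_bool_def)
  qed
  also have "\<dots> = (\<integral>\<^sup>+y. of_bool (\<exists>j\<in>J. \<forall>\<gamma>\<in>{..<P}. u < (\<Sum>i<\<eta>. y (i, \<gamma> mod p i)) + y (\<eta>, \<gamma>) + (\<Sum>l=j..<n. y (\<eta> + 1 + l, \<gamma>))) \<partial>gauss_levels v I)"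
  proof (rule law)
    show "(\<lambda>y. of_bool (\<exists>j\<in>J. \<forall>\<gamma>\<in>{..<P}. u < (\<Sum>i<\<eta>. y (i, \<gamma> mod p i)) + y (\<eta>, \<gamma>) + (\<Sum>l=j..<n. y (\<eta> + 1 + l, \<gamma>))) :: ennreal) \<in> borel_measurable (PiM I (\<lambda>_. borel))"
      using J finJ p_pos
      by (intro borel_measurable_of_bool_Ex_All borel_measurable_add borel_measurable_sum measurable_component_singleton borel_measurable_const)
         (auto simp: I_def I1_def I2_def I3_def)
  qed (use I1ne I1sub in auto)
  also have "\<dots> = ennreal (exp (- (u\<^sup>2 * real P / (2 * \<mu>)))) * (\<integral>\<^sup>+y1. \<integral>\<^sup>+y2. G y1 y2 \<partial>gauss_levels v I2 \<partial>gauss_levels v I1)"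
    using tree_grid_formula[of v \<eta> p P u J n, OF vpos _ _ P_pos u(1) J] p_pos p_dvd
    unfolding mu[symmetric] I1_def[symmetric] I2_def[symmetric] I3_def[symmetric] I_def G_def by (simp add: less_imp_le)
  also have "(\<integral>\<^sup>+y1. \<integral>\<^sup>+y2. G y1 y2 \<partial>gauss_levels v I2 \<partial>gauss_levels v I1) =
     (\<integral>\<^sup>+y1. \<integral>\<^sup>+\<omega>'. G y1 (\<lambda>x\<in>I2. Y' x \<omega>') \<partial>\<Omega>' \<partial>gauss_levels v I1)"
  proof (rule nn_integral_cong, rule law'[symmetric])
    fix y1 :: "nat \<times> nat \<Rightarrow> real" assume "y1 \<in> space (gauss_levels v I1)"
    then have "y1 \<in> space (PiM I1 (\<lambda>_. borel :: real measure))" by (simp add: space_PiM PiE_iff split_beta')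
    from measurable_compose[OF measurable_Pair1'[OF this] Gm] show "G y1 \<in> borel_measurable (PiM I2 (\<lambda>_. borel))" by simp
  qed
  also have "\<dots> = (\<integral>\<^sup>+\<omega>. \<integral>\<^sup>+\<omega>'. G (\<lambda>x\<in>I1. Y (e x) \<omega>) (\<lambda>x\<in>I2. Y' x \<omega>') \<partial>\<Omega>' \<partial>\<Omega>)"
  proof (rule law[OF I1sub I1ne, symmetric])
    have Y'm: "(\<lambda>\<omega>'. \<lambda>x\<in>I2. Y' x \<omega>') \<in> measurable \<Omega>' (PiM I2 (\<lambda>_. borel))"
      using indY' by (intro measurable_restrict) (auto simp: \<Omega>'.indep_vars_def)
    have "(\<lambda>(y1, \<omega>'). (y1, \<lambda>x\<in>I2. Y' x \<omega>')) \<in> measurable (PiM I1 (\<lambda>_. borel) \<Otimes>\<^sub>M \<Omega>') (PiM I1 (\<lambda>_. borel :: real measure) \<Otimes>\<^sub>M PiM I2 (\<lambda>_. borel))"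
      unfolding split_beta' by (intro measurable_Pair measurable_fst measurable_compose[OF measurable_snd Y'm])
    from measurable_compose[OF this Gm] show "(\<lambda>y1. \<integral>\<^sup>+\<omega>'. G y1 (\<lambda>x\<in>I2. Y' x \<omega>') \<partial>\<Omega>') \<in> borel_measurable (PiM I1 (\<lambda>_. borel))"
      by (intro \<Omega>'.borel_measurable_nn_integral) (simp add: split_beta')
  qed
  also have "\<dots> = (\<integral>\<^sup>+\<omega>. \<integral>\<^sup>+\<omega>'. ennreal ((\<mu> / u) ^ P) * (\<integral>\<^sup>+x. ennreal (density_factor K u \<omega> \<omega>' x) *
      (ennreal (exp (\<Sum>k=1..P. x k)) * of_bool (ladder_event (q ` J) \<omega>' x)) \<partial>PiM {1..P} (\<lambda>_. lborel)) \<partial>\<Omega>' \<partial>\<Omega>)"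
    unfolding G_def
  proof (intro nn_integral_cong arg_cong[of _ _ "(*) _"])
    fix \<omega> \<omega>' and x :: "nat \<Rightarrow> real" assume w: "\<omega> \<in> space \<Omega>" and w': "\<omega>' \<in> space \<Omega>'"
    have 1: "(\<Sum>i<\<eta>. (\<lambda>x\<in>I1. Y (e x) \<omega>) (i, \<gamma> mod p i)) = stem \<omega> \<gamma>" for \<gamma>
      unfolding stem_def using w p_pos by (intro sum.cong) (auto simp: I1_def Y1)
    have 2: "(\<Sum>l<j. (\<lambda>x\<in>I2. Y' x \<omega>') (\<eta> + 1 + l, \<gamma>)) = - (1 / u) * Bstar (Suc \<gamma>) (q j) \<omega>'" if "\<gamma> < P" "j \<le> n" for j \<gamma>
    proof -
      have "(\<Sum>l<j. (\<lambda>x\<in>I2. Y' x \<omega>') (\<eta> + 1 + l, \<gamma>)) = (\<Sum>l<j. Y' (\<eta> + 1 + l, \<gamma>) \<omega>')"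
        using that by (intro sum.cong) (auto simp: I2_def)
      then show ?thesis using Y'_sum that w' by simp
    qed
    have 3: "(\<Prod>\<gamma><P. normal_density 0 (sqrt (v \<eta>)) (- (\<mu> / u) * x (Suc \<gamma>) - stem \<omega> \<gamma> - (\<Sum>l<n. (\<lambda>x\<in>I2. Y' x \<omega>') (\<eta> + 1 + l, \<gamma>)))) = density_factor K u \<omega> \<omega>' x"
      unfolding density_factor_def
    proof (rule prod.cong[OF refl])
      fix \<gamma> assume g: "\<gamma> \<in> {..<P}"
      have *: "- (\<mu> / u) * x (Suc \<gamma>) - stem \<omega> \<gamma> - - (1 / u) * Bstar (Suc \<gamma>) K \<omega>' = (Bstar (Suc \<gamma>) K \<omega>' - \<mu> * x (Suc \<gamma>)) / u - stem \<omega> \<gamma>"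
        by (simp add: diff_divide_distrib)
      have **: "(\<Sum>l<n. (\<lambda>x\<in>I2. Y' x \<omega>') (\<eta> + 1 + l, \<gamma>)) = - (1 / u) * Bstar (Suc \<gamma>) K \<omega>'"
        using 2[of \<gamma> n] g q(2) by simp
      then show "normal_density 0 (sqrt (v \<eta>)) (- (\<mu> / u) * x (Suc \<gamma>) - stem \<omega> \<gamma> - (\<Sum>l<n. (\<lambda>x\<in>I2. Y' x \<omega>') (\<eta> + 1 + l, \<gamma>))) =
        normal_density 0 (sqrt (S - K / u\<^sup>2)) ((Bstar (Suc \<gamma>) K \<omega>' - \<mu> * x (Suc \<gamma>)) / u - stem \<omega> \<gamma>)"
        unfolding ** * by (simp add: v_def h_def)
    qed
    have 4: "(\<exists>j\<in>J. \<forall>\<gamma>\<in>{..<P}. x (Suc \<gamma>) < - (u / \<mu>) * (\<Sum>l<j. (\<lambda>x\<in>I2. Y' x \<omega>') (\<eta> + 1 + l, \<gamma>)) - (u / \<mu>)\<^sup>2 * (\<Sum>l<j. v (\<eta> + 1 + l))) \<longleftrightarrow> ladder_event (q ` J) \<omega>' x"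
    proof -
      have "(x (Suc \<gamma>) < - (u / \<mu>) * (\<Sum>l<j. (\<lambda>x\<in>I2. Y' x \<omega>') (\<eta> + 1 + l, \<gamma>)) - (u / \<mu>)\<^sup>2 * (\<Sum>l<j. v (\<eta> + 1 + l))) \<longleftrightarrow>
        x (Suc \<gamma>) < Bstar (Suc \<gamma>) (q j) \<omega>' / \<mu> - q j / \<mu>\<^sup>2" if "j \<in> J" "\<gamma> < P" for j \<gamma>
        using 2[of \<gamma> j] vsum[of j] that J u by (auto simp: power_divide)
      moreover have "(\<forall>k\<in>{1..P}. Q k) \<longleftrightarrow> (\<forall>\<gamma>\<in>{..<P}. Q (Suc \<gamma>))" for Q
        by (auto simp: Ball_def) (metis Suc_le_D Suc_le_lessD One_nat_def)
      ultimately show ?thesis unfolding ladder_event_def by (simp cong: bex_cong)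
    qed
    show "?f (\<lambda>\<gamma>. \<Sum>i<\<eta>. (\<lambda>x\<in>I1. Y (e x) \<omega>) (i, \<gamma> mod p i)) (\<lambda>j \<gamma>. \<Sum>l<j. (\<lambda>x\<in>I2. Y' x \<omega>') (\<eta> + 1 + l, \<gamma>)) x =
      ennreal (density_factor K u \<omega> \<omega>' x) * (ennreal (exp (\<Sum>k=1..P. x k)) * of_bool (ladder_event (q ` J) \<omega>' x))"
      unfolding tilted_integrand_def 1 3 4 ..
  qed
  finally show ?thesis .
qed

end



section \<open>First passage over a curve\<close>

definition dyadic_points :: "real \<Rightarrow> real \<Rightarrow> nat \<Rightarrow> real set" where
  "dyadic_points a b m = (\<lambda>j. a + (b - a) * real j / 2 ^ m) ` {..2 ^ m}"

lemma dyadic_points_subset: "a \<le> b \<Longrightarrow> dyadic_points a b m \<subseteq> {a..b}"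
proof
  fix t assume ab: "a \<le> b" and "t \<in> dyadic_points a b m"
  then obtain j where j': "t = a + (b - a) * (real j / 2 ^ m)" "j \<le> 2 ^ m"
    by (auto simp: dyadic_points_def)
  then have j: "t = a + (b - a) * (real j / 2 ^ m)" "real j \<le> 2 ^ m"
    using of_nat_le_iff[of j "2 ^ m", where ?'a=real] by auto
  have "0 \<le> (b - a) * (real j / 2 ^ m)" using ab by simp
  moreover have "(b - a) * (real j / 2 ^ m) \<le> (b - a) * 1" using ab j by (intro mult_left_mono) auto
  ultimately show "t \<in> {a..b}" using j by auto
qed

lemma finite_dyadic_points[simp]: "finite (dyadic_points a b m)"
  by (simp add: dyadic_points_def)

lemma dyadic_points_mono: "m \<le> m' \<Longrightarrow> dyadic_points a b m \<subseteq> dyadic_points a b m'"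
proof (rule lift_Suc_mono_le[where f="dyadic_points a b"])
  fix m show "dyadic_points a b m \<subseteq> dyadic_points a b (Suc m)"
  proof
    fix t assume "t \<in> dyadic_points a b m"
    then obtain j where "t = a + (b - a) * real j / 2 ^ m" "j \<le> 2 ^ m" by (auto simp: dyadic_points_def)
    then have "t = a + (b - a) * real (2 * j) / 2 ^ Suc m" "2 * j \<le> 2 ^ Suc m" by auto
    then show "t \<in> dyadic_points a b (Suc m)" unfolding dyadic_points_def by blast
  qed
qed

text \<open>For continuous functions, being positive is an open condition, so a dense set of times suffices. This
gives measurability, and it reduces probabilities over intervals to limits over finite grids.\<close>

lemma ex_positive_iff_dyadic:
  fixes f :: "'k \<Rightarrow> real \<Rightarrow> real"
  assumes ab: "a \<le> b" and I: "finite I" and f: "\<And>k. k \<in> I \<Longrightarrow> continuous_on {a..b} (f k)"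
  shows "(\<exists>t\<in>{a..b}. \<forall>k\<in>I. 0 < f k t) \<longleftrightarrow> (\<exists>m. \<exists>t\<in>dyadic_points a b m. \<forall>k\<in>I. 0 < f k t)"
proof
  assume "\<exists>t\<in>{a..b}. \<forall>k\<in>I. 0 < f k t"
  then obtain t where t: "t \<in> {a..b}" "\<And>k. k \<in> I \<Longrightarrow> 0 < f k t" by auto
  have "\<forall>k\<in>I. eventually (\<lambda>s. 0 < f k s) (at t within {a..b})"
  proof
    fix k assume k: "k \<in> I"
    then have "(f k \<longlongrightarrow> f k t) (at t within {a..b})" using f[OF k] t(1) by (simp add: continuous_on_def)
    then show "eventually (\<lambda>s. 0 < f k s) (at t within {a..b})" using t(2)[OF k] by (rule order_tendstoD)
  qed
  then have "eventually (\<lambda>s. \<forall>k\<in>I. 0 < f k s) (at t within {a..b})" using I by (simp add: eventually_ball_finite)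
  then obtain d where d: "0 < d" "\<And>s. s \<in> {a..b} \<Longrightarrow> s \<noteq> t \<Longrightarrow> dist s t < d \<Longrightarrow> \<forall>k\<in>I. 0 < f k s"
    by (auto simp: eventually_at)
  then have d': "\<forall>k\<in>I. 0 < f k s" if "s \<in> {a..b}" "\<bar>s - t\<bar> < d" for s
    using that t by (cases "s = t") (auto simp: dist_real_def)
  show "\<exists>m. \<exists>t\<in>dyadic_points a b m. \<forall>k\<in>I. 0 < f k t"
  proof (cases "a = b")
    case True
    then have "t \<in> dyadic_points a b 0" using t by (auto simp: dyadic_points_def)
    then show ?thesis using t by blast
  next
    case False
    then have ab': "0 < b - a" using ab by simp
    obtain m where "(1 / 2) ^ m < d / (b - a)"
      using real_arch_pow_inv[of "d / (b - a)" "1/2"] d ab' by auto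
    then have m: "(b - a) / 2 ^ m < d" using ab' by (simp add: field_simps power_divide)
    define j where "j = nat \<lfloor>(t - a) * 2 ^ m / (b - a)\<rfloor>"
    define z where "z = (t - a) * 2 ^ m / (b - a)"
    have z: "0 \<le> z" "z \<le> 2 ^ m" using t ab' by (auto simp: z_def field_simps)
    have j: "real j \<le> z" "z < real j + 1" using z by (auto simp: j_def z_def[symmetric])
    have "real j \<le> 2 ^ m" using j z by linarith
    then have j2: "j \<le> 2 ^ m" using of_nat_le_iff[of j "2 ^ m", where ?'a=real] by simp
    define s where "s = a + (b - a) * real j / 2 ^ m"
    have s: "s \<in> dyadic_points a b m" using j2 by (auto simp: s_def dyadic_points_def)
    have tz: "t = a + (b - a) / 2 ^ m * z" using ab' by (simp add: z_def field_simps)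
    have "t - s = (b - a) / 2 ^ m * (z - real j)" unfolding tz s_def by (simp add: field_simps)
    moreover have "0 \<le> (b - a) / 2 ^ m * (z - real j)" using ab' j by simp
    moreover have "(b - a) / 2 ^ m * (z - real j) \<le> (b - a) / 2 ^ m * 1" using ab' j by (intro mult_left_mono) auto
    ultimately have "\<bar>s - t\<bar> < d" using m by linarith
    then have "\<forall>k\<in>I. 0 < f k s" using d'[of s] s dyadic_points_subset[OF ab, of m] by blast
    then show ?thesis using s by blast
  qed
next
  assume "\<exists>m. \<exists>t\<in>dyadic_points a b m. \<forall>k\<in>I. 0 < f k t"
  then obtain m t where "t \<in> dyadic_points a b m" "\<forall>k\<in>I. 0 < f k t" by blast
  then show "\<exists>t\<in>{a..b}. \<forall>k\<in>I. 0 < f k t" using dyadic_points_subset[OF ab, of m] by blast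
qed

lemma
  fixes F :: "'k \<Rightarrow> real \<Rightarrow> 'a \<Rightarrow> real"
  assumes ab: "a \<le> b" and I: "finite I"
    and cont: "\<And>k \<omega>. k \<in> I \<Longrightarrow> \<omega> \<in> space M \<Longrightarrow> continuous_on {a..b} (\<lambda>t. F k t \<omega>)"
    and meas: "\<And>k t. k \<in> I \<Longrightarrow> t \<in> {a..b} \<Longrightarrow> F k t \<in> borel_measurable M"
  shows sets_ex_positive: "{\<omega> \<in> space M. \<exists>t\<in>{a..b}. \<forall>k\<in>I. 0 < F k t \<omega>} \<in> sets M"
    and emeasure_dyadic_positive: "(\<lambda>m. emeasure M {\<omega> \<in> space M. \<exists>t\<in>dyadic_points a b m. \<forall>k\<in>I. 0 < F k t \<omega>})
      \<longlonglongrightarrow> emeasure M {\<omega> \<in> space M. \<exists>t\<in>{a..b}. \<forall>k\<in>I. 0 < F k t \<omega>}"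
proof -
  let ?A = "\<lambda>m. {\<omega> \<in> space M. \<exists>t\<in>dyadic_points a b m. \<forall>k\<in>I. 0 < F k t \<omega>}"
  have A: "?A m \<in> sets M" for m
    using dyadic_points_subset[OF ab, of m] I meas
    by (intro sets.sets_Collect_finite_Ex sets.sets_Collect_finite_All borel_measurable_less) auto
  have *: "{\<omega> \<in> space M. \<exists>t\<in>{a..b}. \<forall>k\<in>I. 0 < F k t \<omega>} = (\<Union>m. ?A m)"
  proof -
    have "(\<exists>t\<in>{a..b}. \<forall>k\<in>I. 0 < F k t \<omega>) \<longleftrightarrow> (\<exists>m. \<exists>t\<in>dyadic_points a b m. \<forall>k\<in>I. 0 < F k t \<omega>)"
      if "\<omega> \<in> space M" for \<omega>
      using ex_positive_iff_dyadic[OF ab I cont] that by simp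
    then have "{\<omega> \<in> space M. \<exists>t\<in>{a..b}. \<forall>k\<in>I. 0 < F k t \<omega>} = {\<omega> \<in> space M. \<exists>m. \<exists>t\<in>dyadic_points a b m. \<forall>k\<in>I. 0 < F k t \<omega>}"
      by (intro Collect_cong conj_cong refl) 
    then show ?thesis by auto
  qed
  show "{\<omega> \<in> space M. \<exists>t\<in>{a..b}. \<forall>k\<in>I. 0 < F k t \<omega>} \<in> sets M" unfolding * using A by blast
  have "?A m \<subseteq> ?A (Suc m)" for m using dyadic_points_mono[of m "Suc m" a b] by auto
  then have "incseq ?A" by (rule incseq_SucI)
  then show "(\<lambda>m. emeasure M (?A m)) \<longlonglongrightarrow> emeasure M {\<omega> \<in> space M. \<exists>t\<in>{a..b}. \<forall>k\<in>I. 0 < F k t \<omega>}"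
    unfolding * using A by (intro Lim_emeasure_incseq) auto
qed

text \<open>Split the union of the \<open>A j\<close> at the first index \<open>j\<close> that occurs. From there, the independent event \<open>D j\<close>, of probability at
least \<open>\<pi>\<close>, leads to \<open>A n\<close>.\<close>

lemma (in prob_space) first_passage_bound:
  fixes n :: nat
  assumes A: "\<And>j. j \<le> n \<Longrightarrow> A j \<in> events" and D: "\<And>j. j \<le> n \<Longrightarrow> D j \<in> events"
    and ind: "\<And>j. j \<le> n \<Longrightarrow> prob ((A j - (\<Union>i<j. A i)) \<inter> D j) = prob (A j - (\<Union>i<j. A i)) * prob (D j)"
    and \<pi>: "\<And>j. j \<le> n \<Longrightarrow> \<pi> \<le> prob (D j)" and sub: "\<And>j. j \<le> n \<Longrightarrow> A j \<inter> D j \<subseteq> A n"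
  shows "prob (\<Union>j\<le>n. A j) * \<pi> \<le> prob (A n)"
proof -
  let ?E = "\<lambda>j. A j - (\<Union>i<j. A i)"
  have E: "?E j \<in> events" if "j \<le> n" for j
    using that by (intro sets.Diff sets.finite_UN A) auto
  have disj: "disjoint_family_on ?E {..n}"
    unfolding disjoint_family_on_def
  proof (intro ballI impI)
    fix i j :: nat assume "i \<noteq> j"
    then show "?E i \<inter> ?E j = {}" by (cases "i < j") auto
  qed
  then have disjD: "disjoint_family_on (\<lambda>j. ?E j \<inter> D j) {..n}"
    unfolding disjoint_family_on_def by blast
  have UE: "(\<Union>j\<le>n. A j) = (\<Union>j\<le>n. ?E j)"
  proof
    show "(\<Union>j\<le>n. A j) \<subseteq> (\<Union>j\<le>n. ?E j)"
    proof
      fix x assume "x \<in> (\<Union>j\<le>n. A j)"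
      then obtain j where j: "j \<le> n" "x \<in> A j" by auto
      define i where "i = (LEAST i. x \<in> A i)"
      have "x \<in> A i" "i \<le> j" using j unfolding i_def by (auto intro: LeastI Least_le)
      moreover have "x \<notin> A i'" if "i' < i" for i' using that not_less_Least unfolding i_def by blast
      ultimately show "x \<in> (\<Union>j\<le>n. ?E j)" using j by (intro UN_I[of i]) auto
    qed
  qed auto
  have "prob (\<Union>j\<le>n. A j) * \<pi> = (\<Sum>j\<le>n. prob (?E j) * \<pi>)"
    unfolding UE using E disj by (subst finite_measure_finite_Union) (auto simp: sum_distrib_right)
  also have "\<dots> \<le> (\<Sum>j\<le>n. prob (?E j \<inter> D j))"
    using ind \<pi> by (intro sum_mono) (auto intro: mult_left_mono)
  also have "\<dots> = prob (\<Union>j\<le>n. ?E j \<inter> D j)"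
    using E D disjD by (subst finite_measure_finite_Union) auto
  also have "\<dots> \<le> prob (A n)" using sub A by (intro finite_measure_mono) auto
  finally show ?thesis .
qed

definition gauss_tail :: "real \<Rightarrow> real" where
  "gauss_tail a = measure (density lborel std_normal_density) {a..}"

lemma gauss_tail_pos: "0 < gauss_tail a"
proof -
  interpret prob_space "density lborel std_normal_density" by (rule prob_space_normal_density) simp
  have "emeasure (density lborel std_normal_density) {a..} \<noteq> 0"
  proof
    assume "emeasure (density lborel std_normal_density) {a..} = 0"
    then have "(\<integral>\<^sup>+x. ennreal (std_normal_density x) * indicator {a..} x \<partial>lborel) = 0"
      by (simp add: emeasure_density)
    then have "AE x in lborel. ennreal (std_normal_density x) * indicator {a..} x = 0"
      by (subst (asm) nn_integral_0_iff_AE) auto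
    then have "AE x in lborel. x \<notin> {a..}"
    proof eventually_elim
      case (elim x)
      then show ?case using normal_density_pos[of 1 0 x] by (cases "x \<in> {a..}") (simp_all add: ennreal_eq_0_iff)
    qed
    then have "emeasure lborel {a..} = 0" by (subst (asm) AE_iff_measurable[where N="{a..}"]) auto
    moreover have "emeasure lborel {a..a+1} \<le> emeasure lborel {a..}" by (intro emeasure_mono) auto
    ultimately show False by simp
  qed
  then show ?thesis unfolding gauss_tail_def by (simp add: emeasure_eq_measure zero_less_measure_iff)
qed

lemma gauss_tail_le_1: "gauss_tail a \<le> 1"
proof -
  interpret prob_space "density lborel std_normal_density" by (rule prob_space_normal_density) simp
  show ?thesis unfolding gauss_tail_def by (rule prob_le_1)
qed

text \<open>After scaling \<open>X\<close> by \<open>1 / sqrt s\<close>, the threshold is \<open>c * sqrt s \<le> \<bar>c\<bar> * sqrt s0\<close>. The bound is uniform in the length \<open>s\<close> of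
the increment.\<close>

lemma (in prob_space) gauss_tail_le_increment:
  assumes X: "distributed M lborel X (normal_density 0 (sqrt s))" and s: "0 < s" "s \<le> s0"
  shows "gauss_tail (\<bar>c\<bar> * sqrt s0) \<le> prob {\<omega> \<in> space M. c * s \<le> X \<omega>}"
proof -
  have "distributed M lborel (\<lambda>x. (X x - 0) / sqrt s) std_normal_density"
    using normal_standard_normal_convert[of "sqrt s" X 0] X s by simp
  then have X': "distributed M lborel (\<lambda>x. X x / sqrt s) std_normal_density" by simp
  have m: "(\<lambda>x. X x / sqrt s) \<in> borel_measurable M" using distributed_measurable[OF X'] by simp
  have "gauss_tail (\<bar>c\<bar> * sqrt s0) = prob {\<omega> \<in> space M. \<bar>c\<bar> * sqrt s0 \<le> X \<omega> / sqrt s}"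
  proof -
    have "gauss_tail (\<bar>c\<bar> * sqrt s0) = measure (distr M lborel (\<lambda>x. X x / sqrt s)) {\<bar>c\<bar> * sqrt s0..}"
      using X' by (simp add: gauss_tail_def distributed_def)
    also have "\<dots> = prob {\<omega> \<in> space M. \<bar>c\<bar> * sqrt s0 \<le> X \<omega> / sqrt s}"
      using m by (subst measure_distr) (auto intro!: arg_cong[of _ _ prob])
    finally show ?thesis .
  qed
  also have "\<dots> \<le> prob {\<omega> \<in> space M. c * s \<le> X \<omega>}"
  proof (rule finite_measure_mono)
    have "c * s \<le> X \<omega>" if "\<bar>c\<bar> * sqrt s0 \<le> X \<omega> / sqrt s" for \<omega>
    proof -
      have "c * s = c * sqrt s * sqrt s" using s by simp
      also have "\<dots> \<le> \<bar>c\<bar> * sqrt s0 * sqrt s" using s by (intro mult_right_mono mult_mono) auto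
      also have "\<dots> \<le> X \<omega> / sqrt s * sqrt s" using that s by (intro mult_right_mono) auto
      also have "\<dots> = X \<omega>" using s by simp
      finally show ?thesis .
    qed
    then show "{\<omega> \<in> space M. \<bar>c\<bar> * sqrt s0 \<le> X \<omega> / sqrt s} \<subseteq> {\<omega> \<in> space M. c * s \<le> X \<omega>}" by auto
    have "X \<in> borel_measurable M" using distributed_measurable[OF X] by simp
    then show "{\<omega> \<in> space M. c * s \<le> X \<omega>} \<in> events" by simp
  qed
  finally show ?thesis .
qed



text \<open>If all coordinates in \<open>D1\<close> are positive at some time, it suffices for positivity at the final
time \<open>s\<close> that each of the driving motions gains at least \<open>c\<close> times the remaining time. The starting points \<open>V k\<close> may
depend on the other motions; for a tree these are the motions before the current branching point.\<close>

theorem brownian_first_passage_bound: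
  fixes B :: "'d \<Rightarrow> real \<Rightarrow> 'w \<Rightarrow> real" and V :: "'d \<Rightarrow> ('d \<Rightarrow> real) \<Rightarrow> real"
  assumes M: "prob_space M" and B: "indep_brownian_motions M D B" and D: "finite D"
    and D1: "D1 \<subseteq> D" "D1 \<noteq> {}" and s: "0 < s" "s \<le> s0" and r: "\<And>d. d \<in> D - D1 \<Longrightarrow> 0 \<le> r d"
    and V: "\<And>k. k \<in> D1 \<Longrightarrow> V k \<in> borel_measurable (PiM (D - D1) (\<lambda>_. borel))"
  shows "measure M {\<omega> \<in> space M. \<exists>t\<in>{0..s}. \<forall>k\<in>D1. 0 < V k (\<lambda>d\<in>D - D1. B d (r d) \<omega>) + B k t \<omega> - c * t} *
      gauss_tail (\<bar>c\<bar> * sqrt s0) ^ card D1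
    \<le> measure M {\<omega> \<in> space M. \<forall>k\<in>D1. 0 < V k (\<lambda>d\<in>D - D1. B d (r d) \<omega>) + B k s \<omega> - c * s}"
proof -
  interpret prob_space M by fact
  define F where "F k t \<omega> = V k (\<lambda>d\<in>D - D1. B d (r d) \<omega>) + B k t \<omega> - c * t" for k t \<omega>
  have bm: "brownian_motion M (B d)" if "d \<in> D" for d using B that by (simp add: indep_brownian_motions_def)
  have finD1: "finite D1" using D D1 finite_subset by blast
  have Bm: "B d t \<in> borel_measurable M" if "d \<in> D" "0 \<le> t" for d t
    using brownian_motion.measurable[OF bm] that by blast
  have Fm: "F k t \<in> borel_measurable M" if "k \<in> D1" "0 \<le> t" for k t
    unfolding F_def using that D1 r
    by (intro borel_measurable_diff borel_measurable_add measurable_compose[OF _ V] measurable_restrict Bm borel_measurable_const) auto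
  have Fc: "continuous_on {0..s} (\<lambda>t. F k t \<omega>)" if "k \<in> D1" "\<omega> \<in> space M" for k \<omega>
  proof -
    have "continuous_on {0..s} (\<lambda>t. B k t \<omega>)"
    proof (rule continuous_on_subset)
      show "continuous_on {0..} (\<lambda>t. B k t \<omega>)"
        by (rule brownian_motion.continuous_paths[OF bm]) (use that D1 in auto)
    qed auto
    then show ?thesis unfolding F_def by (intro continuous_intros)
  qed
  let ?\<pi> = "gauss_tail (\<bar>c\<bar> * sqrt s0) ^ card D1"
  let ?AN = "{\<omega> \<in> space M. \<forall>k\<in>D1. 0 < F k s \<omega>}"
  have grid: "prob {\<omega> \<in> space M. \<exists>t\<in>dyadic_points 0 s m. \<forall>k\<in>D1. 0 < F k t \<omega>} * ?\<pi> \<le> prob ?AN" for m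
  proof -
    define n :: nat where "n = 2 ^ m"
    define tt where "tt j = s * real j / real n" for j
    define A where "A j = {\<omega> \<in> space M. \<forall>k\<in>D1. 0 < F k (tt j) \<omega>}" for j
    define H where "H j = {\<omega> \<in> space M. \<forall>k\<in>D1. c * (s - tt j) \<le> B k s \<omega> - B k (tt j) \<omega>}" for j
    have n: "0 < n" by (simp add: n_def)
    have tn: "tt n = s" using n by (simp add: tt_def)
    have t0: "0 \<le> tt j" for j using s by (simp add: tt_def)
    have tle: "tt i \<le> tt j" if "i \<le> j" for i j using s that n by (simp add: tt_def divide_right_mono)
    have tless: "tt j < s" if "j < n" for j using s that n by (simp add: tt_def field_simps)
    have A: "A j \<in> events" for j
      unfolding A_def using finD1 Fm t0 by (intro sets.sets_Collect_finite_All borel_measurable_less) auto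
    have H: "H j \<in> events" for j
      unfolding H_def using finD1 t0 D1 s by (intro sets.sets_Collect_finite_All borel_measurable_le borel_measurable_diff Bm) auto
    have eq: "{\<omega> \<in> space M. \<exists>t\<in>dyadic_points 0 s m. \<forall>k\<in>D1. 0 < F k t \<omega>} = (\<Union>j\<le>n. A j)"
      by (auto simp: A_def dyadic_points_def tt_def n_def)
    have "prob (\<Union>j\<le>n. A j) * ?\<pi> \<le> prob (A n)"
    proof (rule first_passage_bound[where D=H])
      fix j assume j: "j \<le> n"
      show "A j \<in> events" "H j \<in> events" by (rule A H)+
      show "A j \<inter> H j \<subseteq> A n"
      proof
        fix \<omega> assume w: "\<omega> \<in> A j \<inter> H j"
        have "0 < F k s \<omega>" if "k \<in> D1" for k
        proof -
          have "0 < F k (tt j) \<omega>" "c * (s - tt j) \<le> B k s \<omega> - B k (tt j) \<omega>" using w that by (auto simp: A_def H_def)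
          then show ?thesis by (simp add: F_def algebra_simps)
        qed
        then show "\<omega> \<in> A n" using w by (auto simp: A_def tn)
      qed
      show "?\<pi> \<le> prob (H j)"
      proof (cases "j = n")
        case True
        then have "H j = space M" by (auto simp: H_def tn)
        then show ?thesis using gauss_tail_le_1 gauss_tail_pos by (simp add: prob_space power_le_one less_imp_le)
      next
        case False
        then have jn: "j < n" using j by simp
        define e2 where "e2 = (\<lambda>i :: nat. if i = 0 then tt j else s)"
        have "indep_vars (\<lambda>_. borel) (\<lambda>(d, i) \<omega>. B d (e2 (Suc i)) \<omega> - B d (e2 i) \<omega>) (SIGMA d:D. {..<1})"
          by (rule indep_vars_brownian_increments[OF M B D, of "\<lambda>_. e2" "\<lambda>_. 1"]) (use t0 tless[OF jn] in \<open>auto simp: e2_def\<close>)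
        from indep_vars_inj[OF this, of "\<lambda>d. (d, 0)" D1]
        have ind: "indep_vars (\<lambda>_. borel) (\<lambda>d \<omega>. B d s \<omega> - B d (tt j) \<omega>) D1"
          using D1 by (auto simp: inj_on_def e2_def)
        have "H j = (\<Inter>k\<in>D1. (\<lambda>\<omega>. B k s \<omega> - B k (tt j) \<omega>) -` {c * (s - tt j)..} \<inter> space M)"
          using D1 by (auto simp: H_def)
        then have "prob (H j) = (\<Prod>k\<in>D1. prob ((\<lambda>\<omega>. B k s \<omega> - B k (tt j) \<omega>) -` {c * (s - tt j)..} \<inter> space M))"
          using indep_varsD_finite[OF ind D1(2) finD1, of "\<lambda>_. {c * (s - tt j)..}"] by simp
        also have "\<dots> \<ge> (\<Prod>k\<in>D1. gauss_tail (\<bar>c\<bar> * sqrt s0))"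
        proof (rule prod_mono, intro conjI)
          fix k assume k: "k \<in> D1"
          interpret b: brownian_motion M "B k" using bm k D1 by auto
          have "gauss_tail (\<bar>c\<bar> * sqrt s0) \<le> prob {\<omega> \<in> space M. c * (s - tt j) \<le> B k s \<omega> - B k (tt j) \<omega>}"
            using tless[OF jn] t0[of j] s by (intro gauss_tail_le_increment b.normal_increments) auto
          also have "{\<omega> \<in> space M. c * (s - tt j) \<le> B k s \<omega> - B k (tt j) \<omega>} = (\<lambda>\<omega>. B k s \<omega> - B k (tt j) \<omega>) -` {c * (s - tt j)..} \<inter> space M" by auto
          finally show "gauss_tail (\<bar>c\<bar> * sqrt s0) \<le> prob \<dots>" .
        qed (use gauss_tail_pos in \<open>simp add: less_imp_le\<close>)
        finally show ?thesis by simp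
      qed
      define nn where "nn d = (if d \<in> D1 then n else 1)" for d
      define ts where "ts d i = (if d \<in> D1 then tt i else if i = 0 then 0 else r d)" for d i
      define U where "U = (\<lambda>(d, i) \<omega>. B d (ts d (Suc i)) \<omega> - B d (ts d i) \<omega>)"
      define K1 where "K1 = (D - D1) \<times> {0} \<union> D1 \<times> {..<j}"
      define K2 where "K2 = D1 \<times> {j..<n}"
      have indU: "indep_vars (\<lambda>_. borel) U (SIGMA d:D. {..<nn d})"
        unfolding U_def by (rule indep_vars_brownian_increments[OF M B D]) (use r tle t0 in \<open>auto simp: ts_def nn_def split: if_splits\<close>)
      have indK: "indep_var (PiM K1 (\<lambda>_. borel)) (\<lambda>\<omega>. restrict (\<lambda>i. U i \<omega>) K1) (PiM K2 (\<lambda>_. borel)) (\<lambda>\<omega>. restrict (\<lambda>i. U i \<omega>) K2)"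
        by (rule indep_var_restrict[OF indU]) (use D1 j n in \<open>auto simp: K1_def K2_def nn_def\<close>)
      have zero: "B d 0 \<omega> = 0" if "d \<in> D" "\<omega> \<in> space M" for d \<omega> using brownian_motion.starts_at_0[OF bm] that by blast
      have Usum: "(\<Sum>l<i. U (k, l) \<omega>) = B k (tt i) \<omega>" if "k \<in> D1" "\<omega> \<in> space M" for k i \<omega>
        using sum_lessThan_telescope[of "\<lambda>l. B k (tt l) \<omega>" i] zero[of k \<omega>] that D1 by (auto simp: U_def ts_def tt_def)
      have Usum2: "(\<Sum>l=j..<n. U (k, l) \<omega>) = B k s \<omega> - B k (tt j) \<omega>" if "k \<in> D1" "\<omega> \<in> space M" for k \<omega>
        using sum_Suc_diff'[OF j, of "\<lambda>l. B k (tt l) \<omega>"] that tn by (auto simp: U_def ts_def)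
      define g where "g i k f = V k (\<lambda>d\<in>D - D1. f (d, 0)) + (\<Sum>l<i. f (k, l)) - c * tt i" for i k and f :: "'d \<times> nat \<Rightarrow> real"
      define X1 where "X1 = {f \<in> space (PiM K1 (\<lambda>_. borel :: real measure)). (\<forall>k\<in>D1. 0 < g j k f) \<and> \<not> (\<exists>i\<in>{..<j}. \<forall>k\<in>D1. 0 < g i k f)}"
      define X2 where "X2 = {f \<in> space (PiM K2 (\<lambda>_. borel :: real measure)). \<forall>k\<in>D1. c * (s - tt j) \<le> (\<Sum>l=j..<n. f (k, l))}"
      have gm: "g i k \<in> borel_measurable (PiM K1 (\<lambda>_. borel))" if "i \<le> j" "k \<in> D1" for i k
        unfolding g_def using that
        by (intro borel_measurable_diff borel_measurable_add measurable_compose[OF _ V] measurable_restrict borel_measurable_sum measurable_component_singleton borel_measurable_const)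
           (auto simp: K1_def)
      have X1s: "X1 \<in> sets (PiM K1 (\<lambda>_. borel))"
        unfolding X1_def using finD1
        by (intro sets.sets_Collect_conj sets.sets_Collect_neg sets.sets_Collect_finite_Ex sets.sets_Collect_finite_All borel_measurable_less gm borel_measurable_const) auto
      have X2s: "X2 \<in> sets (PiM K2 (\<lambda>_. borel))"
        unfolding X2_def using finD1
        by (intro sets.sets_Collect_finite_All borel_measurable_le borel_measurable_sum measurable_component_singleton borel_measurable_const) (auto simp: K2_def)
      have gF: "g i k (restrict (\<lambda>x. U x \<omega>) K1) = F k (tt i) \<omega>" if "i \<le> j" "k \<in> D1" "\<omega> \<in> space M" for i k \<omega>
      proof -
        have 1: "(\<lambda>d\<in>D - D1. restrict (\<lambda>x. U x \<omega>) K1 (d, 0)) = (\<lambda>d\<in>D - D1. B d (r d) \<omega>)"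
          using zero that by (auto simp: K1_def U_def ts_def fun_eq_iff)
        have 2: "(\<Sum>l<i. restrict (\<lambda>x. U x \<omega>) K1 (k, l)) = (\<Sum>l<i. U (k, l) \<omega>)"
          using that by (intro sum.cong) (auto simp: K1_def)
        show ?thesis unfolding g_def F_def 1 2 Usum[OF that(2,3)] ..
      qed
      have E1: "(\<lambda>\<omega>. restrict (\<lambda>i. U i \<omega>) K1) -` X1 \<inter> space M = A j - (\<Union>i<j. A i)"
      proof -
        have "(restrict (\<lambda>i. U i \<omega>) K1 \<in> X1) = ((\<forall>k\<in>D1. 0 < F k (tt j) \<omega>) \<and> \<not> (\<exists>i\<in>{..<j}. \<forall>k\<in>D1. 0 < F k (tt i) \<omega>))"
          if w: "\<omega> \<in> space M" for \<omega>
        proof -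
          have "restrict (\<lambda>i. U i \<omega>) K1 \<in> space (PiM K1 (\<lambda>_. borel :: real measure))" by (simp add: space_PiM)
          moreover have "(\<forall>k\<in>D1. 0 < g i k (restrict (\<lambda>i. U i \<omega>) K1)) = (\<forall>k\<in>D1. 0 < F k (tt i) \<omega>)" if "i \<le> j" for i
            using gF[OF that _ w] by (intro ball_cong refl) simp
          moreover from this have "(\<exists>i\<in>{..<j}. \<forall>k\<in>D1. 0 < g i k (restrict (\<lambda>i. U i \<omega>) K1)) = (\<exists>i\<in>{..<j}. \<forall>k\<in>D1. 0 < F k (tt i) \<omega>)"
            by (intro bex_cong refl) simp
          ultimately show ?thesis unfolding X1_def mem_Collect_eq by (simp only: order.refl simp_thms)
        qed
        then show ?thesis by (auto simp: A_def)
      qed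
      have E2: "(\<lambda>\<omega>. restrict (\<lambda>i. U i \<omega>) K2) -` X2 \<inter> space M = H j"
      proof -
        have "(\<Sum>l=j..<n. restrict (\<lambda>i. U i \<omega>) K2 (k, l)) = B k s \<omega> - B k (tt j) \<omega>" if "k \<in> D1" "\<omega> \<in> space M" for k \<omega>
          unfolding Usum2[OF that, symmetric] using that by (intro sum.cong) (auto simp: K2_def)
        then have "(restrict (\<lambda>i. U i \<omega>) K2 \<in> X2) = (\<forall>k\<in>D1. c * (s - tt j) \<le> B k s \<omega> - B k (tt j) \<omega>)" if "\<omega> \<in> space M" for \<omega>
          using that unfolding X2_def by (simp add: space_PiM)
        then show ?thesis by (auto simp: H_def)
      qed
      have "prob ((\<lambda>\<omega>. (restrict (\<lambda>i. U i \<omega>) K1, restrict (\<lambda>i. U i \<omega>) K2)) -` (X1 \<times> X2) \<inter> space M) =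
        prob ((\<lambda>\<omega>. restrict (\<lambda>i. U i \<omega>) K1) -` X1 \<inter> space M) * prob ((\<lambda>\<omega>. restrict (\<lambda>i. U i \<omega>) K2) -` X2 \<inter> space M)"
        by (rule indep_varD[OF indK X1s X2s])
      moreover have "(\<lambda>\<omega>. (restrict (\<lambda>i. U i \<omega>) K1, restrict (\<lambda>i. U i \<omega>) K2)) -` (X1 \<times> X2) \<inter> space M = (A j - (\<Union>i<j. A i)) \<inter> H j"
        unfolding E1[symmetric] E2[symmetric] by auto
      ultimately show "prob ((A j - (\<Union>i<j. A i)) \<inter> H j) = prob (A j - (\<Union>i<j. A i)) * prob (H j)"
        unfolding E1 E2 by simp
    qed
    then show ?thesis unfolding eq by (simp add: A_def tn)
  qed
  have "(\<lambda>m. emeasure M {\<omega> \<in> space M. \<exists>t\<in>dyadic_points 0 s m. \<forall>k\<in>D1. 0 < F k t \<omega>})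
      \<longlonglongrightarrow> emeasure M {\<omega> \<in> space M. \<exists>t\<in>{0..s}. \<forall>k\<in>D1. 0 < F k t \<omega>}"
    using s finD1 Fc Fm by (intro emeasure_dyadic_positive) auto
  then have "(\<lambda>m. prob {\<omega> \<in> space M. \<exists>t\<in>dyadic_points 0 s m. \<forall>k\<in>D1. 0 < F k t \<omega>})
      \<longlonglongrightarrow> prob {\<omega> \<in> space M. \<exists>t\<in>{0..s}. \<forall>k\<in>D1. 0 < F k t \<omega>}"
    by (simp add: emeasure_eq_measure)
  then have "prob {\<omega> \<in> space M. \<exists>t\<in>{0..s}. \<forall>k\<in>D1. 0 < F k t \<omega>} * ?\<pi> \<le> prob ?AN"
    by (intro LIMSEQ_le_const2[OF tendsto_mult_right]) (use grid in auto)
  then show ?thesis by (simp add: F_def)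
qed



context brownian_tree
begin

section \<open>Paths of a tree\<close>

lemma stacked_tree_eq:
  "stacked_tree \<tau> N B i t \<omega> k = (\<Sum>l<i. B (l, k mod p l) (\<tau> (Suc l) - \<tau> l) \<omega>) + B (i, k) (t - \<tau> i) \<omega>"
proof (induction i arbitrary: t k)
  case 0 then show ?case by (simp add: tau_0)
next
  case (Suc i)
  have "(k mod p i) mod p l = k mod p l" if "l < i" for l
    using that by (intro mod_mod_cancel p_dvd) simp
  then show ?case by (simp add: Suc)
qed

definition level_path :: "nat \<Rightarrow> nat \<Rightarrow> real \<Rightarrow> 'w \<Rightarrow> real" where
  "level_path i \<gamma> t \<omega> = (\<Sum>l<i. B (l, \<gamma> mod p l) (\<tau> (Suc l) - \<tau> l) \<omega>) + B (i, \<gamma> mod p i) (t - \<tau> i) \<omega>"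

lemma tau_strict_mono: "i < j \<Longrightarrow> j \<le> Suc \<eta> \<Longrightarrow> \<tau> i < \<tau> j"
proof (induction j)
  case (Suc j)
  then show ?case using tau_less[of j] by (cases "i = j") auto
qed simp

lemma tau_mono: "i \<le> j \<Longrightarrow> j \<le> Suc \<eta> \<Longrightarrow> \<tau> i \<le> \<tau> j"
  using tau_strict_mono[of i j] by (cases "i = j") auto

lemma branching_level_eq:
  assumes i: "i \<le> \<eta>" and t: "\<tau> i < t" "t \<le> \<tau> (Suc i)"
  shows "branching_level \<eta> \<tau> t = i"
proof (cases "i = 0")
  case True then show ?thesis using t by (simp add: branching_level_def)
next
  case False
  then have "\<tau> 1 < t" using tau_mono[of 1 i] i t by simp
  moreover have "Max {j \<in> {1..\<eta>}. \<tau> j < t} = i"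
  proof (rule Max_eqI)
    fix j assume "j \<in> {j \<in> {1..\<eta>}. \<tau> j < t}"
    then show "j \<le> i" using tau_mono[of "Suc i" j] t by (cases "j \<le> i") auto
  qed (use False i t in auto)
  ultimately show ?thesis by (simp add: branching_level_def)
qed

lemma driver_0: "i \<le> \<eta> \<Longrightarrow> k < p i \<Longrightarrow> \<omega> \<in> space \<Omega> \<Longrightarrow> B (i, k) 0 \<omega> = 0"
  using brownian_motion.starts_at_0[OF driver] by blast

text \<open>At \<open>t = \<tau> i\<close> the definition still uses the previous level; both formulas agree there because the drivers start at \<open>0\<close>, which
makes the tree continuous on closed intervals between branching points.\<close>

lemma decision_tree_eq:
  assumes i: "i \<le> \<eta>" and t: "t \<in> {\<tau> i..\<tau> (Suc i)}" and w: "\<omega> \<in> space \<Omega>"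
  shows "decision_tree \<eta> \<tau> N B \<gamma> t \<omega> = level_path i \<gamma> t \<omega>"
proof -
  have A: "stacked_tree \<tau> N B j t \<omega> (\<gamma> mod p j) = level_path j \<gamma> t \<omega>" if "j \<le> \<eta>" for j t
  proof -
    have "(\<gamma> mod p j) mod p l = \<gamma> mod p l" if "l < j" for l
      using that by (intro mod_mod_cancel p_dvd) simp
    then show ?thesis by (simp add: stacked_tree_eq level_path_def)
  qed
  consider "\<tau> i < t" | "t = \<tau> i" "i = 0" | j where "t = \<tau> i" "i = Suc j" using t by (cases "t = \<tau> i"; cases i) auto
  then show ?thesis
  proof cases
    case 1 then show ?thesis using branching_level_eq[OF i 1] t A[OF i] by (simp add: decision_tree_def)
  next
    case 2
    have "branching_level \<eta> \<tau> t = 0" using 2 tau_less[of 0] by (simp add: branching_level_def)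
    then show ?thesis using 2 A[OF i] by (simp add: decision_tree_def)
  next
    case (3 j)
    have "branching_level \<eta> \<tau> t = j" using 3 i tau_less[of j] by (intro branching_level_eq) auto
    then have "decision_tree \<eta> \<tau> N B \<gamma> t \<omega> = level_path j \<gamma> t \<omega>" using 3 i A[of j] by (simp add: decision_tree_def)
    also have "\<dots> = level_path i \<gamma> t \<omega>" using 3 i w driver_0[of i "\<gamma> mod p i" \<omega>] p_pos[OF i] by (simp add: level_path_def)
    finally show ?thesis .
  qed
qed

lemma level_path_mod: "level_path i (\<gamma> mod p i) t \<omega> = level_path i \<gamma> t \<omega>"
proof -
  have "(\<gamma> mod p i) mod p l = \<gamma> mod p l" if "l < i" for l
    using that by (intro mod_mod_cancel p_dvd) simp
  then show ?thesis by (simp add: level_path_def)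
qed

lemma p_le_P: "i \<le> \<eta> \<Longrightarrow> p i \<le> P"
  using p_dvd[of i \<eta>] P_pos by (intro dvd_imp_le) auto

lemma all_leaves_iff:
  assumes "i \<le> \<eta>"
  shows "(\<forall>\<gamma>\<in>leaves \<eta> N. Q (level_path i \<gamma> t \<omega>)) \<longleftrightarrow> (\<forall>k\<in>{..<p i}. Q (level_path i k t \<omega>))"
proof
  assume "\<forall>\<gamma>\<in>leaves \<eta> N. Q (level_path i \<gamma> t \<omega>)"
  then show "\<forall>k\<in>{..<p i}. Q (level_path i k t \<omega>)" using p_le_P[OF assms] by (auto simp: leaves_def)
next
  assume A: "\<forall>k\<in>{..<p i}. Q (level_path i k t \<omega>)"
  show "\<forall>\<gamma>\<in>leaves \<eta> N. Q (level_path i \<gamma> t \<omega>)"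
    using A p_pos[OF assms] level_path_mod[of i _ t \<omega>] by (metis lessThan_iff mod_less_divisor)
qed

lemma level_path_measurable: "i \<le> \<eta> \<Longrightarrow> \<tau> i \<le> t \<Longrightarrow> level_path i \<gamma> t \<in> borel_measurable \<Omega>"
  unfolding level_path_def using p_pos tau_less
  by (intro borel_measurable_add borel_measurable_sum driver_measurable) (auto intro: less_imp_le)

lemma level_path_continuous:
  assumes "i \<le> \<eta>" "\<omega> \<in> space \<Omega>"
  shows "continuous_on {\<tau> i..} (\<lambda>t. level_path i \<gamma> t \<omega>)"
proof -
  have c: "continuous_on {0..} (\<lambda>t. B (i, \<gamma> mod p i) t \<omega>)"
    using assms p_pos by (intro brownian_motion.continuous_paths[OF driver]) auto
  have "continuous_on {\<tau> i..} (\<lambda>t. B (i, \<gamma> mod p i) (t - \<tau> i) \<omega>)"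
    by (rule continuous_on_compose2[OF c]) (auto intro!: continuous_intros)
  then show ?thesis unfolding level_path_def by (intro continuous_intros)
qed

definition exceeds :: "real \<Rightarrow> real \<Rightarrow> real \<Rightarrow> real \<Rightarrow> 'w \<Rightarrow> bool" where
  "exceeds c x u t \<omega> \<longleftrightarrow> (\<forall>\<gamma>\<in>leaves \<eta> N. u < drifted_tree \<eta> \<tau> N B c x \<gamma> t \<omega>)"

abbreviation above_event :: "real \<Rightarrow> real \<Rightarrow> real \<Rightarrow> real \<Rightarrow> 'w set" where
  "above_event c x u t \<equiv> {\<omega> \<in> space \<Omega>. exceeds c x u t \<omega>}"

abbreviation exit_event :: "real \<Rightarrow> real \<Rightarrow> real \<Rightarrow> real \<Rightarrow> 'w set" where
  "exit_event c x u t1 \<equiv> {\<omega> \<in> space \<Omega>. \<exists>t\<in>{0..t1}. exceeds c x u t \<omega>}"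

abbreviation level_exit_event :: "real \<Rightarrow> real \<Rightarrow> real \<Rightarrow> nat \<Rightarrow> real \<Rightarrow> 'w set" where
  "level_exit_event c x u i t1 \<equiv> {\<omega> \<in> space \<Omega>. \<exists>t\<in>{\<tau> i..t1}. exceeds c x u t \<omega>}"

lemma exceeds_iff:
  assumes "i \<le> \<eta>" "t \<in> {\<tau> i..\<tau> (Suc i)}" "\<omega> \<in> space \<Omega>"
  shows "exceeds c x u t \<omega> \<longleftrightarrow> (\<forall>k\<in>{..<p i}. 0 < level_path i k t \<omega> + (x - c * t) - u)"
proof -
  have "exceeds c x u t \<omega> \<longleftrightarrow> (\<forall>\<gamma>\<in>leaves \<eta> N. 0 < level_path i \<gamma> t \<omega> + (x - c * t) - u)"
    unfolding exceeds_def drifted_tree_def decision_tree_eq[OF assms] by auto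
  also have "\<dots> \<longleftrightarrow> (\<forall>k\<in>{..<p i}. 0 < level_path i k t \<omega> + (x - c * t) - u)"
    by (rule all_leaves_iff[OF assms(1), of "\<lambda>z. 0 < z + (x - c * t) - u"])
  finally show ?thesis .
qed

lemma level_exceeds_eq:
  assumes "i \<le> \<eta>" "t1 \<le> \<tau> (Suc i)"
  shows "level_exit_event c x u i t1 =
    {\<omega> \<in> space \<Omega>. \<exists>t\<in>{\<tau> i..t1}. \<forall>k\<in>{..<p i}. 0 < level_path i k t \<omega> + (x - c * t) - u}"
  using assms by (intro Collect_cong conj_cong refl bex_cong exceeds_iff) auto

lemma level_exceeds_dyadic:
  assumes "i \<le> \<eta>" "\<tau> i \<le> t1" "t1 \<le> \<tau> (Suc i)" "\<omega> \<in> space \<Omega>"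
  shows "(\<exists>t\<in>{\<tau> i..t1}. exceeds c x u t \<omega>) \<longleftrightarrow> (\<exists>m. \<exists>t\<in>dyadic_points (\<tau> i) t1 m. exceeds c x u t \<omega>)"
proof -
  have "(\<exists>t\<in>{\<tau> i..t1}. exceeds c x u t \<omega>) \<longleftrightarrow> (\<exists>t\<in>{\<tau> i..t1}. \<forall>k\<in>{..<p i}. 0 < level_path i k t \<omega> + (x - c * t) - u)"
    using assms by (intro bex_cong refl exceeds_iff) auto
  also have "\<dots> \<longleftrightarrow> (\<exists>m. \<exists>t\<in>dyadic_points (\<tau> i) t1 m. \<forall>k\<in>{..<p i}. 0 < level_path i k t \<omega> + (x - c * t) - u)"
  proof (rule ex_positive_iff_dyadic[OF assms(2)])
    fix k
    show "continuous_on {\<tau> i..t1} (\<lambda>t. level_path i k t \<omega> + (x - c * t) - u)"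
      by (intro continuous_intros continuous_on_subset[OF level_path_continuous[OF assms(1,4)]]) auto
  qed simp
  also have "\<dots> \<longleftrightarrow> (\<exists>m. \<exists>t\<in>dyadic_points (\<tau> i) t1 m. exceeds c x u t \<omega>)"
  proof (intro ex_cong1 bex_cong refl)
    fix m t assume "t \<in> dyadic_points (\<tau> i) t1 m"
    then have "t \<in> {\<tau> i..\<tau> (Suc i)}" using dyadic_points_subset[OF assms(2), of m] assms by auto
    then show "(\<forall>k\<in>{..<p i}. 0 < level_path i k t \<omega> + (x - c * t) - u) = exceeds c x u t \<omega>"
      using exceeds_iff[of i t \<omega>] assms by blast
  qed
  finally show ?thesis .
qed

lemma sets_level_exceeds:
  assumes "i \<le> \<eta>" "\<tau> i \<le> t1" "t1 \<le> \<tau> (Suc i)"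
  shows "level_exit_event c x u i t1 \<in> sets \<Omega>"
  unfolding level_exceeds_eq[OF assms(1,3)]
proof (rule sets_ex_positive[OF assms(2)])
  fix k \<omega> assume "\<omega> \<in> space \<Omega>"
  then show "continuous_on {\<tau> i..t1} (\<lambda>t. level_path i k t \<omega> + (x - c * t) - u)"
    by (intro continuous_intros continuous_on_subset[OF level_path_continuous[OF assms(1)]]) auto
next
  fix k t assume "t \<in> {\<tau> i..t1}"
  then show "(\<lambda>\<omega>. level_path i k t \<omega> + (x - c * t) - u) \<in> borel_measurable \<Omega>"
    by (intro borel_measurable_add borel_measurable_diff level_path_measurable[OF assms(1)] borel_measurable_const) auto
qed simp

lemma interval_levels: "t \<in> {0..T} \<Longrightarrow> \<exists>i\<le>\<eta>. t \<in> {\<tau> i..\<tau> (Suc i)}"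
proof -
  have "\<exists>i\<le>j. t \<in> {\<tau> i..\<tau> (Suc i)}" if "0 \<le> t" "t \<le> \<tau> (Suc j)" for j
    using that
  proof (induction j)
    case 0 then show ?case using tau_0 by auto
  next
    case (Suc j)
    then show ?case by (cases "t \<le> \<tau> (Suc j)") (auto intro: le_SucI)
  qed
  from this[of \<eta>] show "t \<in> {0..T} \<Longrightarrow> \<exists>i\<le>\<eta>. t \<in> {\<tau> i..\<tau> (Suc i)}" using tau_end by auto
qed

lemma exit_time_levels:
  assumes t1: "\<tau> \<eta> \<le> t1" "t1 \<le> T"
  shows "exit_event c x u t1 =
    (\<Union>i\<le>\<eta>. level_exit_event c x u i (if i < \<eta> then \<tau> (Suc i) else t1))"
proof -
  have A: "\<exists>i\<le>\<eta>. t \<in> {\<tau> i..if i < \<eta> then \<tau> (Suc i) else t1}" if t: "t \<in> {0..t1}" for t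
  proof -
    obtain i where "i \<le> \<eta>" "t \<in> {\<tau> i..\<tau> (Suc i)}" using interval_levels[of t] t t1 by auto
    then show ?thesis using t by (intro exI[of _ i]) auto
  qed
  have B: "t \<in> {0..t1}" if "i \<le> \<eta>" "t \<in> {\<tau> i..if i < \<eta> then \<tau> (Suc i) else t1}" for i t
    using that t1 tau_mono[of 0 i] tau_mono[of "Suc i" \<eta>] tau_0 by (auto split: if_splits)
  show ?thesis (is "?L = ?R")
  proof (intro set_eqI iffI)
    fix \<omega> assume "\<omega> \<in> ?L"
    then obtain t where t: "\<omega> \<in> space \<Omega>" "t \<in> {0..t1}" "exceeds c x u t \<omega>" by blast
    then obtain i where i: "i \<le> \<eta>" "t \<in> {\<tau> i..if i < \<eta> then \<tau> (Suc i) else t1}" using A[of t] by blast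
    then show "\<omega> \<in> ?R" using t by (intro UN_I[of i]) (simp, blast)
  next
    fix \<omega> assume "\<omega> \<in> ?R"
    then obtain i where i: "i \<le> \<eta>" "\<omega> \<in> level_exit_event c x u i (if i < \<eta> then \<tau> (Suc i) else t1)" by (elim UN_E) simp
    then obtain t where t: "\<omega> \<in> space \<Omega>" "t \<in> {\<tau> i..if i < \<eta> then \<tau> (Suc i) else t1}" "exceeds c x u t \<omega>" by blast
    then show "\<omega> \<in> ?L" using B[OF i(1) t(2)] by blast
  qed
qed

lemma sets_exit_time:
  assumes t1: "\<tau> \<eta> \<le> t1" "t1 \<le> T"
  shows "exit_event c x u t1 \<in> sets \<Omega>"
  unfolding exit_time_levels[OF t1] using t1 tau_less tau_end
  by (intro sets.finite_UN sets_level_exceeds) (auto intro: less_imp_le)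

lemma level_first_passage:
  assumes i: "i \<le> \<eta>" and t1: "\<tau> i < t1" "t1 \<le> \<tau> (Suc i)"
  shows "measure \<Omega> (level_exit_event c x u i t1) * gauss_tail (\<bar>c\<bar> * sqrt T) ^ p i
    \<le> measure \<Omega> (above_event c x u t1)"
proof -
  let ?D = "driver_index \<eta> N" and ?D1 = "{i} \<times> {..<p i}"
  define r where "r = (\<lambda>(l, k::nat). \<tau> (Suc l) - \<tau> l)"
  define V' where "V' = (\<lambda>(l::nat, k) (f :: nat \<times> nat \<Rightarrow> real). (\<Sum>l<i. f (l, k mod p l)) + (x - c * \<tau> i - u))"
  have sub: "(l, k mod p l) \<in> ?D - ?D1" if "l < i" for l k
    using that i p_pos[of l] by (auto simp: driver_index_def)
  have bound: "measure \<Omega> {\<omega> \<in> space \<Omega>. \<exists>t\<in>{0..t1 - \<tau> i}. \<forall>d\<in>?D1. 0 < V' d (\<lambda>d\<in>?D - ?D1. B d (r d) \<omega>) + B d t \<omega> - c * t} *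
      gauss_tail (\<bar>c\<bar> * sqrt T) ^ card ?D1
    \<le> measure \<Omega> {\<omega> \<in> space \<Omega>. \<forall>d\<in>?D1. 0 < V' d (\<lambda>d\<in>?D - ?D1. B d (r d) \<omega>) + B d (t1 - \<tau> i) \<omega> - c * (t1 - \<tau> i)}"
  proof (rule brownian_first_passage_bound[OF \<Omega>.prob_space_axioms drivers finite_drivers])
    show "?D1 \<subseteq> ?D" using i by (auto simp: driver_index_def)
    show "?D1 \<noteq> {}" using p_pos[OF i] by auto
    show "t1 - \<tau> i \<le> T" using t1 tau_mono[of 0 i] tau_mono[of "Suc i" "Suc \<eta>"] i tau_0 tau_end by simp
    show "0 \<le> r d" if "d \<in> ?D - ?D1" for d
      using that tau_less by (auto simp: driver_index_def r_def intro: less_imp_le)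
    show "V' d \<in> borel_measurable (PiM (?D - ?D1) (\<lambda>_. borel))" for d
      unfolding V'_def split_beta' using sub
      by (intro borel_measurable_add borel_measurable_sum measurable_component_singleton borel_measurable_const) auto
  qed (use t1 in auto)
  have Veq: "V' (i, k) (\<lambda>d\<in>?D - ?D1. B d (r d) \<omega>) + B (i, k) t \<omega> - c * t = level_path i k (\<tau> i + t) \<omega> + (x - c * (\<tau> i + t)) - u"
    if "k < p i" for k t \<omega>
    using sub that by (simp add: V'_def level_path_def r_def algebra_simps)
  have D1_all: "(\<forall>d\<in>?D1. Q d) = (\<forall>k\<in>{..<p i}. Q (i, k))" for Q by auto
  have ev: "(\<forall>d\<in>?D1. 0 < V' d (\<lambda>d\<in>?D - ?D1. B d (r d) \<omega>) + B d t \<omega> - c * t) \<longleftrightarrow>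
      (\<forall>k\<in>{..<p i}. 0 < level_path i k (\<tau> i + t) \<omega> + (x - c * (\<tau> i + t)) - u)" for t \<omega>
    unfolding D1_all by (rule ball_cong[OF refl]) (simp only: Veq lessThan_iff)
  have e1: "{\<omega> \<in> space \<Omega>. \<exists>t\<in>{0..t1 - \<tau> i}. \<forall>d\<in>?D1. 0 < V' d (\<lambda>d\<in>?D - ?D1. B d (r d) \<omega>) + B d t \<omega> - c * t} =
     level_exit_event c x u i t1"
    unfolding level_exceeds_eq[OF i t1(2)]
  proof (intro Collect_cong conj_cong refl)
    fix \<omega>
    have "(\<exists>t\<in>{0..t1 - \<tau> i}. \<forall>d\<in>?D1. 0 < V' d (\<lambda>d\<in>?D - ?D1. B d (r d) \<omega>) + B d t \<omega> - c * t) \<longleftrightarrow>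
      (\<exists>t\<in>{0..t1 - \<tau> i}. (\<lambda>s. \<forall>k\<in>{..<p i}. 0 < level_path i k s \<omega> + (x - c * s) - u) (\<tau> i + t))" unfolding ev ..
    also have "\<dots> \<longleftrightarrow> (\<exists>s\<in>(\<lambda>t. \<tau> i + t) ` {0..t1 - \<tau> i}. (\<forall>k\<in>{..<p i}. 0 < level_path i k s \<omega> + (x - c * s) - u))" by blast
    also have "(\<lambda>t. \<tau> i + t) ` {0..t1 - \<tau> i} = {\<tau> i..t1}" by (simp add: add.commute)
    finally show "(\<exists>t\<in>{0..t1 - \<tau> i}. \<forall>d\<in>?D1. 0 < V' d (\<lambda>d\<in>?D - ?D1. B d (r d) \<omega>) + B d t \<omega> - c * t) \<longleftrightarrow>
       (\<exists>s\<in>{\<tau> i..t1}. (\<forall>k\<in>{..<p i}. 0 < level_path i k s \<omega> + (x - c * s) - u))" .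
  qed
  have e2: "{\<omega> \<in> space \<Omega>. \<forall>d\<in>?D1. 0 < V' d (\<lambda>d\<in>?D - ?D1. B d (r d) \<omega>) + B d (t1 - \<tau> i) \<omega> - c * (t1 - \<tau> i)} =
     above_event c x u t1"
    unfolding ev using exceeds_iff[of i t1 _ c x u] i t1 by (intro Collect_cong conj_cong refl) simp
  show ?thesis using bound unfolding e1 e2 by (simp add: card_cartesian_product)
qed

text \<open>Apply \<open>level_first_passage\<close> on the successive intervals between branching points: above \<open>u\<close> in one
interval leads to above \<open>u\<close> at its end, which lies in the next one. The constant does not depend on \<open>t1\<close>.\<close>

theorem exit_bounded_by_endpoint:
  obtains C where "0 < C"
    "\<And>u x t1. \<tau> \<eta> < t1 \<Longrightarrow> t1 \<le> T \<Longrightarrow> measure \<Omega> (exit_event c x u t1)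
       \<le> C * measure \<Omega> (above_event c x u t1)"
proof
  let ?g = "gauss_tail (\<bar>c\<bar> * sqrt T)"
  define \<pi> where "\<pi> = ?g ^ P"
  have \<pi>: "0 < \<pi>" "\<pi> \<le> 1" using gauss_tail_pos gauss_tail_le_1 by (auto simp: \<pi>_def power_le_one less_imp_le)
  show "0 < real (Suc \<eta>) / \<pi> ^ Suc \<eta>" using \<pi> by simp
  fix u x t1 assume t1: "\<tau> \<eta> < t1" "t1 \<le> T"
  define e where "e i = (if i < \<eta> then \<tau> (Suc i) else t1)" for i
  define a where "a i = measure \<Omega> (level_exit_event c x u i (e i))" for i
  define b where "b = measure \<Omega> (above_event c x u t1)"
  have e: "\<tau> i < e i" "e i \<le> \<tau> (Suc i)" if "i \<le> \<eta>" for i using that t1 tau_less tau_end by (auto simp: e_def)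
  have sets: "level_exit_event c x u i (e i) \<in> sets \<Omega>" if "i \<le> \<eta>" for i
    using e that by (intro sets_level_exceeds) (auto intro: less_imp_le)
  have step: "a i * \<pi> \<le> measure \<Omega> (above_event c x u (e i))" if i: "i \<le> \<eta>" for i
  proof -
    have "a i * \<pi> \<le> a i * ?g ^ p i"
      unfolding \<pi>_def using p_le_P[OF i] gauss_tail_pos gauss_tail_le_1
      by (intro mult_left_mono power_decreasing) (auto simp: a_def less_imp_le)
    also have "\<dots> \<le> measure \<Omega> (above_event c x u (e i))"
      unfolding a_def using e[OF i] i by (intro level_first_passage) auto
    finally show ?thesis .
  qed
  \<comment> \<open>Induction from the last interval down to the first one.\<close>
  have chain: "a (\<eta> - j) * \<pi> ^ Suc j \<le> b" if "j \<le> \<eta>" for j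
    using that
  proof (induction j)
    case 0 then show ?case using step[of \<eta>] by (simp add: b_def e_def)
  next
    case (Suc j)
    have "a (\<eta> - Suc j) * \<pi> \<le> measure \<Omega> (above_event c x u (\<tau> (Suc (\<eta> - Suc j))))"
      using step[of "\<eta> - Suc j"] Suc by (simp add: e_def)
    also have "Suc (\<eta> - Suc j) = \<eta> - j" using Suc by simp
    also have "measure \<Omega> (above_event c x u (\<tau> (\<eta> - j))) \<le> a (\<eta> - j)"
      unfolding a_def using sets[of "\<eta> - j"] e[of "\<eta> - j"] by (intro \<Omega>.finite_measure_mono) (auto intro!: bexI[of _ "\<tau> (\<eta> - j)"])
    finally have "a (\<eta> - Suc j) * \<pi> * \<pi> ^ Suc j \<le> a (\<eta> - j) * \<pi> ^ Suc j" using \<pi> by (intro mult_right_mono) auto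
    then show ?case using Suc by (simp add: mult.assoc)
  qed
  have ai: "a i \<le> b / \<pi> ^ Suc \<eta>" if "i \<le> \<eta>" for i
  proof -
    have "a i * \<pi> ^ Suc \<eta> \<le> a i * \<pi> ^ Suc (\<eta> - i)"
      using \<pi> by (intro mult_left_mono power_decreasing) (auto simp: a_def)
    also have "\<dots> \<le> b" using chain[of "\<eta> - i"] that by simp
    finally show ?thesis using \<pi> by (simp add: pos_le_divide_eq)
  qed
  have "measure \<Omega> (exit_event c x u t1) \<le> (\<Sum>i\<le>\<eta>. a i)"
    unfolding exit_time_levels[OF less_imp_le[OF t1(1)] t1(2)] a_def e_def[symmetric]
    using sets by (intro \<Omega>.finite_measure_subadditive_finite) auto
  also have "\<dots> \<le> (\<Sum>i\<le>\<eta>. b / \<pi> ^ Suc \<eta>)" using ai by (intro sum_mono) auto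
  finally show "measure \<Omega> (exit_event c x u t1)
       \<le> real (Suc \<eta>) / \<pi> ^ Suc \<eta> * measure \<Omega> (above_event c x u t1)" by (simp add: b_def)
qed

end



section \<open>The exact formula on the last stretch\<close>

lemma ennreal_SUP_attained:
  fixes G :: ennreal and g :: "nat \<Rightarrow> ennreal"
  assumes le: "\<And>m. g m \<le> G" and att: "G \<noteq> 0 \<Longrightarrow> \<exists>m. g m = G"
  shows "G = (SUP m. g m)"
proof (cases "G = 0")
  case True then show ?thesis using le by (auto intro!: antisym SUP_upper2)
next
  case False
  then obtain m where m: "g m = G" using att by blast
  show ?thesis
  proof (rule antisym)
    show "G \<le> (SUP m. g m)" using m SUP_upper[of m UNIV g] by simp
    show "(SUP m. g m) \<le> G" using le by (rule SUP_least)
  qed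
qed

context brownian_tree
begin

abbreviation "Leb \<equiv> PiM {1..P} (\<lambda>_. lborel :: real measure)"

abbreviation "limit_space \<equiv> \<Omega>' \<Otimes>\<^sub>M Leb"
abbreviation "full_space \<equiv> \<Omega> \<Otimes>\<^sub>M limit_space"

lemma sigma_finite_Leb: "sigma_finite_measure Leb"
proof -
  interpret L: product_sigma_finite "\<lambda>_::nat. lborel :: real measure" by (rule product_sigma_finite_lborel)
  show ?thesis by (rule L.sigma_finite) simp
qed

sublocale Leb: sigma_finite_measure Leb by (rule sigma_finite_Leb)
sublocale \<Omega>'Leb: pair_sigma_finite \<Omega>' Leb ..

lemma sigma_finite_\<Omega>'Leb: "sigma_finite_measure limit_space"
  by (rule \<Omega>'Leb.P.sigma_finite_measure_axioms)

text \<open>The integrand of the limit constant, as a function of the path and of \<open>x\<close>.\<close>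

definition weight :: "real set \<Rightarrow> 'v \<times> (nat \<Rightarrow> real) \<Rightarrow> real" where
  "weight Q z = exp (\<Sum>k=1..P. snd z k) * of_bool (ladder_event Q (fst z) (snd z))"

lemma weight_nonneg: "0 \<le> weight Q z" by (simp add: weight_def)

lemma coordinate_measurable: "k \<in> {1..P} \<Longrightarrow> (\<lambda>z. snd z k) \<in> borel_measurable limit_space"
  using measurable_compose[OF measurable_snd measurable_component_singleton, of k "{1..P}" \<Omega>' "\<lambda>_. lborel"] by simp

lemma local_measurable': "k \<in> {1..P} \<Longrightarrow> 0 \<le> t \<Longrightarrow> (\<lambda>z. Bstar k t (fst z)) \<in> borel_measurable limit_space"
  by (rule measurable_compose[OF measurable_fst local_measurable])

lemma weight_measurableI:
  assumes "{z \<in> space limit_space. ladder_event Q (fst z) (snd z)} \<in> sets limit_space"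
  shows "weight Q \<in> borel_measurable limit_space"
proof -
  have "(\<lambda>z. exp (\<Sum>k=1..P. snd z k) * indicator {z \<in> space limit_space. ladder_event Q (fst z) (snd z)} z) \<in> borel_measurable limit_space"
    using assms coordinate_measurable
    by (intro borel_measurable_times borel_measurable_exp[THEN measurable_compose[rotated]] borel_measurable_sum borel_measurable_indicator) auto
  then show ?thesis
    by (rule measurable_cong[THEN iffD1, rotated]) (auto simp: weight_def indicator_def)
qed

lemma ladder_event_iff: "ladder_event Q \<omega> x \<longleftrightarrow> (\<exists>t\<in>Q. \<forall>k\<in>{1..P}. 0 < Bstar k t \<omega> / \<mu> - t / \<mu>\<^sup>2 - x k)"
  unfolding ladder_event_def by (simp add: algebra_simps)

lemma ladder_continuous:
  assumes "k \<in> {1..P}" "\<omega> \<in> space \<Omega>'"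
  shows "continuous_on {0..K} (\<lambda>t. Bstar k t \<omega> / \<mu> - t / \<mu>\<^sup>2 - y)"
proof -
  have "continuous_on {0..K} (\<lambda>t. Bstar k t \<omega>)"
  proof (rule continuous_on_subset)
    show "continuous_on {0..} (\<lambda>t. Bstar k t \<omega>)"
      by (rule brownian_motion.continuous_paths[OF local_motion]) (use assms in auto)
  qed auto
  then show ?thesis using mu_pos by (intro continuous_intros) auto
qed

lemma ladder_measurable:
  assumes "k \<in> {1..P}" "0 \<le> t"
  shows "(\<lambda>z. Bstar k t (fst z) / \<mu> - t / \<mu>\<^sup>2 - snd z k) \<in> borel_measurable limit_space"
  using assms local_measurable' coordinate_measurable
  by (intro borel_measurable_diff borel_measurable_divide borel_measurable_const) auto

lemma weight_measurable_finite:
  assumes "finite Q" "Q \<subseteq> {0..}"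
  shows "weight Q \<in> borel_measurable limit_space"
proof (rule weight_measurableI)
  show "{z \<in> space limit_space. ladder_event Q (fst z) (snd z)} \<in> sets limit_space"
    unfolding ladder_event_iff using assms
    by (intro sets.sets_Collect_finite_Ex sets.sets_Collect_finite_All borel_measurable_less ladder_measurable borel_measurable_const) auto
qed

lemma ladder_event_dyadic:
  assumes "0 \<le> K" "\<omega> \<in> space \<Omega>'"
  shows "ladder_event {0..K} \<omega> x \<longleftrightarrow> (\<exists>m. ladder_event (dyadic_points 0 K m) \<omega> x)"
  unfolding ladder_event_iff using assms by (intro ex_positive_iff_dyadic ladder_continuous) auto

lemma weight_measurable_interval:
  assumes "0 \<le> K"
  shows "weight {0..K} \<in> borel_measurable limit_space"
proof (rule weight_measurableI)
  show "{z \<in> space limit_space. ladder_event {0..K} (fst z) (snd z)} \<in> sets limit_space"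
    unfolding ladder_event_iff
  proof (rule sets_ex_positive[OF assms])
    fix k z assume "k \<in> {1..P}" "z \<in> space limit_space"
    then show "continuous_on {0..K} (\<lambda>t. Bstar k t (fst z) / \<mu> - t / \<mu>\<^sup>2 - snd z k)"
      by (intro ladder_continuous) (auto simp: space_pair_measure)
  next
    fix k t assume "k \<in> {1..P}" "t \<in> {0..K}"
    then show "(\<lambda>z. Bstar k t (fst z) / \<mu> - t / \<mu>\<^sup>2 - snd z k) \<in> borel_measurable limit_space"
      by (intro ladder_measurable) auto
  qed simp
qed

lemma stem_measurable': "(\<lambda>z. stem (fst z) \<gamma>) \<in> borel_measurable full_space"
  by (rule measurable_compose[OF measurable_fst stem_measurable])

definition density_at :: "real \<Rightarrow> real \<Rightarrow> 'w \<times> 'v \<times> (nat \<Rightarrow> real) \<Rightarrow> real" where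
  "density_at K u z = density_factor K u (fst z) (fst (snd z)) (snd (snd z))"

lemma density_at_measurable:
  assumes "0 \<le> K"
  shows "density_at K u \<in> borel_measurable full_space"
  unfolding density_at_def[abs_def] density_factor_def using assms
  by (intro borel_measurable_prod measurable_compose[OF _ borel_measurable_normal_density] borel_measurable_diff borel_measurable_divide
      borel_measurable_times borel_measurable_const stem_measurable' measurable_compose[OF measurable_snd local_measurable'] measurable_compose[OF measurable_snd coordinate_measurable]) auto

lemma density_at_nonneg: "0 \<le> density_at K u z"
  by (simp add: density_at_def density_factor_def prod_nonneg)

lemma nested_eq_product:
  assumes W: "weight Q \<in> borel_measurable limit_space" and K: "0 \<le> K"
  shows "(\<integral>\<^sup>+\<omega>. \<integral>\<^sup>+\<omega>'. ennreal ((\<mu> / u) ^ P) * (\<integral>\<^sup>+x. ennreal (density_factor K u \<omega> \<omega>' x) *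
      (ennreal (exp (\<Sum>k=1..P. x k)) * of_bool (ladder_event Q \<omega>' x)) \<partial>Leb) \<partial>\<Omega>' \<partial>\<Omega>) =
    ennreal ((\<mu> / u) ^ P) * (\<integral>\<^sup>+z. ennreal (density_at K u z * weight Q (snd z)) \<partial>full_space)"
proof -
  let ?c = "ennreal ((\<mu> / u) ^ P)"
  let ?f = "\<lambda>z. ennreal (density_at K u z * weight Q (snd z))"
  have f: "?f \<in> borel_measurable full_space"
    by (intro measurable_compose[OF _ measurable_ennreal] borel_measurable_times density_at_measurable[OF K] measurable_compose[OF measurable_snd W])
  have fe: "?f (\<omega>, \<omega>', x) = ennreal (density_factor K u \<omega> \<omega>' x) * (ennreal (exp (\<Sum>k=1..P. x k)) * of_bool (ladder_event Q \<omega>' x))" for \<omega> \<omega>' x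
    by (simp add: density_at_def weight_def ennreal_mult density_factor_def prod_nonneg)
  have fs: "(\<lambda>y. ?f (\<omega>, y)) \<in> borel_measurable limit_space" if "\<omega> \<in> space \<Omega>" for \<omega>
    using measurable_compose[OF measurable_Pair1'[OF that] f] by simp
  have "(\<integral>\<^sup>+\<omega>. \<integral>\<^sup>+\<omega>'. ?c * (\<integral>\<^sup>+x. ?f (\<omega>, \<omega>', x) \<partial>Leb) \<partial>\<Omega>' \<partial>\<Omega>) = (\<integral>\<^sup>+\<omega>. ?c * (\<integral>\<^sup>+y. ?f (\<omega>, y) \<partial>limit_space) \<partial>\<Omega>)"
  proof (rule nn_integral_cong)
    fix \<omega> assume w: "\<omega> \<in> space \<Omega>"
    have "(\<integral>\<^sup>+\<omega>'. ?c * (\<integral>\<^sup>+x. ?f (\<omega>, \<omega>', x) \<partial>Leb) \<partial>\<Omega>') = ?c * (\<integral>\<^sup>+\<omega>'. \<integral>\<^sup>+x. ?f (\<omega>, \<omega>', x) \<partial>Leb \<partial>\<Omega>')"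
      by (rule nn_integral_cmult, rule Leb.borel_measurable_nn_integral) (use fs[OF w] in \<open>simp add: split_beta'\<close>)
    also have "(\<integral>\<^sup>+\<omega>'. \<integral>\<^sup>+x. ?f (\<omega>, \<omega>', x) \<partial>Leb \<partial>\<Omega>') = (\<integral>\<^sup>+y. ?f (\<omega>, y) \<partial>limit_space)"
      by (rule Leb.nn_integral_fst[OF fs[OF w]])
    finally show "(\<integral>\<^sup>+\<omega>'. ?c * (\<integral>\<^sup>+x. ?f (\<omega>, \<omega>', x) \<partial>Leb) \<partial>\<Omega>') = ?c * (\<integral>\<^sup>+y. ?f (\<omega>, y) \<partial>limit_space)" .
  qed
  also have "\<dots> = ?c * (\<integral>\<^sup>+\<omega>. \<integral>\<^sup>+y. ?f (\<omega>, y) \<partial>limit_space \<partial>\<Omega>)"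
    by (rule nn_integral_cmult, rule sigma_finite_measure.borel_measurable_nn_integral[OF sigma_finite_\<Omega>'Leb]) (use f in \<open>simp add: split_beta'\<close>)
  also have "(\<integral>\<^sup>+\<omega>. \<integral>\<^sup>+y. ?f (\<omega>, y) \<partial>limit_space \<partial>\<Omega>) = (\<integral>\<^sup>+z. ?f z \<partial>full_space)"
    by (rule sigma_finite_measure.nn_integral_fst[OF sigma_finite_\<Omega>'Leb f])
  finally show ?thesis unfolding fe .
qed

text \<open>The driftless tree is above \<open>u\<close> at one of the times \<open>T - t / u\<^sup>2\<close> with \<open>t \<in> Q\<close>.\<close>

definition hit :: "real \<Rightarrow> real set \<Rightarrow> 'w set" where
  "hit u Q = {\<omega> \<in> space \<Omega>. \<exists>t\<in>Q. \<forall>\<gamma><P. u < tip \<omega> \<gamma> (t / u\<^sup>2)}"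

lemma hit_grid:
  fixes q :: "nat \<Rightarrow> real"
  assumes n: "0 < n" and q: "q 0 = 0" "q n = K" "\<And>l. l < n \<Longrightarrow> q l < q (Suc l)"
    and u: "0 < u" "K / u\<^sup>2 < S" and J: "J \<subseteq> {..n}"
  shows "emeasure \<Omega> (hit u (q ` J)) = ennreal (exp (- (u\<^sup>2 * real P / (2 * \<mu>))) * (\<mu> / u) ^ P) *
      (\<integral>\<^sup>+z. ennreal (density_at K u z * weight (q ` J) (snd z)) \<partial>full_space)"
proof -
  have qn: "0 \<le> q l" if "l \<le> n" for l
    using that
  proof (induction l)
    case (Suc l) then show ?case using q(3)[of l] by simp
  qed (use q in simp)
  have "weight (q ` J) \<in> borel_measurable limit_space"
    using J qn finite_subset[OF J] by (intro weight_measurable_finite) auto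
  note prd = nested_eq_product[OF this qn[OF order.refl, unfolded q(2)], of u]
  have c: "ennreal (exp (- (u\<^sup>2 * real P / (2 * \<mu>))) * (\<mu> / u) ^ P) = ennreal (exp (- (u\<^sup>2 * real P / (2 * \<mu>)))) * ennreal ((\<mu> / u) ^ P)"
    using mu_pos u by (intro ennreal_mult) auto
  show ?thesis
    unfolding hit_def c mult.assoc prd[symmetric] by (rule exit_grid_formula[OF n q u J])
qed

text \<open>Both sides are monotone limits over dyadic grids in \<open>{0..K}\<close>.\<close>

lemma hit_interval:
  assumes K: "0 < K" and u: "0 < u" "K / u\<^sup>2 < S"
  shows "emeasure \<Omega> (hit u {0..K}) = ennreal (exp (- (u\<^sup>2 * real P / (2 * \<mu>))) * (\<mu> / u) ^ P) *
      (\<integral>\<^sup>+z. ennreal (density_at K u z * weight {0..K} (snd z)) \<partial>full_space)"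
proof -
  let ?c = "ennreal (exp (- (u\<^sup>2 * real P / (2 * \<mu>))) * (\<mu> / u) ^ P)"
  let ?N = "full_space"
  let ?Q = "dyadic_points 0 K"
  let ?f = "\<lambda>m z. ennreal (density_at K u z * weight (?Q m) (snd z))"
  have Q0: "?Q m \<subseteq> {0..}" for m using dyadic_points_subset[of 0 K m] K by auto
  have f: "?f m \<in> borel_measurable ?N" for m
    using K by (intro measurable_compose[OF _ measurable_ennreal] borel_measurable_times density_at_measurable measurable_compose[OF measurable_snd] weight_measurable_finite Q0) auto
  have grid: "emeasure \<Omega> (hit u (?Q m)) = ?c * (\<integral>\<^sup>+z. ?f m z \<partial>?N)" for m
  proof -
    define q where "q j = 0 + (K - 0) * real j / 2 ^ m" for j :: nat
    have Q: "?Q m = q ` {..2 ^ m}" by (simp add: dyadic_points_def q_def)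
    show ?thesis unfolding Q
      by (rule hit_grid[where n="2 ^ m", OF _ _ _ _ u]) (use K in \<open>auto simp: q_def divide_strict_right_mono\<close>)
  qed
  have hpos: "hit u Q = {\<omega> \<in> space \<Omega>. \<exists>t\<in>Q. \<forall>\<gamma>\<in>{..<P}. 0 < tip \<omega> \<gamma> (t / u\<^sup>2) - u}" for Q
    unfolding hit_def by (simp add: Ball_def)
  have tK: "t / u\<^sup>2 \<le> S" if "t \<in> {0..K}" for t
    using that u by (meson atLeastAtMost_iff divide_right_mono less_imp_le order_trans zero_le_power2)
  have "(\<lambda>m. emeasure \<Omega> (hit u (?Q m))) \<longlonglongrightarrow> emeasure \<Omega> (hit u {0..K})"
    unfolding hpos
  proof (rule emeasure_dyadic_positive)
    fix \<gamma> \<omega> assume g: "\<gamma> \<in> {..<P}" and w: "\<omega> \<in> space \<Omega>"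
    have c: "continuous_on {0..} (\<lambda>t. B (\<eta>, \<gamma>) t \<omega>)"
      by (rule brownian_motion.continuous_paths[OF driver]) (use g w in auto)
    have "continuous_on {0..K} (\<lambda>t. B (\<eta>, \<gamma>) (S - t / u\<^sup>2) \<omega>)"
      by (rule continuous_on_compose2[OF c]) (use u tK in \<open>auto intro!: continuous_intros\<close>)
    then show "continuous_on {0..K} (\<lambda>t. tip \<omega> \<gamma> (t / u\<^sup>2) - u)"
      by (intro continuous_intros)
  next
    fix \<gamma> t assume "\<gamma> \<in> {..<P}" "t \<in> {0..K}"
    then show "(\<lambda>\<omega>. tip \<omega> \<gamma> (t / u\<^sup>2) - u) \<in> borel_measurable \<Omega>"
      using tK by (intro borel_measurable_diff borel_measurable_add stem_measurable driver_measurable borel_measurable_const) auto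
  qed (use K in auto)
  moreover have "(\<lambda>m. ?c * (\<integral>\<^sup>+z. ?f m z \<partial>?N)) \<longlonglongrightarrow> ?c * (\<integral>\<^sup>+z. ennreal (density_at K u z * weight {0..K} (snd z)) \<partial>?N)"
  proof -
    have mono: "?f m z \<le> ?f m' z" if "m \<le> m'" for m m' z
      using dyadic_points_mono[OF that, of 0 K] density_at_nonneg[of K u z]
      by (intro ennreal_leI mult_left_mono) (auto simp: weight_def ladder_event_def)
    have "(\<integral>\<^sup>+z. ennreal (density_at K u z * weight {0..K} (snd z)) \<partial>?N) = (\<integral>\<^sup>+z. (SUP m. ?f m z) \<partial>?N)"
    proof (rule nn_integral_cong)
      fix z assume z: "z \<in> space ?N"
      then have w: "fst (snd z) \<in> space \<Omega>'" by (auto simp: space_pair_measure)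
      have le: "?f m z \<le> ennreal (density_at K u z * weight {0..K} (snd z))" for m
        using dyadic_points_subset[of 0 K m] K density_at_nonneg[of K u z]
        by (intro ennreal_leI mult_left_mono) (auto simp: weight_def ladder_event_def)
      show "ennreal (density_at K u z * weight {0..K} (snd z)) = (SUP m. ?f m z)"
      proof (rule ennreal_SUP_attained[OF le])
        assume "ennreal (density_at K u z * weight {0..K} (snd z)) \<noteq> 0"
        then have L: "ladder_event {0..K} (fst (snd z)) (snd (snd z))" by (cases "ladder_event {0..K} (fst (snd z)) (snd (snd z))") (simp_all add: weight_def)
        then obtain m where "ladder_event (?Q m) (fst (snd z)) (snd (snd z))" using ladder_event_dyadic[of K] K w by auto
        then have "?f m z = ennreal (density_at K u z * weight {0..K} (snd z))" using L by (simp add: weight_def)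
        then show "\<exists>m. ?f m z = ennreal (density_at K u z * weight {0..K} (snd z))" by (rule exI)
      qed
    qed
    also have "\<dots> = (SUP m. \<integral>\<^sup>+z. ?f m z \<partial>?N)"
      using mono f by (intro nn_integral_monotone_convergence_SUP) (auto simp: incseq_def le_fun_def)
    finally have 1: "(\<integral>\<^sup>+z. ennreal (density_at K u z * weight {0..K} (snd z)) \<partial>?N) = (SUP m. \<integral>\<^sup>+z. ?f m z \<partial>?N)" .
    have "(\<lambda>m. \<integral>\<^sup>+z. ?f m z \<partial>?N) \<longlonglongrightarrow> (SUP m. \<integral>\<^sup>+z. ?f m z \<partial>?N)"
      using mono by (intro LIMSEQ_SUP) (auto simp: incseq_def intro!: nn_integral_mono)
    then show ?thesis unfolding 1 by (rule ennreal_tendsto_cmult[OF ennreal_less_top])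
  qed
  ultimately show ?thesis unfolding grid by (rule LIMSEQ_unique)
qed

end



section \<open>The limit on the last stretch\<close>

\<comment> \<open>Keeps the index set \<open>{1..P}\<close> in this form when the simplifier meets it.\<close>
declare One_nat_def [simp del]

lemma nn_integral_exp_lessThan: "(\<integral>\<^sup>+x. ennreal (exp x) * indicator {..<z} x \<partial>lborel) = ennreal (exp z)"
proof -
  have "(\<integral>\<^sup>+x. ennreal (exp x) * indicator {..<z} x \<partial>lborel) = (\<integral>\<^sup>+x. ennreal (exp (- x)) * indicator {..<z} (- x) \<partial>lborel)"
    using nn_integral_real_affine[of "\<lambda>x. ennreal (exp x) * indicator {..<z} x" "- 1" 0] by simp
  also have "\<dots> = (\<integral>\<^sup>+x. ennreal (exp (- x)) * indicator {- z..} x \<partial>lborel)"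
  proof (rule nn_integral_cong_AE)
    show "AE x in lborel. ennreal (exp (- x)) * indicator {..<z} (- x) = ennreal (exp (- x)) * indicator {- z..} x"
      using AE_lborel_singleton[of "- z"] by eventually_elim (auto simp: indicator_def)
  qed
  also have "\<dots> = ennreal (0 - (- exp (- (- z))))"
  proof (rule nn_integral_FTC_atLeast)
    show "((\<lambda>x::real. - exp (- x)) \<longlongrightarrow> 0) at_top" by real_asymp
  qed (auto intro!: derivative_eq_intros)
  finally show ?thesis by simp
qed

lemma normal_density_le:
  assumes "0 < a" "a \<le> \<sigma>\<^sup>2" shows "normal_density m \<sigma> x \<le> 1 / sqrt (2 * pi * a)"
proof -
  have "normal_density m \<sigma> x \<le> 1 / sqrt (2 * pi * \<sigma>\<^sup>2) * 1"
    unfolding normal_density_def by (intro mult_left_mono) auto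
  also have "\<dots> \<le> 1 / sqrt (2 * pi * a) * 1"
    using assms by (intro mult_right_mono divide_left_mono) (auto intro!: mult_pos_pos)
  finally show ?thesis by simp
qed

context brownian_tree
begin

definition ladder_mass :: "real set \<Rightarrow> real" where
  "ladder_mass Q = (\<integral>z. weight Q z \<partial>limit_space)"

text \<open>The density at \<open>0\<close> of the vector of the leaves of the driftless tree at time \<open>T\<close>.\<close>

definition endpoint_density :: real where
  "endpoint_density = (\<integral>\<omega>. (\<Prod>\<gamma><P. normal_density 0 (sqrt S) (stem \<omega> \<gamma>)) \<partial>\<Omega>)"

text \<open>The asymptotic size of the probability that the driftless tree is above \<open>u\<close> at time \<open>T\<close>.\<close>

definition envelope :: "real \<Rightarrow> real" where
  "envelope u = endpoint_density * (exp (- (u\<^sup>2 * real P / (2 * \<mu>))) * (\<mu> / u) ^ P)"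

lemma stem_density_measurable: "(\<lambda>\<omega>. \<Prod>\<gamma><P. normal_density 0 (sqrt S) (stem \<omega> \<gamma>)) \<in> borel_measurable \<Omega>"
  by (intro borel_measurable_prod measurable_compose[OF stem_measurable] borel_measurable_normal_density)

lemma endpoint_density_pos: "0 < endpoint_density"
proof -
  let ?f = "\<lambda>\<omega>. \<Prod>\<gamma><P. normal_density 0 (sqrt S) (stem \<omega> \<gamma>)"
  have pos: "0 < ?f \<omega>" for \<omega> using S_pos by (intro prod_pos) (auto intro: normal_density_pos)
  have bd: "?f \<omega> \<le> (1 / sqrt (2 * pi * S)) ^ P" for \<omega>
  proof -
    have "?f \<omega> \<le> (\<Prod>\<gamma><P. 1 / sqrt (2 * pi * S))"
      using S_pos by (intro prod_mono) (auto intro!: normal_density_le)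
    then show ?thesis by simp
  qed
  have int: "integrable \<Omega> ?f"
    by (rule \<Omega>.integrable_const_bound[where B="(1 / sqrt (2 * pi * S)) ^ P"])
       (use bd pos stem_density_measurable in \<open>auto simp: less_imp_le abs_of_pos\<close>)
  have "0 \<noteq> endpoint_density"
  proof
    assume "0 = endpoint_density"
    then have "AE \<omega> in \<Omega>. ?f \<omega> = 0"
      using integral_nonneg_eq_0_iff_AE[OF int] pos by (simp add: endpoint_density_def less_imp_le)
    then have "AE \<omega> in \<Omega>. False" by eventually_elim (use pos in \<open>metis less_irrefl\<close>)
    then show False using \<Omega>.AE_False by blast
  qed
  moreover have "0 \<le> endpoint_density" unfolding endpoint_density_def using pos by (intro Bochner_Integration.integral_nonneg) (auto intro: less_imp_le)
  ultimately show ?thesis by simp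
qed

lemma envelope_pos: "0 < u \<Longrightarrow> 0 < envelope u"
  unfolding envelope_def using endpoint_density_pos mu_pos by simp

lemma density_at_le:
  assumes "0 < u" "K / u\<^sup>2 \<le> S / 2"
  shows "density_at K u z \<le> (1 / sqrt (pi * S)) ^ P"
proof -
  have "density_at K u z \<le> (\<Prod>\<gamma><P. 1 / sqrt (2 * pi * (S / 2)))"
    unfolding density_at_def density_factor_def
  proof (intro prod_mono conjI normal_density_le)
    have half: "s / 2 \<le> s - k" "0 \<le> s - k" if "0 < s" "k \<le> s / 2" for k s :: real using that by auto
    have "S / 2 \<le> S - K / u\<^sup>2" "0 \<le> S - K / u\<^sup>2" using half[OF S_pos assms(2)] by auto
    then show "S / 2 \<le> (sqrt (S - K / u\<^sup>2))\<^sup>2" by (simp only: real_sqrt_pow2)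
  qed (use S_pos in auto)
  then show ?thesis by simp
qed

lemma density_at_tendsto:
  "((\<lambda>u. density_at K u z) \<longlongrightarrow> (\<Prod>\<gamma><P. normal_density 0 (sqrt S) (stem (fst z) \<gamma>))) at_top"
  unfolding density_at_def density_factor_def
proof (intro tendsto_prod)
  fix \<gamma>
  define a where "a = stem (fst z) \<gamma>"
  define b where "b = Bstar (Suc \<gamma>) K (fst (snd z)) - \<mu> * snd (snd z) (Suc \<gamma>)"
  have K0: "((\<lambda>u. K / u\<^sup>2) \<longlongrightarrow> 0) at_top" by real_asymp
  have b0: "((\<lambda>u. b / u) \<longlongrightarrow> 0) at_top" by real_asymp
  have s: "((\<lambda>u. (sqrt (S - K / u\<^sup>2))\<^sup>2) \<longlongrightarrow> (sqrt (S - 0))\<^sup>2) at_top" by (intro tendsto_intros K0)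
  have "((\<lambda>u. normal_density 0 (sqrt (S - K / u\<^sup>2)) (b / u - a)) \<longlongrightarrow>
      1 / sqrt (2 * pi * (sqrt (S - 0))\<^sup>2) * exp (- ((0 - a) - 0)\<^sup>2 / (2 * (sqrt (S - 0))\<^sup>2))) at_top"
    unfolding normal_density_def using S_pos by (intro tendsto_intros s b0) auto
  then show "((\<lambda>u. normal_density 0 (sqrt (S - K / u\<^sup>2)) ((Bstar (Suc \<gamma>) K (fst (snd z)) - \<mu> * snd (snd z) (Suc \<gamma>)) / u - stem (fst z) \<gamma>))
     \<longlongrightarrow> normal_density 0 (sqrt S) (stem (fst z) \<gamma>)) at_top"
    unfolding a_def[symmetric] b_def[symmetric] normal_density_def[of 0 "sqrt S"] by simp
qed

lemma nn_integral_fst_snd_product: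
  assumes a: "a \<in> borel_measurable \<Omega>" and w: "w \<in> borel_measurable limit_space"
    and nn: "\<And>\<omega>. 0 \<le> a \<omega>" "\<And>z. 0 \<le> w z"
  shows "(\<integral>\<^sup>+z. ennreal (a (fst z) * w (snd z)) \<partial>full_space) = (\<integral>\<^sup>+\<omega>. ennreal (a \<omega>) \<partial>\<Omega>) * (\<integral>\<^sup>+z. ennreal (w z) \<partial>limit_space)"
proof -
  have m: "(\<lambda>z. ennreal (a (fst z) * w (snd z))) \<in> borel_measurable full_space"
    by (intro measurable_compose[OF _ measurable_ennreal] borel_measurable_times measurable_compose[OF measurable_fst a] measurable_compose[OF measurable_snd w])
  have "(\<integral>\<^sup>+z. ennreal (a (fst z) * w (snd z)) \<partial>full_space) = (\<integral>\<^sup>+\<omega>. \<integral>\<^sup>+z. ennreal (a \<omega> * w z) \<partial>limit_space \<partial>\<Omega>)"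
    using sigma_finite_measure.nn_integral_fst[OF sigma_finite_\<Omega>'Leb m] by simp
  also have "\<dots> = (\<integral>\<^sup>+\<omega>. ennreal (a \<omega>) * (\<integral>\<^sup>+z. ennreal (w z) \<partial>limit_space) \<partial>\<Omega>)"
    using nn w by (simp add: ennreal_mult nn_integral_cmult)
  also have "\<dots> = (\<integral>\<^sup>+\<omega>. ennreal (a \<omega>) \<partial>\<Omega>) * (\<integral>\<^sup>+z. ennreal (w z) \<partial>limit_space)"
    using a by (intro nn_integral_multc) auto
  finally show ?thesis .
qed

text \<open>In the exact formula only \<open>density_at K u\<close> depends on \<open>u\<close>. It is bounded once \<open>K / u\<^sup>2 \<le> S / 2\<close>, and
converges to the density at \<open>0\<close>, which depends on \<open>\<Omega>\<close> only, so that the limit integral factorizes.\<close>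

lemma hit_limit:
  assumes K: "0 < K" and W: "integrable limit_space (weight Q)"
    and formula: "\<And>u. 0 < u \<Longrightarrow> K / u\<^sup>2 < S \<Longrightarrow> emeasure \<Omega> (hit u Q) = ennreal (exp (- (u\<^sup>2 * real P / (2 * \<mu>))) * (\<mu> / u) ^ P) *
      (\<integral>\<^sup>+z. ennreal (density_at K u z * weight Q (snd z)) \<partial>full_space)"
  shows "((\<lambda>u. measure \<Omega> (hit u Q) / envelope u) \<longlongrightarrow> ladder_mass Q) at_top"
proof -
  let ?N = "full_space"
  let ?a = "\<lambda>\<omega>. \<Prod>\<gamma><P. normal_density 0 (sqrt S) (stem \<omega> \<gamma>)"
  let ?\<beta> = "(1 / sqrt (pi * S)) ^ P"
  have wm: "weight Q \<in> borel_measurable limit_space" using W by auto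
  have wm': "(\<lambda>z. weight Q (snd z)) \<in> borel_measurable ?N" by (rule measurable_compose[OF measurable_snd wm])
  have am: "(\<lambda>z. ?a (fst z)) \<in> borel_measurable ?N" by (rule measurable_compose[OF measurable_fst stem_density_measurable])
  have fm: "(\<lambda>z. density_at K u z * weight Q (snd z)) \<in> borel_measurable ?N" for u
    using K by (intro borel_measurable_times density_at_measurable wm') simp
  have a_nn: "0 \<le> ?a \<omega>" for \<omega> by (intro prod_nonneg) simp
  have nnW: "(\<integral>\<^sup>+z. ennreal (weight Q z) \<partial>limit_space) < \<infinity>"
    using integrableD(2)[OF W] weight_nonneg by (simp add: top.not_eq_extremum)
  have intW: "integrable ?N (\<lambda>z. ?\<beta> * weight Q (snd z))"
  proof (rule integrable_mult_right, rule integrableI_nonneg[OF wm'])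
    have "(\<integral>\<^sup>+z. ennreal (1 * weight Q (snd z)) \<partial>?N) = (\<integral>\<^sup>+\<omega>. ennreal 1 \<partial>\<Omega>) * (\<integral>\<^sup>+z. ennreal (weight Q z) \<partial>limit_space)"
      by (rule nn_integral_fst_snd_product[of "\<lambda>_. 1"]) (use wm weight_nonneg in auto)
    then show "(\<integral>\<^sup>+z. ennreal (weight Q (snd z)) \<partial>?N) < \<infinity>" using nnW by (simp add: \<Omega>.emeasure_space_1)
  qed (simp add: weight_nonneg)
  have ev: "eventually (\<lambda>u. 0 < u \<and> K / u\<^sup>2 \<le> S / 2 \<and> K / u\<^sup>2 < S) at_top"
  proof -
    have "((\<lambda>u::real. K / u\<^sup>2) \<longlongrightarrow> 0) at_top" by real_asymp
    then have "eventually (\<lambda>u. K / u\<^sup>2 < S / 2) at_top" using S_pos by (intro order_tendstoD) auto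
    with eventually_gt_at_top[of 0] show ?thesis
    proof eventually_elim
      case (elim u)
      have half: "k < s" if "0 < s" "k < s / 2" for k s :: real using that by auto
      have "K / u\<^sup>2 < S" using half[OF S_pos] elim by blast
      then show ?case using elim by (simp add: less_imp_le)
    qed
  qed
  have lim: "((\<lambda>u. \<integral>z. density_at K u z * weight Q (snd z) \<partial>?N) \<longlongrightarrow> (\<integral>z. ?a (fst z) * weight Q (snd z) \<partial>?N)) at_top"
  proof (rule integral_dominated_convergence_at_top[OF _ _ intW])
    show "(\<lambda>z. ?a (fst z) * weight Q (snd z)) \<in> borel_measurable ?N" by (intro borel_measurable_times am wm')
    show "AE z in ?N. ((\<lambda>u. density_at K u z * weight Q (snd z)) \<longlongrightarrow> ?a (fst z) * weight Q (snd z)) at_top"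
      by (intro AE_I2 tendsto_mult density_at_tendsto tendsto_const)
    show "eventually (\<lambda>u. AE z in ?N. norm (density_at K u z * weight Q (snd z)) \<le> ?\<beta> * weight Q (snd z)) at_top"
      using ev
    proof eventually_elim
      case (elim u)
      have "norm (density_at K u z * weight Q (snd z)) \<le> ?\<beta> * weight Q (snd z)" for z
        using density_at_le[of u K z] elim density_at_nonneg[of K u z] weight_nonneg[of Q "snd z"]
        by (simp add: abs_mult mult_right_mono)
      then show ?case by simp
    qed
  qed (rule fm)
  have prod: "(\<integral>z. ?a (fst z) * weight Q (snd z) \<partial>?N) = endpoint_density * ladder_mass Q"
  proof -
    have "(\<integral>z. ?a (fst z) * weight Q (snd z) \<partial>?N) = enn2real (\<integral>\<^sup>+z. ennreal (?a (fst z) * weight Q (snd z)) \<partial>?N)"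
      by (intro integral_eq_nn_integral borel_measurable_times am wm') (simp add: a_nn weight_nonneg)
    also have "\<dots> = enn2real (\<integral>\<^sup>+\<omega>. ennreal (?a \<omega>) \<partial>\<Omega>) * enn2real (\<integral>\<^sup>+z. ennreal (weight Q z) \<partial>limit_space)"
      by (subst nn_integral_fst_snd_product[OF stem_density_measurable wm a_nn weight_nonneg]) (rule enn2real_mult)
    also have "enn2real (\<integral>\<^sup>+\<omega>. ennreal (?a \<omega>) \<partial>\<Omega>) = endpoint_density"
      unfolding endpoint_density_def by (rule integral_eq_nn_integral[symmetric, OF stem_density_measurable]) (simp add: a_nn)
    also have "enn2real (\<integral>\<^sup>+z. ennreal (weight Q z) \<partial>limit_space) = ladder_mass Q"
      unfolding ladder_mass_def by (rule integral_eq_nn_integral[symmetric, OF wm]) (simp add: weight_nonneg)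
    finally show ?thesis .
  qed
  have "((\<lambda>u. (\<integral>z. density_at K u z * weight Q (snd z) \<partial>?N) / endpoint_density) \<longlongrightarrow> endpoint_density * ladder_mass Q / endpoint_density) at_top"
    using lim endpoint_density_pos unfolding prod by (intro tendsto_divide tendsto_const) auto
  then have "((\<lambda>u. (\<integral>z. density_at K u z * weight Q (snd z) \<partial>?N) / endpoint_density) \<longlongrightarrow> ladder_mass Q) at_top"
    using endpoint_density_pos by simp
  moreover have "eventually (\<lambda>u. measure \<Omega> (hit u Q) / envelope u = (\<integral>z. density_at K u z * weight Q (snd z) \<partial>?N) / endpoint_density) at_top"
    using ev
  proof eventually_elim
    case (elim u)
    let ?c = "exp (- (u\<^sup>2 * real P / (2 * \<mu>))) * (\<mu> / u) ^ P"
    have c: "0 < ?c" using elim mu_pos by simp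
    have "measure \<Omega> (hit u Q) = ?c * enn2real (\<integral>\<^sup>+z. ennreal (density_at K u z * weight Q (snd z)) \<partial>?N)"
      unfolding measure_def using formula[of u] elim c by (simp add: enn2real_mult)
    also have "enn2real (\<integral>\<^sup>+z. ennreal (density_at K u z * weight Q (snd z)) \<partial>?N) = (\<integral>z. density_at K u z * weight Q (snd z) \<partial>?N)"
      by (rule integral_eq_nn_integral[symmetric, OF fm]) (simp add: density_at_nonneg weight_nonneg)
    finally have m: "measure \<Omega> (hit u Q) = ?c * (\<integral>z. density_at K u z * weight Q (snd z) \<partial>?N)" .
    have "d * i / (e * d) = i / e" if "0 < d" for d i e :: real using that by simp
    from this[OF c] show ?case unfolding m envelope_def .
  qed
  ultimately show ?thesis by (simp add: filterlim_cong)
qed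

text \<open>For a single time the integral over \<open>x\<close> is the product of the \<open>exp (Bstar k t / \<mu> - t / \<mu>\<^sup>2)\<close>, and its expectation
is the moment generating function of \<open>P\<close> independent normal variables, which is read off from the Cameron-Martin formula for the
constant function.\<close>

lemma nn_integral_weight_singleton:
  assumes t: "0 \<le> t"
  shows "(\<integral>\<^sup>+z. ennreal (weight {t} z) \<partial>limit_space) = ennreal (exp (- (t * real P / (2 * \<mu>\<^sup>2))))"
proof -
  interpret L: product_sigma_finite "\<lambda>_::nat. lborel :: real measure" by (rule product_sigma_finite_lborel)
  let ?zz = "\<lambda>\<omega> k. Bstar k t \<omega> / \<mu> - t / \<mu>\<^sup>2"
  have wm: "weight {t} \<in> borel_measurable limit_space" using t by (intro weight_measurable_finite) auto
  have inner: "(\<integral>\<^sup>+x. ennreal (weight {t} (\<omega>, x)) \<partial>Leb) = ennreal (exp (\<Sum>k=1..P. ?zz \<omega> k))" for \<omega>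
  proof -
    have "(\<integral>\<^sup>+x. ennreal (weight {t} (\<omega>, x)) \<partial>Leb) = (\<integral>\<^sup>+x. (\<Prod>k\<in>{1..P}. ennreal (exp (x k)) * indicator {..<?zz \<omega> k} (x k)) \<partial>Leb)"
    proof (rule nn_integral_cong)
      fix x
      have "(\<Prod>k\<in>{1..P}. indicator {..<?zz \<omega> k} (x k) :: ennreal) = of_bool (\<forall>k\<in>{1..P}. x k < ?zz \<omega> k)"
        by (auto simp: indicator_def intro!: prod_zero)
      then show "ennreal (weight {t} (\<omega>, x)) = (\<Prod>k\<in>{1..P}. ennreal (exp (x k)) * indicator {..<?zz \<omega> k} (x k))"
        by (simp add: weight_def ladder_event_def prod.distrib exp_sum prod_ennreal ennreal_mult prod_nonneg)
    qed
    also have "\<dots> = (\<Prod>k\<in>{1..P}. ennreal (exp (?zz \<omega> k)))"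
      by (subst L.product_nn_integral_prod) (auto simp: nn_integral_exp_lessThan)
    finally show ?thesis by (simp add: exp_sum prod_ennreal)
  qed
  have "(\<integral>\<^sup>+z. ennreal (weight {t} z) \<partial>limit_space) = (\<integral>\<^sup>+\<omega>. \<integral>\<^sup>+x. ennreal (weight {t} (\<omega>, x)) \<partial>Leb \<partial>\<Omega>')"
    using Leb.nn_integral_fst[of "\<lambda>z. ennreal (weight {t} z)" \<Omega>'] wm by simp
  also have "\<dots> = (\<integral>\<^sup>+\<omega>. ennreal (exp (\<Sum>k=1..P. ?zz \<omega> k)) \<partial>\<Omega>')" by (simp add: inner del: exp_sum)
  also have "\<dots> = ennreal (exp (- (t * real P / (2 * \<mu>\<^sup>2))))"
  proof (cases "t = 0")
    case True
    have "Bstar k 0 \<omega> = 0" if "k \<in> {1..P}" "\<omega> \<in> space \<Omega>'" for k \<omega>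
      using brownian_motion.starts_at_0[OF local_motion] that by blast
    then have "(\<integral>\<^sup>+\<omega>. ennreal (exp (\<Sum>k=1..P. ?zz \<omega> k)) \<partial>\<Omega>') = (\<integral>\<^sup>+\<omega>. 1 \<partial>\<Omega>')"
      using True by (intro nn_integral_cong) simp
    then show ?thesis using True by (simp add: \<Omega>'.emeasure_space_1)
  next
    case False
    then have t': "0 < t" using t by simp
    define F where "F y = ennreal (exp (\<Sum>k=1..P. y k / \<mu> - t / \<mu>\<^sup>2))" for y :: "nat \<Rightarrow> real"
    have Fm: "F \<in> borel_measurable (PiM {1..P} (\<lambda>_. borel))"
      unfolding F_def by (intro measurable_compose[OF _ measurable_ennreal] borel_measurable_exp[THEN measurable_compose[rotated]] borel_measurable_sum
         borel_measurable_diff borel_measurable_divide measurable_component_singleton borel_measurable_const)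
    define e2 where "e2 = (\<lambda>i :: nat. if i = 0 then 0 else t)"
    have "\<Omega>'.indep_vars (\<lambda>_. borel) (\<lambda>(d, i) \<omega>. Bstar d (e2 (Suc i)) \<omega> - Bstar d (e2 i) \<omega>) (SIGMA d:{1..P}. {..<1})"
      by (rule indep_vars_brownian_increments[OF \<Omega>'.prob_space_axioms local_motions, of "\<lambda>_. e2" "\<lambda>_. 1"]) (use t in \<open>auto simp: e2_def\<close>)
    from \<Omega>'.indep_vars_inj[OF this, of "\<lambda>d. (d, 0)" "{1..P}"]
    have ind: "\<Omega>'.indep_vars (\<lambda>_. borel) (\<lambda>d \<omega>. Bstar d t \<omega> - Bstar d 0 \<omega>) {1..P}"
      by (auto simp: inj_on_def e2_def)
    have ne: "{1..P} \<noteq> {}" using P_pos by auto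
    have dist: "distributed \<Omega>' lborel (\<lambda>\<omega>. Bstar k t \<omega> - Bstar k 0 \<omega>) (normal_density 0 (sqrt t))" if "k \<in> {1..P}" for k
      using brownian_motion.normal_increments[OF local_motion[OF that], of 0 t] t' by simp
    have z: "Bstar k 0 \<omega> = 0" if "k \<in> {1..P}" "\<omega> \<in> space \<Omega>'" for k \<omega>
      using brownian_motion.starts_at_0[OF local_motion] that by blast
    have "(\<integral>\<^sup>+\<omega>. ennreal (exp (\<Sum>k=1..P. ?zz \<omega> k)) \<partial>\<Omega>') = (\<integral>\<^sup>+\<omega>. F (\<lambda>k\<in>{1..P}. Bstar k t \<omega> - Bstar k 0 \<omega>) \<partial>\<Omega>')"
      using z by (intro nn_integral_cong) (auto simp: F_def intro!: arg_cong[of _ _ exp] sum.cong)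
    also have "\<dots> = (\<integral>\<^sup>+y. F y \<partial>PiM {1..P} (\<lambda>_. gauss t))"
      by (rule \<Omega>'.nn_integral_indep_gauss[OF ind ne dist Fm])
    also have "\<dots> = (\<integral>\<^sup>+y. ennreal (exp (- (t * real P / (2 * \<mu>\<^sup>2)))) * (1 * ennreal (exp (- (\<Sum>k\<in>{1..P}. - (t / \<mu>) * y k / t) - (\<Sum>k\<in>{1..P}. (- (t / \<mu>))\<^sup>2 / (2 * t))))) \<partial>PiM {1..P} (\<lambda>_. gauss t))"
    proof (rule nn_integral_cong)
      fix y :: "nat \<Rightarrow> real"
      have "(\<Sum>k=1..P. y k / \<mu> - t / \<mu>\<^sup>2) = - (t * real P / (2 * \<mu>\<^sup>2)) + (- (\<Sum>k\<in>{1..P}. - (t / \<mu>) * y k / t) - (\<Sum>k\<in>{1..P}. (- (t / \<mu>))\<^sup>2 / (2 * t)))"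
      proof -
        have 1: "(\<Sum>k=1..P. - (t / \<mu>) * y k / t) = - (\<Sum>k=1..P. y k / \<mu>)"
          unfolding sum_negf[symmetric] using t' by (intro sum.cong) auto
        have 2: "(\<Sum>k=1..P. (- (t / \<mu>))\<^sup>2 / (2 * t)) = t * real P / (2 * \<mu>\<^sup>2)"
          using t' mu_pos by (simp add: power_divide power2_eq_square ac_simps)
        have 3: "(\<Sum>k=1..P. y k / \<mu> - t / \<mu>\<^sup>2) = (\<Sum>k=1..P. y k / \<mu>) - 2 * (t * real P / (2 * \<mu>\<^sup>2))"
          by (simp add: sum_subtractf mult.commute)
        show ?thesis unfolding 1 2 3 by simp
      qed
      then show "F y = ennreal (exp (- (t * real P / (2 * \<mu>\<^sup>2)))) * (1 * ennreal (exp (- (\<Sum>k\<in>{1..P}. - (t / \<mu>) * y k / t) - (\<Sum>k\<in>{1..P}. (- (t / \<mu>))\<^sup>2 / (2 * t)))))"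
        unfolding F_def by (simp only: exp_add ennreal_mult'[OF exp_ge_zero] mult_1)
    qed
    also have "\<dots> = ennreal (exp (- (t * real P / (2 * \<mu>\<^sup>2)))) * (\<integral>\<^sup>+y. 1 * ennreal (exp (- (\<Sum>k\<in>{1..P}. - (t / \<mu>) * y k / t) - (\<Sum>k\<in>{1..P}. (- (t / \<mu>))\<^sup>2 / (2 * t)))) \<partial>PiM {1..P} (\<lambda>_. gauss t))"
      by (rule nn_integral_cmult) measurable
    also have "(\<integral>\<^sup>+y. 1 * ennreal (exp (- (\<Sum>k\<in>{1..P}. - (t / \<mu>) * y k / t) - (\<Sum>k\<in>{1..P}. (- (t / \<mu>))\<^sup>2 / (2 * t)))) \<partial>PiM {1..P} (\<lambda>_. gauss t))
       = (\<integral>\<^sup>+y. 1 \<partial>PiM {1..P} (\<lambda>_. gauss t))"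
      by (rule nn_integral_PiM_gauss_shift[symmetric, of "{1..P}" "\<lambda>_. t" "\<lambda>_. 1"]) (use t' in auto)
    also have "\<dots> = 1"
    proof -
      interpret G: prob_space "PiM {1..P} (\<lambda>_. gauss t)" by (intro prob_space_PiM prob_space_gauss t')
      show ?thesis by (simp add: G.emeasure_space_1)
    qed
    finally show ?thesis by simp
  qed
  finally show ?thesis .
qed

lemma integrable_weight_singleton:
  assumes "0 \<le> t" shows "integrable limit_space (weight {t})"
  using nn_integral_weight_singleton[OF assms] assms weight_nonneg
  by (intro integrableI_nonneg weight_measurable_finite) auto

lemma ladder_mass_singleton:
  assumes "0 \<le> t" shows "ladder_mass {t} = exp (- (t * real P / (2 * \<mu>\<^sup>2)))"
proof -
  have "ladder_mass {t} = enn2real (\<integral>\<^sup>+z. ennreal (weight {t} z) \<partial>limit_space)"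
    unfolding ladder_mass_def using assms weight_nonneg by (intro integral_eq_nn_integral weight_measurable_finite) auto
  then show ?thesis by (simp add: nn_integral_weight_singleton[OF assms])
qed

definition ladder_prob :: "real set \<Rightarrow> (nat \<Rightarrow> real) \<Rightarrow> real" where
  "ladder_prob Q x = measure \<Omega>' {\<omega> \<in> space \<Omega>'. ladder_event Q \<omega> x}"

lemma nn_integral_weight_section:
  assumes W: "weight Q \<in> borel_measurable limit_space" and x: "x \<in> space Leb"
  shows "(\<integral>\<^sup>+\<omega>. ennreal (weight Q (\<omega>, x)) \<partial>\<Omega>') = ennreal (ladder_prob Q x * exp (\<Sum>k=1..P. x k))"
proof -
  have "(\<lambda>\<omega>. weight Q (\<omega>, x)) \<in> borel_measurable \<Omega>'" using measurable_compose[OF measurable_Pair2'[OF x] W] by simp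
  then have "{\<omega> \<in> space \<Omega>'. 0 < weight Q (\<omega>, x)} \<in> sets \<Omega>'" by (intro borel_measurable_less) auto
  also have "{\<omega> \<in> space \<Omega>'. 0 < weight Q (\<omega>, x)} = {\<omega> \<in> space \<Omega>'. ladder_event Q \<omega> x}" by (auto simp: weight_def)
  finally have sets: "{\<omega> \<in> space \<Omega>'. ladder_event Q \<omega> x} \<in> sets \<Omega>'" .
  have "(\<integral>\<^sup>+\<omega>. ennreal (weight Q (\<omega>, x)) \<partial>\<Omega>') = (\<integral>\<^sup>+\<omega>. ennreal (exp (\<Sum>k=1..P. x k)) * indicator {\<omega> \<in> space \<Omega>'. ladder_event Q \<omega> x} \<omega> \<partial>\<Omega>')"
    by (intro nn_integral_cong) (auto simp: weight_def indicator_def)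
  also have "\<dots> = ennreal (exp (\<Sum>k=1..P. x k)) * ennreal (ladder_prob Q x)"
    unfolding ladder_prob_def using sets by (simp add: nn_integral_cmult \<Omega>'.emeasure_eq_measure del: exp_sum)
  finally show ?thesis by (simp add: ennreal_mult mult.commute ladder_prob_def)
qed

lemma
  assumes W: "weight Q \<in> borel_measurable limit_space"
  shows ladder_prob_measurable: "(\<lambda>x. ladder_prob Q x * exp (\<Sum>k=1..P. x k)) \<in> borel_measurable Leb"
    and nn_integral_weight: "(\<integral>\<^sup>+z. ennreal (weight Q z) \<partial>limit_space) = (\<integral>\<^sup>+x. ennreal (ladder_prob Q x * exp (\<Sum>k=1..P. x k)) \<partial>Leb)"
proof -
  have "(\<lambda>x. \<integral>\<^sup>+\<omega>. ennreal (weight Q (\<omega>, x)) \<partial>\<Omega>') \<in> borel_measurable Leb"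
    using W by (intro \<Omega>'.borel_measurable_nn_integral) (simp add: split_beta' measurable_pair_swap_iff[of _ Leb])
  then have "(\<lambda>x. enn2real (\<integral>\<^sup>+\<omega>. ennreal (weight Q (\<omega>, x)) \<partial>\<Omega>')) \<in> borel_measurable Leb" by (rule measurable_compose) simp
  then show "(\<lambda>x. ladder_prob Q x * exp (\<Sum>k=1..P. x k)) \<in> borel_measurable Leb"
    by (rule measurable_cong[THEN iffD1, rotated]) (simp add: nn_integral_weight_section[OF W] ladder_prob_def)
  have "(\<integral>\<^sup>+z. ennreal (weight Q z) \<partial>limit_space) = (\<integral>\<^sup>+x. \<integral>\<^sup>+\<omega>. ennreal (weight Q (\<omega>, x)) \<partial>\<Omega>' \<partial>Leb)"
    using \<Omega>'Leb.nn_integral_snd[of "\<lambda>z. ennreal (weight Q z)"] W by simp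
  also have "\<dots> = (\<integral>\<^sup>+x. ennreal (ladder_prob Q x * exp (\<Sum>k=1..P. x k)) \<partial>Leb)"
    by (rule nn_integral_cong) (rule nn_integral_weight_section[OF W])
  finally show "(\<integral>\<^sup>+z. ennreal (weight Q z) \<partial>limit_space) = (\<integral>\<^sup>+x. ennreal (ladder_prob Q x * exp (\<Sum>k=1..P. x k)) \<partial>Leb)" .
qed

text \<open>For every \<open>x\<close> the first passage bound compares the whole interval with its end point, where
the mass is known.\<close>

lemma integrable_weight_interval:
  assumes K: "0 < K" shows "integrable limit_space (weight {0..K})"
proof -
  let ?\<pi> = "gauss_tail (\<bar>1 / \<mu>\<bar> * sqrt K) ^ P"
  have \<pi>: "0 < ?\<pi>" using gauss_tail_pos by simp
  have W: "weight {0..K} \<in> borel_measurable limit_space" "weight {K} \<in> borel_measurable limit_space"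
    using K by (auto intro!: weight_measurable_interval weight_measurable_finite)
  have bound: "ladder_prob {0..K} x * ?\<pi> \<le> ladder_prob {K} x" for x
  proof -
    have le: "ladder_event Q \<omega> x \<longleftrightarrow> (\<exists>t\<in>Q. \<forall>k\<in>{1..P}. 0 < - \<mu> * x k + Bstar k t \<omega> - 1 / \<mu> * t)" for Q \<omega>
    proof -
      have "(x k < Bstar k t \<omega> / \<mu> - t / \<mu>\<^sup>2) \<longleftrightarrow> (0 < - \<mu> * x k + Bstar k t \<omega> - 1 / \<mu> * t)" for k t
        using mu_pos by (simp add: field_simps power2_eq_square)
      then show ?thesis by (simp add: ladder_event_def)
    qed
    have "measure \<Omega>' {\<omega> \<in> space \<Omega>'. \<exists>t\<in>{0..K}. \<forall>k\<in>{1..P}. 0 < (\<lambda>_. - \<mu> * x k) (\<lambda>d\<in>{1..P} - {1..P}. Bstar d 0 \<omega>) + Bstar k t \<omega> - 1 / \<mu> * t} * gauss_tail (\<bar>1 / \<mu>\<bar> * sqrt K) ^ card {1..P}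
      \<le> measure \<Omega>' {\<omega> \<in> space \<Omega>'. \<forall>k\<in>{1..P}. 0 < (\<lambda>_. - \<mu> * x k) (\<lambda>d\<in>{1..P} - {1..P}. Bstar d 0 \<omega>) + Bstar k K \<omega> - 1 / \<mu> * K}"
      by (rule brownian_first_passage_bound[OF \<Omega>'.prob_space_axioms local_motions, where V="\<lambda>k _. - \<mu> * x k" and r="\<lambda>_. 0"]) (use K P_pos in auto)
    then show ?thesis unfolding ladder_prob_def le by simp
  qed
  show ?thesis
  proof (rule integrableI_nonneg[OF W(1)])
    have "(\<integral>\<^sup>+z. ennreal (weight {0..K} z) \<partial>limit_space) \<le> (\<integral>\<^sup>+x. ennreal (1 / ?\<pi>) * ennreal (ladder_prob {K} x * exp (\<Sum>k=1..P. x k)) \<partial>Leb)"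
      unfolding nn_integral_weight[OF W(1)]
    proof (rule nn_integral_mono)
      fix x
      have "ladder_prob {0..K} x \<le> 1 / ?\<pi> * ladder_prob {K} x"
        using bound[of x] \<pi> by (simp add: pos_le_divide_eq)
      then have "ladder_prob {0..K} x * exp (\<Sum>k=1..P. x k) \<le> 1 / ?\<pi> * (ladder_prob {K} x * exp (\<Sum>k=1..P. x k))"
        unfolding mult.assoc[symmetric] by (rule mult_right_mono) simp
      then show "ennreal (ladder_prob {0..K} x * exp (\<Sum>k=1..P. x k)) \<le> ennreal (1 / ?\<pi>) * ennreal (ladder_prob {K} x * exp (\<Sum>k=1..P. x k))"
        using \<pi> by (subst ennreal_mult[symmetric]) (auto intro: ennreal_leI simp: ladder_prob_def)
    qed
    also have "\<dots> = ennreal (1 / ?\<pi>) * (\<integral>\<^sup>+z. ennreal (weight {K} z) \<partial>limit_space)"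
      unfolding nn_integral_weight[OF W(2)]
      by (rule nn_integral_cmult) (intro measurable_compose[OF _ measurable_ennreal] ladder_prob_measurable W(2))
    also have "\<dots> < \<infinity>" using nn_integral_weight_singleton[of K] K by (simp add: ennreal_mult_less_top)
    finally show "(\<integral>\<^sup>+z. ennreal (weight {0..K} z) \<partial>limit_space) < \<infinity>" .
  qed (simp add: weight_nonneg)
qed

theorem hit_limits:
  assumes K: "0 < K"
  shows "((\<lambda>u. measure \<Omega> (hit u {0}) / envelope u) \<longlongrightarrow> 1) at_top"
    and "((\<lambda>u. measure \<Omega> (hit u {K}) / envelope u) \<longlongrightarrow> exp (- (K * real P / (2 * \<mu>\<^sup>2)))) at_top"
    and "((\<lambda>u. measure \<Omega> (hit u {0..K}) / envelope u) \<longlongrightarrow> ladder_mass {0..K}) at_top"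
proof -
  define q where "q l = (if l = 0 then 0 else K)" for l :: nat
  have q0: "{0} = q ` {0}" and qK: "{K} = q ` {1}" by (auto simp: q_def)
  have "((\<lambda>u. measure \<Omega> (hit u {0}) / envelope u) \<longlongrightarrow> ladder_mass {0}) at_top"
    by (rule hit_limit[OF K integrable_weight_singleton]) (simp, subst (1 2) q0, rule hit_grid[where n=1], use K in \<open>auto simp: q_def\<close>)
  then show "((\<lambda>u. measure \<Omega> (hit u {0}) / envelope u) \<longlongrightarrow> 1) at_top"
    using ladder_mass_singleton[of 0] by simp
  have "((\<lambda>u. measure \<Omega> (hit u {K}) / envelope u) \<longlongrightarrow> ladder_mass {K}) at_top"
    by (rule hit_limit[OF K integrable_weight_singleton]) (use K in simp, subst (1 2) qK, rule hit_grid[where n=1], use K in \<open>auto simp: q_def\<close>)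
  then show "((\<lambda>u. measure \<Omega> (hit u {K}) / envelope u) \<longlongrightarrow> exp (- (K * real P / (2 * \<mu>\<^sup>2)))) at_top"
    using ladder_mass_singleton[of K] K by simp
  show "((\<lambda>u. measure \<Omega> (hit u {0..K}) / envelope u) \<longlongrightarrow> ladder_mass {0..K}) at_top"
    by (rule hit_limit[OF K integrable_weight_interval[OF K] hit_interval[OF K]])
qed

end



context brownian_tree
begin

section \<open>A single tree with drift\<close>

lemma level_path_last: "\<gamma> < P \<Longrightarrow> level_path \<eta> \<gamma> t \<omega> = stem \<omega> \<gamma> + B (\<eta>, \<gamma>) (t - \<tau> \<eta>) \<omega>"
  by (simp add: level_path_def stem_def)

lemma exceeds_late_iff:
  assumes s: "s \<in> {0..S}" and w: "\<omega> \<in> space \<Omega>"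
  shows "exceeds c x u (T - s) \<omega> \<longleftrightarrow> (\<forall>\<gamma><P. u - x + c * T < tip \<omega> \<gamma> s + c * s)"
proof -
  have "exceeds c x u (T - s) \<omega> \<longleftrightarrow> (\<forall>\<gamma>\<in>{..<P}. 0 < level_path \<eta> \<gamma> (T - s) \<omega> + (x - c * (T - s)) - u)"
    using s tau_end by (intro exceeds_iff w) auto
  also have "\<dots> \<longleftrightarrow> (\<forall>\<gamma>\<in>{..<P}. u - x + c * T < tip \<omega> \<gamma> s + c * s)"
  proof (rule ball_cong[OF refl])
    fix \<gamma> assume "\<gamma> \<in> {..<P}"
    moreover have "T - s - \<tau> \<eta> = S - s" by simp
    ultimately show "(0 < level_path \<eta> \<gamma> (T - s) \<omega> + (x - c * (T - s)) - u) = (u - x + c * T < tip \<omega> \<gamma> s + c * s)"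
      by (simp only: level_path_last lessThan_iff) (simp add: algebra_simps)
  qed
  finally show ?thesis by (simp add: Ball_def)
qed

lemma endpoint_eq_hit: "above_event c x u T = hit (u - x + c * T) {0}"
  using exceeds_late_iff[of 0 _ c x u] S_pos unfolding hit_def by auto

text \<open>On the last stretch, of length at most \<open>K / v\<^sup>2\<close>, the drift amounts to at most \<open>\<bar>c\<bar> * K / v\<^sup>2\<close>. Raising the level by
this amount shortens the stretch, which does no harm for a lower bound.\<close>

lemma hit_subset_exit:
  assumes K: "0 < K" and v: "0 < v" "K / v\<^sup>2 \<le> S"
  shows "hit (v + \<bar>c\<bar> * K / v\<^sup>2) {0..K} \<subseteq> exit_event c x (v + x - c * T) T"
proof
  let ?r = "v + \<bar>c\<bar> * K / v\<^sup>2"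
  fix \<omega> assume "\<omega> \<in> hit ?r {0..K}"
  then obtain t where w: "\<omega> \<in> space \<Omega>" and t: "t \<in> {0..K}" and gt: "\<And>\<gamma>. \<gamma> < P \<Longrightarrow> ?r < tip \<omega> \<gamma> (t / ?r\<^sup>2)"
    unfolding hit_def by blast
  define s where "s = t / ?r\<^sup>2"
  have r: "v \<le> ?r" using K v by simp
  have "s \<le> K / v\<^sup>2"
    unfolding s_def using t r v by (intro frac_le power_mono) auto
  then have sS: "s \<in> {0..S}" using t v unfolding s_def by auto
  have cs: "- (c * s) \<le> \<bar>c\<bar> * K / v\<^sup>2"
  proof -
    have "- (c * s) \<le> \<bar>c\<bar> * s" using sS by (cases "0 \<le> c") (auto simp: abs_if)
    also have "\<dots> \<le> \<bar>c\<bar> * (K / v\<^sup>2)" using \<open>s \<le> K / v\<^sup>2\<close> by (intro mult_left_mono) auto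
    finally show ?thesis by simp
  qed
  have "exceeds c x (v + x - c * T) (T - s) \<omega>"
    unfolding exceeds_late_iff[OF sS w]
  proof (intro allI impI)
    fix \<gamma> assume "\<gamma> < P"
    from gt[OF this] cs show "v + x - c * T - x + c * T < tip \<omega> \<gamma> s + c * s"
      unfolding s_def[symmetric] by linarith
  qed
  moreover have "T - s \<in> {0..T}" using sS tau_mono[of 0 \<eta>] tau_0 by auto
  ultimately show "\<omega> \<in> exit_event c x (v + x - c * T) T" using w by blast
qed

text \<open>For an upper bound the level is lowered to some \<open>r\<close>, and the stretch \<open>K / r\<^sup>2\<close> becomes longer, so \<open>r\<close> has to absorb the drift over
that longer stretch.\<close>

lemma exceeds_imp_hit:
  assumes r: "0 < r" "\<bar>c\<bar> * K / r\<^sup>2 \<le> v - r" "K / r\<^sup>2 \<le> S" and s: "0 \<le> s" "s * r\<^sup>2 \<le> K"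
    and w: "\<omega> \<in> space \<Omega>" and e: "exceeds c x (v + x - c * T) (T - s) \<omega>" and Q: "s * r\<^sup>2 \<in> Q"
  shows "\<omega> \<in> hit r Q"
proof -
  have sK: "s \<le> K / r\<^sup>2" using s r by (simp add: pos_le_divide_eq)
  have sS: "s \<in> {0..S}" using sK s r by auto
  have "c * s \<le> \<bar>c\<bar> * s" using s by (intro mult_right_mono) auto
  also have "\<dots> \<le> \<bar>c\<bar> * (K / r\<^sup>2)" using sK by (intro mult_left_mono) auto
  also have "\<dots> \<le> v - r" using r by simp
  finally have cs: "c * s \<le> v - r" .
  have "r < tip \<omega> \<gamma> (s * r\<^sup>2 / r\<^sup>2)" if "\<gamma> < P" for \<gamma>
    using e[unfolded exceeds_late_iff[OF sS w], rule_format, OF that] cs r by simp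
  then show ?thesis using w Q unfolding hit_def by blast
qed

lemma exit_subset_hit:
  assumes K: "0 < K" and r: "0 < r" "\<bar>c\<bar> * K / r\<^sup>2 \<le> v - r" "K / r\<^sup>2 \<le> S"
  shows "exit_event c x (v + x - c * T) T \<subseteq>
    exit_event c x (v + x - c * T) (T - K / r\<^sup>2) \<union> hit r {0..K}"
proof
  fix \<omega> assume "\<omega> \<in> exit_event c x (v + x - c * T) T"
  then obtain t where w: "\<omega> \<in> space \<Omega>" and t: "t \<in> {0..T}" and e: "exceeds c x (v + x - c * T) t \<omega>" by blast
  show "\<omega> \<in> exit_event c x (v + x - c * T) (T - K / r\<^sup>2) \<union> hit r {0..K}"
  proof (cases "t \<le> T - K / r\<^sup>2")
    case True then show ?thesis using w t e by auto
  next
    case False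
    then have "(T - t) * r\<^sup>2 \<le> K / r\<^sup>2 * r\<^sup>2" by (intro mult_right_mono) auto
    then have tK: "(T - t) * r\<^sup>2 \<le> K" using r by simp
    moreover have "(T - t) * r\<^sup>2 \<in> {0..K}" using tK t by simp
    ultimately have "\<omega> \<in> hit r {0..K}"
      using exceeds_imp_hit[OF r, of "T - t" \<omega> x "{0..K}"] t w e by simp
    then show ?thesis by blast
  qed
qed

text \<open>A change of the level by \<open>a / v\<^sup>2\<close> changes \<open>v\<^sup>2\<close> by a term that tends to \<open>0\<close>.\<close>

lemma envelope_shift:
  assumes f: "((\<lambda>u. f u / envelope u) \<longlongrightarrow> l) at_top"
  shows "((\<lambda>v. f (v + a / v\<^sup>2) / envelope v) \<longlongrightarrow> l) at_top"
proof -
  let ?r = "\<lambda>v::real. v + a / v\<^sup>2"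
  have a0: "((\<lambda>v::real. a / v\<^sup>2) \<longlongrightarrow> 0) at_top" by real_asymp
  have r: "filterlim ?r at_top at_top"
    by (rule filterlim_tendsto_add_at_top[OF a0 filterlim_ident, THEN filterlim_cong[THEN iffD1, rotated -1]]) (auto simp: add.commute)
  have "((\<lambda>v. f (?r v) / envelope (?r v)) \<longlongrightarrow> l) at_top" by (rule filterlim_compose[OF f r])
  moreover have "((\<lambda>v. envelope (?r v) / envelope v) \<longlongrightarrow> 1) at_top"
  proof -
    have e: "((\<lambda>v::real. 2 * a / v + (a / v\<^sup>2)\<^sup>2) \<longlongrightarrow> 0) at_top"
    proof -
      have "((\<lambda>v::real. 2 * a / v) \<longlongrightarrow> 0) at_top" by real_asymp
      then have "((\<lambda>v::real. 2 * a / v + (a / v\<^sup>2)\<^sup>2) \<longlongrightarrow> 0 + 0\<^sup>2) at_top" by (intro tendsto_intros a0)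
      then show ?thesis by simp
    qed
    have q: "((\<lambda>v::real. 1 / (1 + a / v\<^sup>2 / v)) \<longlongrightarrow> 1) at_top"
    proof -
      have "((\<lambda>v::real. a / v\<^sup>2 / v) \<longlongrightarrow> 0) at_top" by real_asymp
      then have "((\<lambda>v::real. 1 / (1 + a / v\<^sup>2 / v)) \<longlongrightarrow> 1 / (1 + 0)) at_top" by (intro tendsto_intros) auto
      then show ?thesis by simp
    qed
    have "((\<lambda>v. exp (- ((2 * a / v + (a / v\<^sup>2)\<^sup>2) * real P / (2 * \<mu>))) * (1 / (1 + a / v\<^sup>2 / v)) ^ P) \<longlongrightarrow>
       exp (- (0 * real P / (2 * \<mu>))) * 1 ^ P) at_top"
      using mu_pos by (intro tendsto_intros e q) auto
    then have lim: "((\<lambda>v. exp (- ((2 * a / v + (a / v\<^sup>2)\<^sup>2) * real P / (2 * \<mu>))) * (1 / (1 + a / v\<^sup>2 / v)) ^ P) \<longlongrightarrow> 1) at_top" by simp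
    have "eventually (\<lambda>v. envelope (?r v) / envelope v = exp (- ((2 * a / v + (a / v\<^sup>2)\<^sup>2) * real P / (2 * \<mu>))) * (1 / (1 + a / v\<^sup>2 / v)) ^ P) at_top"
      using eventually_gt_at_top[of 0] filterlim_at_top_dense[THEN iffD1, OF r, rule_format, of 0]
    proof eventually_elim
      case (elim v)
      have "(?r v)\<^sup>2 = v\<^sup>2 + (2 * a / v + (a / v\<^sup>2)\<^sup>2)"
        using elim by (simp add: power2_eq_square field_simps)
      then have E: "exp (- ((?r v)\<^sup>2 * real P / (2 * \<mu>))) = exp (- (v\<^sup>2 * real P / (2 * \<mu>))) * exp (- ((2 * a / v + (a / v\<^sup>2)\<^sup>2) * real P / (2 * \<mu>)))"
        by (simp add: exp_add[symmetric] add_divide_distrib distrib_right)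
      have "\<mu> / ?r v = (\<mu> / v) * (1 / (1 + a / v\<^sup>2 / v))"
        using elim by (simp add: field_simps)
      then have M: "(\<mu> / ?r v) ^ P = (\<mu> / v) ^ P * (1 / (1 + a / v\<^sup>2 / v)) ^ P" by (simp only: power_mult_distrib)
      have "d * (e * e' * (m * m')) / (d * (e * m)) = e' * m'" if "d \<noteq> 0" "e \<noteq> 0" "m \<noteq> 0" for d e e' m m' :: real
        using that by simp
      then show ?case unfolding envelope_def E M using endpoint_density_pos mu_pos elim by simp
    qed
    then show ?thesis using lim by (simp add: filterlim_cong)
  qed
  ultimately have "((\<lambda>v. f (?r v) / envelope (?r v) * (envelope (?r v) / envelope v)) \<longlongrightarrow> l * 1) at_top" by (rule tendsto_mult)
  moreover have "eventually (\<lambda>v. f (?r v) / envelope (?r v) * (envelope (?r v) / envelope v) = f (?r v) / envelope v) at_top"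
    using filterlim_at_top_dense[THEN iffD1, OF r, rule_format, of 0]
    by eventually_elim (use envelope_pos in \<open>force simp: less_imp_neq\<close>)
  ultimately show ?thesis by (simp only: mult_1_right) (rule Lim_transform_eventually)
qed

definition exit_prob :: "real \<Rightarrow> real \<Rightarrow> real \<Rightarrow> real" where
  "exit_prob c x u = measure \<Omega> (exit_event c x u T)"

definition end_prob :: "real \<Rightarrow> real \<Rightarrow> real \<Rightarrow> real" where
  "end_prob c x u = measure \<Omega> (above_event c x u T)"

lemma sets_hit:
  assumes "\<And>t. t \<in> Q \<Longrightarrow> t \<le> K \<and> 0 \<le> t" and "finite Q \<or> Q = {0..K}" and "0 \<le> K" and u: "0 < u" "K / u\<^sup>2 \<le> S"
  shows "hit u Q \<in> sets \<Omega>"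
proof -
  have hpos: "hit u Q = {\<omega> \<in> space \<Omega>. \<exists>t\<in>Q. \<forall>\<gamma>\<in>{..<P}. 0 < tip \<omega> \<gamma> (t / u\<^sup>2) - u}"
    unfolding hit_def by (simp add: Ball_def)
  have tK: "t / u\<^sup>2 \<le> S" if "t \<le> K" for t
    using divide_right_mono[OF that zero_le_power2[of u]] u by linarith
  have meas: "(\<lambda>\<omega>. tip \<omega> \<gamma> (t / u\<^sup>2) - u) \<in> borel_measurable \<Omega>" if "\<gamma> \<in> {..<P}" "t \<le> K" for \<gamma> t
    using tK[OF that(2)] that(1) by (intro borel_measurable_diff borel_measurable_add stem_measurable driver_measurable borel_measurable_const) auto
  show ?thesis
  proof (cases "finite Q")
    case True
    then show ?thesis unfolding hpos using assms(1)
      by (intro sets.sets_Collect_finite_Ex sets.sets_Collect_finite_All borel_measurable_less meas borel_measurable_const) auto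
  next
    case False
    then have Q: "Q = {0..K}" using assms(2) by blast
    show ?thesis unfolding hpos unfolding Q
    proof (rule sets_ex_positive[OF assms(3)])
      fix \<gamma> \<omega> assume g: "\<gamma> \<in> {..<P}" and w: "\<omega> \<in> space \<Omega>"
      have c: "continuous_on {0..} (\<lambda>t. B (\<eta>, \<gamma>) t \<omega>)"
        by (rule brownian_motion.continuous_paths[OF driver]) (use g w in auto)
      have "continuous_on {0..K} (\<lambda>t. B (\<eta>, \<gamma>) (S - t / u\<^sup>2) \<omega>)"
        by (rule continuous_on_compose2[OF c]) (use u tK in \<open>auto intro!: continuous_intros\<close>)
      then show "continuous_on {0..K} (\<lambda>t. tip \<omega> \<gamma> (t / u\<^sup>2) - u)"
        by (intro continuous_intros)
    qed (use meas in auto)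
  qed
qed

lemma exit_lower:
  assumes K: "0 < K" and a: "a < ladder_mass {0..K}"
  shows "eventually (\<lambda>v. a < exit_prob c x (v + x - c * T) / envelope v) at_top"
proof -
  have "((\<lambda>v. measure \<Omega> (hit (v + \<bar>c\<bar> * K / v\<^sup>2) {0..K}) / envelope v) \<longlongrightarrow> ladder_mass {0..K}) at_top"
    by (rule envelope_shift[OF hit_limits(3)[OF K]])
  then have "eventually (\<lambda>v. a < measure \<Omega> (hit (v + \<bar>c\<bar> * K / v\<^sup>2) {0..K}) / envelope v) at_top" using a by (rule order_tendstoD)
  moreover have "((\<lambda>v::real. K / v\<^sup>2) \<longlongrightarrow> 0) at_top" by real_asymp
  then have "eventually (\<lambda>v. K / v\<^sup>2 < S) at_top" using S_pos by (intro order_tendstoD) auto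
  ultimately show ?thesis using eventually_gt_at_top[of 0]
  proof eventually_elim
    case (elim v)
    have "measure \<Omega> (hit (v + \<bar>c\<bar> * K / v\<^sup>2) {0..K}) \<le> exit_prob c x (v + x - c * T)"
      unfolding exit_prob_def using elim K tau_less[of \<eta>] tau_end
      by (intro \<Omega>.finite_measure_mono hit_subset_exit sets_exit_time) (auto intro: less_imp_le)
    then have "measure \<Omega> (hit (v + \<bar>c\<bar> * K / v\<^sup>2) {0..K}) / envelope v \<le> exit_prob c x (v + x - c * T) / envelope v"
      using envelope_pos[of v] elim by (intro divide_right_mono) (auto intro: less_imp_le)
    then show ?case using elim by linarith
  qed
qed

text \<open>Exits on the last stretch contribute the mass of \<open>{0..K}\<close>. Exits before are bounded by the
probability to be above the level at the beginning of the stretch, which contributes the mass of \<open>{K}\<close>.\<close>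

lemma exit_upper:
  assumes K: "0 < K" and C: "0 < C"
    "\<And>u x t1. \<tau> \<eta> < t1 \<Longrightarrow> t1 \<le> T \<Longrightarrow> measure \<Omega> (exit_event c x u t1)
       \<le> C * measure \<Omega> (above_event c x u t1)"
    and a: "C * exp (- (K * real P / (2 * \<mu>\<^sup>2))) + ladder_mass {0..K} < a"
  shows "eventually (\<lambda>v. exit_prob c x (v + x - c * T) / envelope v < a) at_top"
proof -
  \<comment> \<open>The factor \<open>2\<close> leaves room for the longer stretch: \<open>v\<^sup>2 / 2 \<le> r\<^sup>2\<close> for large \<open>v\<close>.\<close>
  let ?r = "\<lambda>v. v + (- 2 * \<bar>c\<bar> * K) / v\<^sup>2"
  let ?h = "\<lambda>v Q. measure \<Omega> (hit (?r v) Q)"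
  have "((\<lambda>v. C * (?h v {K} / envelope v) + ?h v {0..K} / envelope v) \<longlongrightarrow> C * exp (- (K * real P / (2 * \<mu>\<^sup>2))) + ladder_mass {0..K}) at_top"
    by (intro tendsto_add tendsto_mult tendsto_const envelope_shift[where f="\<lambda>u. measure \<Omega> (hit u _)"] hit_limits[OF K])
  then have "eventually (\<lambda>v. C * (?h v {K} / envelope v) + ?h v {0..K} / envelope v < a) at_top" using a by (rule order_tendstoD)
  moreover have "((\<lambda>v::real. 1 + (- 2 * \<bar>c\<bar> * K) / v\<^sup>2 / v) \<longlongrightarrow> 1 + 0) at_top"
    by (intro tendsto_add tendsto_const) real_asymp
  then have "eventually (\<lambda>v::real. 4/5 < 1 + (- 2 * \<bar>c\<bar> * K) / v\<^sup>2 / v) at_top" by (rule order_tendstoD) simp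
  moreover have "((\<lambda>v::real. 2 * K / v\<^sup>2) \<longlongrightarrow> 0) at_top" by real_asymp
  then have "eventually (\<lambda>v. 2 * K / v\<^sup>2 < S) at_top" using S_pos by (intro order_tendstoD) auto
  ultimately show ?thesis using eventually_gt_at_top[of 0]
  proof eventually_elim
    case (elim v)
    define r where "r = ?r v"
    have "4/5 * v < (1 + (- 2 * \<bar>c\<bar> * K) / v\<^sup>2 / v) * v" using elim by (intro mult_strict_right_mono) auto
    also have "\<dots> = r" using elim by (simp add: r_def field_simps)
    finally have rv: "4/5 * v < r" .
    then have r0: "0 < r" using elim by (intro less_trans[OF _ rv]) simp
    have "v\<^sup>2 / 2 \<le> (4/5 * v)\<^sup>2" by (simp add: power2_eq_square)
    also have "\<dots> \<le> r\<^sup>2" using rv elim by (intro power_mono) auto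
    finally have v2: "v\<^sup>2 / 2 \<le> r\<^sup>2" .
    have Kr: "K / r\<^sup>2 \<le> 2 * K / v\<^sup>2"
    proof -
      have "K / r\<^sup>2 \<le> K / (v\<^sup>2 / 2)" using v2 K elim r0 by (intro divide_left_mono) auto
      then show ?thesis by (simp add: mult.commute)
    qed
    have cr: "\<bar>c\<bar> * K / r\<^sup>2 \<le> v - r"
    proof -
      have "\<bar>c\<bar> * (K / r\<^sup>2) \<le> \<bar>c\<bar> * (2 * K / v\<^sup>2)" using Kr by (intro mult_left_mono) auto
      also have "\<dots> = v - r" by (simp add: r_def)
      finally show ?thesis by simp
    qed
    have KS: "K / r\<^sup>2 < S" "K / r\<^sup>2 \<le> S" using Kr elim by linarith+
    have t1: "\<tau> \<eta> < T - K / r\<^sup>2" "T - K / r\<^sup>2 \<le> T" using KS K by auto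
    have T0: "0 \<le> \<tau> \<eta>" using tau_mono[of 0 \<eta>] tau_0 by simp
    have h1: "hit r {K} \<in> sets \<Omega>" by (rule sets_hit[where K=K]) (use K r0 KS in auto)
    have h2: "hit r {0..K} \<in> sets \<Omega>" by (rule sets_hit[where K=K]) (use K r0 KS in auto)
    let ?E = "exit_event c x (v + x - c * T) (T - K / r\<^sup>2)"
    have E: "?E \<in> sets \<Omega>" using t1 by (intro sets_exit_time) auto
    have "exit_prob c x (v + x - c * T) \<le> measure \<Omega> (?E \<union> hit r {0..K})"
      unfolding exit_prob_def using E h2 by (intro \<Omega>.finite_measure_mono exit_subset_hit K r0 cr KS) auto
    also have "\<dots> \<le> measure \<Omega> ?E + measure \<Omega> (hit r {0..K})" using E h2 by (intro measure_Un_le)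
    also have "measure \<Omega> ?E \<le> C * measure \<Omega> (above_event c x (v + x - c * T) (T - K / r\<^sup>2))" by (rule C(2)[OF t1])
    also have "measure \<Omega> (above_event c x (v + x - c * T) (T - K / r\<^sup>2)) \<le> measure \<Omega> (hit r {K})"
    proof (rule \<Omega>.finite_measure_mono[OF _ h1], rule subsetI)
      fix \<omega> assume "\<omega> \<in> above_event c x (v + x - c * T) (T - K / r\<^sup>2)"
      then show "\<omega> \<in> hit r {K}" using r0 K by (intro exceeds_imp_hit[OF r0 cr KS(2), where s="K / r\<^sup>2" and x=x]) auto
    qed
    finally have "exit_prob c x (v + x - c * T) \<le> C * measure \<Omega> (hit r {K}) + measure \<Omega> (hit r {0..K})" using C by simp
    then have "exit_prob c x (v + x - c * T) / envelope v \<le> (C * measure \<Omega> (hit r {K}) + measure \<Omega> (hit r {0..K})) / envelope v"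
      using envelope_pos[of v] elim by (intro divide_right_mono) (auto intro: less_imp_le)
    also have "\<dots> = C * (measure \<Omega> (hit r {K}) / envelope v) + measure \<Omega> (hit r {0..K}) / envelope v" by (simp add: add_divide_distrib)
    also have "\<dots> < a" unfolding r_def by (rule elim(1))
    finally show ?case .
  qed
qed

lemma end_prob_limit: "((\<lambda>v. end_prob c x (v + x - c * T) / envelope v) \<longlongrightarrow> 1) at_top"
proof -
  have "end_prob c x (v + x - c * T) = measure \<Omega> (hit v {0})" for v
    unfolding end_prob_def endpoint_eq_hit by simp
  then show ?thesis using hit_limits(1)[of 1] by simp
qed

lemma ladder_mass_mono:
  assumes "0 < K" "K \<le> K'" shows "ladder_mass {0..K} \<le> ladder_mass {0..K'}"
  unfolding ladder_mass_def using assms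
  by (intro integral_mono integrable_weight_interval) (auto simp: weight_def ladder_event_def)

lemma ladder_mass_ge_1:
  assumes "0 < K" shows "1 \<le> ladder_mass {0..K}"
proof -
  have "ladder_mass {0} \<le> ladder_mass {0..K}"
    unfolding ladder_mass_def using assms
    by (intro integral_mono integrable_weight_interval integrable_weight_singleton) (auto simp: weight_def ladder_event_def intro!: bexI[of _ 0])
  then show ?thesis using ladder_mass_singleton[of 0] by simp
qed

text \<open>A bound that is uniform in \<open>K\<close> comes from the tree: the probability of an exit is at most a
constant times that of the end point, and both have been compared with \<open>envelope\<close>.\<close>

lemma ladder_mass_bounded:
  obtains C where "\<And>K. 0 < K \<Longrightarrow> ladder_mass {0..K} \<le> C"
proof -
  obtain C where C: "0 < C"
    "\<And>u x t1. \<tau> \<eta> < t1 \<Longrightarrow> t1 \<le> T \<Longrightarrow> measure \<Omega> (exit_event 0 x u t1)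
       \<le> C * measure \<Omega> (above_event 0 x u t1)"
    using exit_bounded_by_endpoint[of 0] by blast
  have "ladder_mass {0..K} \<le> C + 1" if K: "0 < K" for K
  proof (rule ccontr)
    assume "\<not> ladder_mass {0..K} \<le> C + 1"
    then have "eventually (\<lambda>v. C + 1 < exit_prob 0 0 (v + 0 - 0 * T) / envelope v) at_top"
      using K by (intro exit_lower) auto
    moreover have "((\<lambda>v. C * (end_prob 0 0 (v + 0 - 0 * T) / envelope v)) \<longlongrightarrow> C * 1) at_top"
      by (intro tendsto_mult tendsto_const end_prob_limit)
    then have "eventually (\<lambda>v. C * (end_prob 0 0 (v + 0 - 0 * T) / envelope v) < C + 1) at_top" by (rule order_tendstoD) simp
    ultimately have "eventually (\<lambda>v::real. False) at_top" using eventually_gt_at_top[of 0]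
    proof eventually_elim
      case (elim v)
      have "exit_prob 0 0 (v + 0 - 0 * T) \<le> C * end_prob 0 0 (v + 0 - 0 * T)"
        unfolding exit_prob_def end_prob_def using S_pos by (intro C(2)) auto
      then have "exit_prob 0 0 (v + 0 - 0 * T) / envelope v \<le> C * end_prob 0 0 (v + 0 - 0 * T) / envelope v"
        using envelope_pos[of v] elim by (intro divide_right_mono) (auto intro: less_imp_le)
      then show ?case using elim by simp
    qed
    then show False by simp
  qed
  then show thesis using that by blast
qed

abbreviation "H \<equiv> H_const \<Omega>' Bstar P (1 / \<mu>)"

text \<open>Time \<open>0\<close> can be added to the positive times, because the condition is open and the paths are continuous.\<close>

lemma ladder_event_positive_times:
  assumes w: "\<omega> \<in> space \<Omega>'"
  shows "ladder_event {0<..} \<omega> x \<longleftrightarrow> (\<exists>n. ladder_event {0..real (Suc n)} \<omega> x)"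
proof
  assume "ladder_event {0<..} \<omega> x"
  then obtain t where t: "0 < t" "\<forall>k\<in>{1..P}. x k < Bstar k t \<omega> / \<mu> - t / \<mu>\<^sup>2" by (auto simp: ladder_event_def)
  obtain n where "t \<le> real n" using real_arch_simple by blast
  then have "t \<in> {0..real (Suc n)}" using t by simp
  then show "\<exists>n. ladder_event {0..real (Suc n)} \<omega> x" using t unfolding ladder_event_def by blast
next
  assume "\<exists>n. ladder_event {0..real (Suc n)} \<omega> x"
  then obtain t where t: "0 \<le> t" "\<forall>k\<in>{1..P}. 0 < Bstar k t \<omega> / \<mu> - t / \<mu>\<^sup>2 - x k"
    unfolding ladder_event_iff by auto
  have "\<forall>k\<in>{1..P}. eventually (\<lambda>s. 0 < Bstar k s \<omega> / \<mu> - s / \<mu>\<^sup>2 - x k) (at t within {0..t + 1})"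
  proof
    fix k assume k: "k \<in> {1..P}"
    have "((\<lambda>s. Bstar k s \<omega> / \<mu> - s / \<mu>\<^sup>2 - x k) \<longlongrightarrow> Bstar k t \<omega> / \<mu> - t / \<mu>\<^sup>2 - x k) (at t within {0..t + 1})"
      using ladder_continuous[OF k w, of "t + 1" "x k"] t(1) by (simp add: continuous_on_def)
    then show "eventually (\<lambda>s. 0 < Bstar k s \<omega> / \<mu> - s / \<mu>\<^sup>2 - x k) (at t within {0..t + 1})"
      using t(2) k by (intro order_tendstoD) auto
  qed
  then have "eventually (\<lambda>s. \<forall>k\<in>{1..P}. 0 < Bstar k s \<omega> / \<mu> - s / \<mu>\<^sup>2 - x k) (at t within {0..t + 1})"
    by (simp add: eventually_ball_finite)
  then obtain d where d: "0 < d" "\<And>s. s \<in> {0..t + 1} \<Longrightarrow> s \<noteq> t \<Longrightarrow> dist s t < d \<Longrightarrow> \<forall>k\<in>{1..P}. 0 < Bstar k s \<omega> / \<mu> - s / \<mu>\<^sup>2 - x k"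
    by (auto simp: eventually_at)
  define s where "s = t + min d 1 / 2"
  have "\<forall>k\<in>{1..P}. 0 < Bstar k s \<omega> / \<mu> - s / \<mu>\<^sup>2 - x k"
    using d t(1) by (intro d(2)) (auto simp: s_def dist_real_def min_def)
  moreover have "0 < s" using d t by (simp add: s_def)
  ultimately show "ladder_event {0<..} \<omega> x" unfolding ladder_event_iff by auto
qed

lemma ladder_mass_tendsto_H: "(\<lambda>n. ladder_mass {0..real (Suc n)}) \<longlonglongrightarrow> H"
proof -
  let ?Z = "limit_space"
  let ?w = "\<lambda>n z. ennreal (weight {0..real (Suc n)} z)"
  have wm: "weight {0..real (Suc n)} \<in> borel_measurable ?Z" for n by (rule weight_measurable_interval) simp
  have mono: "?w m z \<le> ?w n z" if "m \<le> n" for m n z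
    using that by (intro ennreal_leI) (auto simp: weight_def ladder_event_def)
  have eq: "ennreal (weight {0<..} z) = (SUP n. ?w n z)" if z: "z \<in> space ?Z" for z
  proof -
    have w: "fst z \<in> space \<Omega>'" using z by (auto simp: space_pair_measure)
    note iff = ladder_event_positive_times[OF w, of "snd z"]
    show ?thesis
    proof (rule ennreal_SUP_attained)
      show "?w n z \<le> ennreal (weight {0<..} z)" for n
        using iff by (intro ennreal_leI) (auto simp: weight_def)
      assume "ennreal (weight {0<..} z) \<noteq> 0"
      then have "ladder_event {0<..} (fst z) (snd z)" by (cases "ladder_event {0<..} (fst z) (snd z)") (simp_all add: weight_def)
      then obtain n where "ladder_event {0..real (Suc n)} (fst z) (snd z)" using iff by blast
      then have "?w n z = ennreal (weight {0<..} z)" using \<open>ladder_event {0<..} (fst z) (snd z)\<close> by (simp add: weight_def)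
      then show "\<exists>n. ?w n z = ennreal (weight {0<..} z)" by (rule exI)
    qed
  qed
  have wm0': "(\<lambda>z. ennreal (weight {0<..} z)) \<in> borel_measurable ?Z"
  proof (rule measurable_cong[THEN iffD2, OF eq])
    show "(\<lambda>z. SUP n. ?w n z) \<in> borel_measurable ?Z"
      using wm by (intro borel_measurable_SUP) auto
  qed
  then have "(\<lambda>z. enn2real (ennreal (weight {0<..} z))) \<in> borel_measurable ?Z" by (rule measurable_compose) simp
  then have wm0: "weight {0<..} \<in> borel_measurable ?Z" using weight_nonneg by simp
  have mass: "(\<integral>\<^sup>+z. ?w n z \<partial>?Z) = ennreal (ladder_mass {0..real (Suc n)})" for n
    unfolding ladder_mass_def by (rule nn_integral_eq_integral[OF integrable_weight_interval]) (auto simp: weight_nonneg)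
  obtain C where C: "\<And>K. 0 < K \<Longrightarrow> ladder_mass {0..K} \<le> C" using ladder_mass_bounded by blast
  have tot: "(\<integral>\<^sup>+z. ennreal (weight {0<..} z) \<partial>?Z) = (SUP n. ennreal (ladder_mass {0..real (Suc n)}))"
  proof -
    have "(\<integral>\<^sup>+z. ennreal (weight {0<..} z) \<partial>?Z) = (\<integral>\<^sup>+z. (SUP n. ?w n z) \<partial>?Z)"
      by (rule nn_integral_cong) (rule eq)
    also have "\<dots> = (SUP n. \<integral>\<^sup>+z. ?w n z \<partial>?Z)"
      using mono wm by (intro nn_integral_monotone_convergence_SUP) (auto simp: incseq_def le_fun_def)
    finally show ?thesis unfolding mass .
  qed
  have "(SUP n. ennreal (ladder_mass {0..real (Suc n)})) \<le> ennreal C"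
    using C by (intro SUP_least ennreal_leI) simp
  then have fin: "(\<integral>\<^sup>+z. ennreal (weight {0<..} z) \<partial>?Z) < top" unfolding tot by (rule le_less_trans) simp
  have lim: "(\<lambda>n. ennreal (ladder_mass {0..real (Suc n)})) \<longlonglongrightarrow> (\<integral>\<^sup>+z. ennreal (weight {0<..} z) \<partial>?Z)"
    unfolding tot by (intro LIMSEQ_SUP) (auto simp: incseq_def intro!: ennreal_leI ladder_mass_mono)
  have Hw: "H = enn2real (\<integral>\<^sup>+z. ennreal (weight {0<..} z) \<partial>?Z)"
  proof -
    have "H = (\<integral>x. ladder_prob {0<..} x * exp (\<Sum>k=1..P. x k) \<partial>Leb)"
    proof -
      have "{\<omega> \<in> space \<Omega>'. \<exists>t\<in>{0<..}. \<forall>k\<in>{1..P}. 1 / \<mu> * Bstar k t \<omega> - (1 / \<mu>)\<^sup>2 * t > x k} = {\<omega> \<in> space \<Omega>'. ladder_event {0<..} \<omega> x}" for x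
        unfolding ladder_event_def by (simp add: power_divide)
      then show ?thesis unfolding H_const_def ladder_prob_def by simp
    qed
    also have "\<dots> = enn2real (\<integral>\<^sup>+x. ennreal (ladder_prob {0<..} x * exp (\<Sum>k=1..P. x k)) \<partial>Leb)"
      by (rule integral_eq_nn_integral[OF ladder_prob_measurable[OF wm0]]) (simp add: ladder_prob_def)
    finally show ?thesis unfolding nn_integral_weight[OF wm0] .
  qed
  have "(\<lambda>n. enn2real (ennreal (ladder_mass {0..real (Suc n)}))) \<longlonglongrightarrow> enn2real (\<integral>\<^sup>+z. ennreal (weight {0<..} z) \<partial>?Z)"
    by (rule tendsto_enn2real) (use fin lim in simp_all)
  moreover have "0 \<le> ladder_mass {0..real (Suc n)}" for n using ladder_mass_ge_1[of "real (Suc n)"] by simp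
  ultimately show ?thesis unfolding Hw by simp
qed

lemma H_ge_1: "1 \<le> H"
  by (rule LIMSEQ_le_const[OF ladder_mass_tendsto_H]) (auto intro!: ladder_mass_ge_1)

text \<open>Both bounds hold for every \<open>K\<close>, and they meet as \<open>K\<close> tends to infinity.\<close>

theorem exit_prob_limit: "((\<lambda>v. exit_prob c x (v + x - c * T) / envelope v) \<longlongrightarrow> H) at_top"
proof (rule order_tendstoI)
  fix a assume "a < H"
  then have "eventually (\<lambda>n. a < ladder_mass {0..real (Suc n)}) sequentially"
    by (rule order_tendstoD[OF ladder_mass_tendsto_H])
  then obtain n where "a < ladder_mass {0..real (Suc n)}" by (auto simp: eventually_sequentially)
  then show "eventually (\<lambda>v. a < exit_prob c x (v + x - c * T) / envelope v) at_top" by (intro exit_lower) auto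
next
  fix a assume a: "H < a"
  obtain C where C: "0 < C"
    "\<And>u x t1. \<tau> \<eta> < t1 \<Longrightarrow> t1 \<le> T \<Longrightarrow> measure \<Omega> (exit_event c x u t1)
       \<le> C * measure \<Omega> (above_event c x u t1)"
    using exit_bounded_by_endpoint[of c] by blast
  define \<theta> where "\<theta> = real P / (2 * \<mu>\<^sup>2)"
  have \<theta>: "0 < \<theta>" using P_pos mu_pos by (simp add: \<theta>_def)
  have "(\<lambda>n. exp (- (real (Suc n) * \<theta>))) \<longlonglongrightarrow> 0" using \<theta> by real_asymp
  then have "(\<lambda>n. C * exp (- (real (Suc n) * \<theta>)) + ladder_mass {0..real (Suc n)}) \<longlonglongrightarrow> C * 0 + H"
    by (intro tendsto_add tendsto_mult tendsto_const ladder_mass_tendsto_H)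
  then have "eventually (\<lambda>n. C * exp (- (real (Suc n) * \<theta>)) + ladder_mass {0..real (Suc n)} < a) sequentially"
    using a by (intro order_tendstoD) auto
  then obtain n where n: "C * exp (- (real (Suc n) * \<theta>)) + ladder_mass {0..real (Suc n)} < a" by (auto simp: eventually_sequentially)
  show "eventually (\<lambda>v. exit_prob c x (v + x - c * T) / envelope v < a) at_top"
    by (rule exit_upper[OF _ C]) (use n in \<open>auto simp: \<theta>_def\<close>)
qed

lemma level_shift: "filterlim (\<lambda>u. u - x + c * T) at_top at_top"
proof -
  have "filterlim (\<lambda>u. (- x + c * T) + u) at_top at_top" by (rule filterlim_tendsto_add_at_top[OF tendsto_const filterlim_ident])
  then show ?thesis by (simp add: algebra_simps)
qed

theorem exit_prob_asymptotics: "((\<lambda>u. exit_prob c x u / envelope (u - x + c * T)) \<longlongrightarrow> H) at_top"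
  using filterlim_compose[OF exit_prob_limit level_shift, of c x x c] by simp

theorem end_prob_asymptotics: "((\<lambda>u. end_prob c x u / envelope (u - x + c * T)) \<longlongrightarrow> 1) at_top"
  using filterlim_compose[OF end_prob_limit level_shift, of c x x c] by simp

end



section \<open>Independent trees\<close>

lemma finite_total_preorder_has_maximum:
  assumes "finite S" "S \<noteq> {}" and tot: "\<And>i j. R i j \<or> R j i" and tr: "\<And>i j k. R i j \<Longrightarrow> R j k \<Longrightarrow> R i k"
  shows "\<exists>i\<in>S. \<forall>j\<in>S. R i j"
  using assms(1,2)
proof (induction rule: finite_ne_induct)
  case (singleton i) then show ?case using tot by blast
next
  case (insert i S)
  then obtain m where m: "m \<in> S" "\<forall>j\<in>S. R m j" by blast
  show ?case
  proof (cases "R m i")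
    case True then show ?thesis using m by blast
  next
    case False
    then have "R i m" using tot by blast
    then have "\<forall>j\<in>insert i S. R i j" using m tr tot by blast
    then show ?thesis by blast
  qed
qed

text \<open>From \<open>1 - t \<le> exp (- t)\<close> and \<open>exp (- s) \<le> 1 / (1 + s) \<le> 1 - s + s\<^sup>2\<close>.\<close>

lemma one_minus_prod_bounds:
  fixes p :: "'i \<Rightarrow> real"
  assumes I: "finite I" and p: "\<And>i. i \<in> I \<Longrightarrow> 0 \<le> p i" "\<And>i. i \<in> I \<Longrightarrow> p i \<le> 1"
  shows "(\<Prod>i\<in>I. 1 - p i) \<le> 1 - (\<Sum>i\<in>I. p i) + (\<Sum>i\<in>I. p i)\<^sup>2"
proof -
  let ?s = "\<Sum>i\<in>I. p i"
  have s: "0 \<le> ?s" using p by (intro sum_nonneg)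
  have "(\<Prod>i\<in>I. 1 - p i) \<le> (\<Prod>i\<in>I. exp (- p i))"
  proof (intro prod_mono conjI)
    fix i assume "i \<in> I" then show "0 \<le> 1 - p i" using p by simp
    show "1 - p i \<le> exp (- p i)" using exp_ge_add_one_self[of "- p i"] by simp
  qed
  also have "\<dots> = exp (- ?s)" using I by (simp add: exp_sum sum_negf[symmetric])
  also have "\<dots> \<le> 1 / (1 + ?s)"
    using exp_ge_add_one_self[of ?s] s by (simp add: exp_minus field_simps)
  also have "\<dots> \<le> 1 - ?s + ?s\<^sup>2"
  proof -
    have "1 \<le> (1 - ?s + ?s\<^sup>2) * (1 + ?s)" using s by (simp add: algebra_simps power2_eq_square)
    then show ?thesis using s by (simp add: pos_divide_le_eq)
  qed
  finally show ?thesis .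
qed

lemma power_times_exp_tendsto_0:
  fixes k :: nat and \<kappa> d :: real
  assumes "0 < \<kappa>"
  shows "((\<lambda>u. (u + d) ^ k * exp (- \<kappa> * (u + d))) \<longlongrightarrow> 0) at_top"
proof -
  have f: "filterlim (\<lambda>u. \<kappa> * (u + d)) at_top at_top" using assms by real_asymp
  have "((\<lambda>u. (1 / \<kappa>) ^ k * ((\<kappa> * (u + d)) ^ k / exp (\<kappa> * (u + d)))) \<longlongrightarrow> (1 / \<kappa>) ^ k * 0) at_top"
    by (intro tendsto_mult tendsto_const filterlim_compose[OF tendsto_power_div_exp_0 f])
  moreover have "(1 / \<kappa>) ^ k * ((\<kappa> * (u + d)) ^ k / exp (\<kappa> * (u + d))) = (u + d) ^ k * exp (- \<kappa> * (u + d))" for u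
  proof -
    have "(1 / \<kappa>) ^ k * (\<kappa> * (u + d)) ^ k = (1 / \<kappa> * (\<kappa> * (u + d))) ^ k" by (simp only: power_mult_distrib)
    then have "(1 / \<kappa>) ^ k * (\<kappa> * (u + d)) ^ k = (u + d) ^ k" using assms by simp
    then show ?thesis by (simp add: exp_minus divide_inverse mult.assoc[symmetric])
  qed
  ultimately show ?thesis by simp
qed

text \<open>The exponent is a quadratic polynomial in \<open>u\<close> whose leading coefficient is negative in the first case; in the second case it
is linear with negative slope. Both beat the powers of \<open>u\<close>. In the third case
the exponent vanishes and the power of \<open>u\<close> decides.\<close>

lemma gaussian_ratio_tendsto_0:
  fixes f1 f2 \<mu>1 \<mu>2 d1 d2 :: real and P1 P2 :: nat
  assumes pos: "0 < \<mu>1" "0 < \<mu>2" "0 < P1" "0 < P2" and f: "0 < f1"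
    and order: "\<mu>1 / P1 > \<mu>2 / P2 \<or> \<mu>1 / P1 = \<mu>2 / P2 \<and> d1 < d2 \<or> \<mu>1 / P1 = \<mu>2 / P2 \<and> d1 = d2 \<and> P1 < P2"
  shows "((\<lambda>u. (f2 * (exp (- ((u + d2)\<^sup>2 * P2 / (2 * \<mu>2))) * (\<mu>2 / (u + d2)) ^ P2)) /
     (f1 * (exp (- ((u + d1)\<^sup>2 * P1 / (2 * \<mu>1))) * (\<mu>1 / (u + d1)) ^ P1))) \<longlongrightarrow> 0) at_top"
proof -
  define a1 a2 where "a1 = P1 / (2 * \<mu>1)" and "a2 = P2 / (2 * \<mu>2)"
  define e where "e u = a1 * (u + d1)\<^sup>2 - a2 * (u + d2)\<^sup>2" for u
  define C where "C = f2 / f1 * (\<mu>2 ^ P2 / \<mu>1 ^ P1)"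
  have a: "0 < a1" "0 < a2" using pos by (auto simp: a1_def a2_def)
  have aeq: "\<mu>1 / P1 = 1 / (2 * a1)" "\<mu>2 / P2 = 1 / (2 * a2)" using pos by (auto simp: a1_def a2_def)
  have order': "a1 < a2 \<or> a1 = a2 \<and> d1 < d2 \<or> a1 = a2 \<and> d1 = d2 \<and> P1 < P2"
    using order a unfolding aeq by (auto simp: field_simps)
  have gt: "eventually (\<lambda>u. 1 < u + d1 \<and> 1 < u + d2) at_top"
    using eventually_gt_at_top[of "1 - d1"] eventually_gt_at_top[of "1 - d2"] by eventually_elim auto
  have main: "((\<lambda>u. exp (e u) * ((u + d1) ^ P1 / (u + d2) ^ P2)) \<longlongrightarrow> 0) at_top"
  proof (cases "a1 = a2 \<and> d1 = d2")
    case True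
    then have "P1 < P2" using order' by auto
    then obtain m where m: "P2 = P1 + Suc m" using less_iff_Suc_add by auto
    have "((\<lambda>u. 1 / (u + d1)) \<longlongrightarrow> 0) at_top" by real_asymp
    then have "((\<lambda>u. (1 / (u + d1)) ^ Suc m) \<longlongrightarrow> 0 ^ Suc m) at_top" by (rule tendsto_power)
    then have 0: "((\<lambda>u. (1 / (u + d1)) ^ Suc m) \<longlongrightarrow> 0) at_top" by simp
    have "eventually (\<lambda>u. (1 / (u + d1)) ^ Suc m = exp (e u) * ((u + d1) ^ P1 / (u + d2) ^ P2)) at_top"
      using gt
    proof eventually_elim
      case (elim u)
      have "e u = 0" using True by (simp add: e_def)
      have "(1 / z) ^ Suc m = z ^ P1 / z ^ P2" if "z \<noteq> 0" for z :: real
        unfolding m power_add power_one_over using that by simp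
      from this[of "u + d2"] show ?case using True elim \<open>e u = 0\<close> by simp
    qed
    with 0 show ?thesis by (rule Lim_transform_eventually)
  next
    case False
    \<comment> \<open>Reserve a factor \<open>exp (- \<kappa> * (u + d1))\<close> of the exponential decay for the power of \<open>u\<close>.\<close>
    have "\<exists>\<kappa>>0. filterlim (\<lambda>u. e u + \<kappa> * (u + d1)) at_bot at_top"
    proof (cases "a1 < a2")
      case True
      define \<alpha> where "\<alpha> = a2 - a1"
      have \<alpha>: "0 < \<alpha>" using True by (simp add: \<alpha>_def)
      define \<beta> where "\<beta> = 2 * a1 * d1 - 2 * a2 * d2 + 1"
      define \<delta> where "\<delta> = a1 * d1\<^sup>2 - a2 * d2\<^sup>2 + d1"
      have "e u + 1 * (u + d1) = u * (- \<alpha> * u + \<beta>) + \<delta>" for u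
        by (simp add: e_def \<alpha>_def \<beta>_def \<delta>_def power2_eq_square algebra_simps)
      moreover have "filterlim (\<lambda>u::real. u * (- \<alpha> * u + \<beta>) + \<delta>) at_bot at_top"
        using \<alpha> by real_asymp
      ultimately have "filterlim (\<lambda>u. e u + 1 * (u + d1)) at_bot at_top" by (simp only:)
      then show ?thesis by (intro exI[of _ 1]) simp
    next
      case F: False
      then have eq: "a1 = a2" "d1 < d2" using order' False by auto
      define \<kappa> where "\<kappa> = a1 * (d2 - d1)"
      have \<kappa>: "0 < \<kappa>" using a eq by (simp add: \<kappa>_def)
      define \<delta> where "\<delta> = a1 * d1\<^sup>2 - a1 * d2\<^sup>2 + \<kappa> * d1"
      have "e u + \<kappa> * (u + d1) = - \<kappa> * u + \<delta>" for u
        using eq by (simp add: e_def \<kappa>_def \<delta>_def power2_eq_square algebra_simps)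
      moreover have "filterlim (\<lambda>u::real. - \<kappa> * u + \<delta>) at_bot at_top"
        using \<kappa> by real_asymp
      ultimately have "filterlim (\<lambda>u. e u + \<kappa> * (u + d1)) at_bot at_top" by (simp only:)
      then show ?thesis using \<kappa> by blast
    qed
    then obtain \<kappa> where \<kappa>: "0 < \<kappa>" "filterlim (\<lambda>u. e u + \<kappa> * (u + d1)) at_bot at_top" by blast
    have "((\<lambda>u. exp (e u + \<kappa> * (u + d1)) * ((u + d1) ^ P1 * exp (- \<kappa> * (u + d1)))) \<longlongrightarrow> 0 * 0) at_top"
      by (intro tendsto_mult filterlim_compose[OF exp_at_bot \<kappa>(2)] power_times_exp_tendsto_0 \<kappa>)
    moreover have "exp (e u + \<kappa> * (u + d1)) * ((u + d1) ^ P1 * exp (- \<kappa> * (u + d1))) = exp (e u) * (u + d1) ^ P1" for u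
    proof -
      have "exp (e u + \<kappa> * (u + d1)) * exp (- \<kappa> * (u + d1)) = exp (e u)" by (simp add: exp_add[symmetric])
      then show ?thesis by (simp only: mult.assoc mult.left_commute mult.commute)
    qed
    ultimately have up: "((\<lambda>u. exp (e u) * (u + d1) ^ P1) \<longlongrightarrow> 0) at_top" by (simp only: mult_zero_left)
    show ?thesis
    proof (rule tendsto_sandwich[OF _ _ tendsto_const up])
      show "eventually (\<lambda>u. 0 \<le> exp (e u) * ((u + d1) ^ P1 / (u + d2) ^ P2)) at_top"
        using gt by eventually_elim simp
      show "eventually (\<lambda>u. exp (e u) * ((u + d1) ^ P1 / (u + d2) ^ P2) \<le> exp (e u) * (u + d1) ^ P1) at_top"
        using gt
      proof eventually_elim
        case (elim u)
        have "1 \<le> (u + d2) ^ P2" using elim by (intro one_le_power) simp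
        moreover have "0 \<le> (u + d1) ^ P1" using elim by simp
        ultimately have "(u + d1) ^ P1 / (u + d2) ^ P2 \<le> (u + d1) ^ P1 / 1" by (intro divide_left_mono) auto
        then show ?case by (intro mult_left_mono) auto
      qed
    qed
  qed
  have "((\<lambda>u. C * (exp (e u) * ((u + d1) ^ P1 / (u + d2) ^ P2))) \<longlongrightarrow> C * 0) at_top"
    by (intro tendsto_mult tendsto_const main)
  moreover have "eventually (\<lambda>u. C * (exp (e u) * ((u + d1) ^ P1 / (u + d2) ^ P2)) =
     (f2 * (exp (- ((u + d2)\<^sup>2 * P2 / (2 * \<mu>2))) * (\<mu>2 / (u + d2)) ^ P2)) /
     (f1 * (exp (- ((u + d1)\<^sup>2 * P1 / (2 * \<mu>1))) * (\<mu>1 / (u + d1)) ^ P1))) at_top"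
    using gt
  proof eventually_elim
    case (elim u)
    have E: "exp (e u) = exp (- ((u + d2)\<^sup>2 * P2 / (2 * \<mu>2))) / exp (- ((u + d1)\<^sup>2 * P1 / (2 * \<mu>1)))"
      unfolding exp_diff[symmetric] by (simp add: e_def a1_def a2_def mult.commute)
    have "C * (x2 / x1 * (w1 / w2)) = f2 * (x2 * (\<mu>2 ^ P2 / w2)) / (f1 * (x1 * (\<mu>1 ^ P1 / w1)))"
      if "x1 \<noteq> 0" "w1 \<noteq> 0" "w2 \<noteq> 0" for x1 x2 w1 w2
      using that f pos by (simp add: C_def ac_simps)
    from this[of "exp (- ((u + d1)\<^sup>2 * P1 / (2 * \<mu>1)))" "(u + d1) ^ P1" "(u + d2) ^ P2" "exp (- ((u + d2)\<^sup>2 * P2 / (2 * \<mu>2)))"]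
    show ?case unfolding E power_divide using elim by simp
  qed
  ultimately show ?thesis by (simp only: mult_zero_right) (rule Lim_transform_eventually)
qed

context brownian_tree
begin

text \<open>Countably many times that detect every exit. With them the exit becomes a measurable event in the product space of the
paths, to which the independence of the trees applies.\<close>

definition observation_times :: "real set" where
  "observation_times = (\<Union>i\<le>\<eta>. \<Union>m. dyadic_points (\<tau> i) (\<tau> (Suc i)) m)"

lemma countable_observation_times: "countable observation_times"
  unfolding observation_times_def
  by (intro countable_UN countable_finite[OF finite_dyadic_points] countable_finite[OF finite_atMost] countableI_type)

lemma observation_times_subset: "observation_times \<subseteq> {0..T}"
proof
  fix t assume "t \<in> observation_times"
  then obtain i m where i: "i \<le> \<eta>" "t \<in> dyadic_points (\<tau> i) (\<tau> (Suc i)) m" by (auto simp: observation_times_def)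
  then have "t \<in> {\<tau> i..\<tau> (Suc i)}" using dyadic_points_subset[of "\<tau> i" "\<tau> (Suc i)" m] tau_less[of i] by auto
  then show "t \<in> {0..T}" using i tau_mono[of 0 i] tau_mono[of "Suc i" "Suc \<eta>"] tau_0 tau_end by auto
qed

lemma exceeds_observation_times:
  assumes w: "\<omega> \<in> space \<Omega>"
  shows "(\<exists>t\<in>{0..T}. exceeds c x u t \<omega>) \<longleftrightarrow> (\<exists>t\<in>observation_times. exceeds c x u t \<omega>)"
proof
  assume "\<exists>t\<in>{0..T}. exceeds c x u t \<omega>"
  then obtain t where t: "t \<in> {0..T}" "exceeds c x u t \<omega>" by blast
  obtain i where i: "i \<le> \<eta>" "t \<in> {\<tau> i..\<tau> (Suc i)}" using interval_levels[OF t(1)] by blast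
  then have "\<exists>t\<in>{\<tau> i..\<tau> (Suc i)}. exceeds c x u t \<omega>" using t by blast
  then obtain m s where "s \<in> dyadic_points (\<tau> i) (\<tau> (Suc i)) m" "exceeds c x u s \<omega>"
    using level_exceeds_dyadic[OF i(1) _ order.refl w, of c x u] tau_less[OF i(1)] by auto
  then show "\<exists>t\<in>observation_times. exceeds c x u t \<omega>" using i(1) unfolding observation_times_def by blast
qed (use observation_times_subset in blast)

definition crossing_paths :: "real \<Rightarrow> real \<Rightarrow> real \<Rightarrow> (nat \<times> real \<Rightarrow> real) set" where
  "crossing_paths c x u = {f \<in> space (\<Pi>\<^sub>M z\<in>leaves \<eta> N \<times> {0..T}. borel). \<exists>t\<in>observation_times. \<forall>\<gamma>\<in>leaves \<eta> N. u < f (\<gamma>, t) + (x - c * t)}"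

lemma sets_crossing_paths: "crossing_paths c x u \<in> sets (\<Pi>\<^sub>M z\<in>leaves \<eta> N \<times> {0..T}. borel)"
proof -
  let ?M = "\<Pi>\<^sub>M z\<in>leaves \<eta> N \<times> {0..T}. (borel :: real measure)"
  have "{f \<in> space ?M. \<forall>\<gamma>\<in>leaves \<eta> N. u < f (\<gamma>, t) + (x - c * t)} \<in> sets ?M" if "t \<in> observation_times" for t
    using that observation_times_subset
    by (intro sets.sets_Collect_finite_All borel_measurable_less borel_measurable_add measurable_component_singleton borel_measurable_const)
       (auto simp: leaves_def)
  then have "(\<Union>t\<in>observation_times. {f \<in> space ?M. \<forall>\<gamma>\<in>leaves \<eta> N. u < f (\<gamma>, t) + (x - c * t)}) \<in> sets ?M"
    by (intro sets.countable_UN'' countable_observation_times)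
  also have "(\<Union>t\<in>observation_times. {f \<in> space ?M. \<forall>\<gamma>\<in>leaves \<eta> N. u < f (\<gamma>, t) + (x - c * t)}) = crossing_paths c x u"
    unfolding crossing_paths_def by blast
  finally show ?thesis .
qed

lemma exit_event_eq_crossing_paths:
  "exit_event c x u T =
    (\<lambda>\<omega>. \<lambda>(\<gamma>, t)\<in>leaves \<eta> N \<times> {0..T}. decision_tree \<eta> \<tau> N B \<gamma> t \<omega>) -` crossing_paths c x u \<inter> space \<Omega>"
proof -
  have "(\<exists>t\<in>{0..T}. exceeds c x u t \<omega>) \<longleftrightarrow> (\<lambda>(\<gamma>, t)\<in>leaves \<eta> N \<times> {0..T}. decision_tree \<eta> \<tau> N B \<gamma> t \<omega>) \<in> crossing_paths c x u"
    if w: "\<omega> \<in> space \<Omega>" for \<omega>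
  proof -
    have "exceeds c x u t \<omega> \<longleftrightarrow> (\<forall>\<gamma>\<in>leaves \<eta> N. u < (\<lambda>(\<gamma>, t)\<in>leaves \<eta> N \<times> {0..T}. decision_tree \<eta> \<tau> N B \<gamma> t \<omega>) (\<gamma>, t) + (x - c * t))"
      if "t \<in> observation_times" for t
      unfolding exceeds_def drifted_tree_def using that observation_times_subset by (intro ball_cong refl) auto
    moreover have "(\<lambda>(\<gamma>, t)\<in>leaves \<eta> N \<times> {0..T}. decision_tree \<eta> \<tau> N B \<gamma> t \<omega>) \<in> space (\<Pi>\<^sub>M z\<in>leaves \<eta> N \<times> {0..T}. (borel :: real measure))"
      by (simp add: space_PiM)
    ultimately show ?thesis
      unfolding exceeds_observation_times[OF w] crossing_paths_def mem_Collect_eq by (simp cong: bex_cong)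
  qed
  then show ?thesis by auto
qed

lemma exit_prob_relative: "((\<lambda>u. exit_prob c x u / (H * end_prob c x u)) \<longlongrightarrow> 1) at_top"
proof -
  have "((\<lambda>u. (exit_prob c x u / envelope (u - x + c * T)) / (H * (end_prob c x u / envelope (u - x + c * T)))) \<longlongrightarrow> H / (H * 1)) at_top"
    using H_ge_1 by (intro tendsto_divide tendsto_mult tendsto_const exit_prob_asymptotics end_prob_asymptotics) auto
  then have 1: "((\<lambda>u. (exit_prob c x u / envelope (u - x + c * T)) / (H * (end_prob c x u / envelope (u - x + c * T)))) \<longlongrightarrow> 1) at_top"
    using H_ge_1 by simp
  have "eventually (\<lambda>u. 0 < u - x + c * T) at_top" using level_shift by (simp add: filterlim_at_top_dense)
  then have "eventually (\<lambda>u. (exit_prob c x u / envelope (u - x + c * T)) / (H * (end_prob c x u / envelope (u - x + c * T))) = exit_prob c x u / (H * end_prob c x u)) at_top"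
  proof eventually_elim
    case (elim u)
    have "a / g / (h * (b / g)) = a / (h * b)" if "0 < g" for a b g h :: real using that by simp
    from this[OF envelope_pos[OF elim]] show ?case .
  qed
  with 1 show ?thesis by (rule Lim_transform_eventually)
qed

lemma exit_prob_tendsto_0: "((\<lambda>u. exit_prob c x u) \<longlongrightarrow> 0) at_top"
proof -
  have 0: "(envelope \<longlongrightarrow> 0) at_top"
  proof -
    have l: "((\<lambda>u. (\<mu> / u) ^ P) \<longlongrightarrow> 0 ^ P) at_top"
    proof (rule tendsto_power)
      have "((\<lambda>u. k / u) \<longlongrightarrow> 0) at_top" for k :: real by real_asymp
      then show "((\<lambda>u. \<mu> / u) \<longlongrightarrow> 0) at_top" .
    qed
    have "((\<lambda>u. endpoint_density * (\<mu> / u) ^ P) \<longlongrightarrow> endpoint_density * 0) at_top"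
      using l P_pos by (intro tendsto_mult tendsto_const) (simp add: power_0_left)
    then have up: "((\<lambda>u. endpoint_density * (\<mu> / u) ^ P) \<longlongrightarrow> 0) at_top" by simp
    show ?thesis
    proof (rule tendsto_sandwich[OF _ _ tendsto_const up])
      show "eventually (\<lambda>u. 0 \<le> envelope u) at_top"
        using eventually_gt_at_top[of 0] by eventually_elim (simp add: envelope_pos less_imp_le)
      show "eventually (\<lambda>u. envelope u \<le> endpoint_density * (\<mu> / u) ^ P) at_top"
        using eventually_gt_at_top[of 0]
      proof eventually_elim
        case (elim u)
        have "exp (- (u\<^sup>2 * real P / (2 * \<mu>))) * (\<mu> / u) ^ P \<le> 1 * (\<mu> / u) ^ P"
          using elim mu_pos by (intro mult_right_mono) auto
        then show ?case unfolding envelope_def using endpoint_density_pos by (intro mult_left_mono) auto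
      qed
    qed
  qed
  have "((\<lambda>u. exit_prob c x u / envelope (u - x + c * T) * envelope (u - x + c * T)) \<longlongrightarrow> H * 0) at_top"
    by (intro tendsto_mult exit_prob_asymptotics filterlim_compose[OF 0 level_shift])
  then have 1: "((\<lambda>u. exit_prob c x u / envelope (u - x + c * T) * envelope (u - x + c * T)) \<longlongrightarrow> 0) at_top" by simp
  have "eventually (\<lambda>u. 0 < u - x + c * T) at_top" using level_shift by (simp add: filterlim_at_top_dense)
  then have "eventually (\<lambda>u. exit_prob c x u / envelope (u - x + c * T) * envelope (u - x + c * T) = exit_prob c x u) at_top"
    by eventually_elim (use envelope_pos in \<open>simp add: less_imp_neq[symmetric]\<close>)
  with 1 show ?thesis by (rule Lim_transform_eventually)
qed

lemma exit_prob_eventually_pos: "eventually (\<lambda>u. 0 < exit_prob c x u) at_top"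
proof -
  have "eventually (\<lambda>u. 1 / 2 < exit_prob c x u / envelope (u - x + c * T)) at_top"
    by (rule order_tendstoD(1)[OF exit_prob_asymptotics]) (use H_ge_1 in linarith)
  then show ?thesis
  proof eventually_elim
    case (elim u)
    then have "exit_prob c x u \<noteq> 0" by auto
    then show ?case by (simp add: exit_prob_def less_le)
  qed
qed

end

text \<open>The constants \<open>H_const\<close> are positive and finite, so the comparison of the exits reduces to the one
of the two envelopes at the shifted levels \<open>u - x + c * T\<close>.\<close>

lemma exit_prob_ratio_tendsto_0:
  assumes t1: "brownian_tree \<Omega> \<Omega>' T \<eta>1 \<tau>1 N1 B1 Bstar" and t2: "brownian_tree \<Omega> \<Omega>' T \<eta>2 \<tau>2 N2 B2 Bstar"
    and less: "\<not> tree_succeq T (\<eta>2, \<tau>2, N2, c2, x2) (\<eta>1, \<tau>1, N1, c1, x1)"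
  shows "((\<lambda>u. brownian_tree.exit_prob \<Omega> T \<eta>2 \<tau>2 N2 B2 c2 x2 u / brownian_tree.exit_prob \<Omega> T \<eta>1 \<tau>1 N1 B1 c1 x1 u) \<longlongrightarrow> 0) at_top"
proof -
  interpret t1: brownian_tree \<Omega> \<Omega>' T \<eta>1 \<tau>1 N1 B1 Bstar by fact
  interpret t2: brownian_tree \<Omega> \<Omega>' T \<eta>2 \<tau>2 N2 B2 Bstar by fact
  have "((\<lambda>u. (t2.endpoint_density * (exp (- ((u + (c2 * T - x2))\<^sup>2 * real t2.P / (2 * t2.\<mu>))) * (t2.\<mu> / (u + (c2 * T - x2))) ^ t2.P)) /
     (t1.endpoint_density * (exp (- ((u + (c1 * T - x1))\<^sup>2 * real t1.P / (2 * t1.\<mu>))) * (t1.\<mu> / (u + (c1 * T - x1))) ^ t1.P))) \<longlongrightarrow> 0) at_top"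
    using less
    by (intro gaussian_ratio_tendsto_0 t1.mu_pos t2.mu_pos t1.P_pos t2.P_pos t1.endpoint_density_pos) (auto simp: Let_def)
  then have g: "((\<lambda>u. t2.envelope (u - x2 + c2 * T) / t1.envelope (u - x1 + c1 * T)) \<longlongrightarrow> 0) at_top"
    unfolding t1.envelope_def t2.envelope_def by (simp add: algebra_simps)
  have "((\<lambda>u. t2.exit_prob c2 x2 u / t2.envelope (u - x2 + c2 * T) * (t2.envelope (u - x2 + c2 * T) / t1.envelope (u - x1 + c1 * T)) /
      (t1.exit_prob c1 x1 u / t1.envelope (u - x1 + c1 * T))) \<longlongrightarrow> t2.H * 0 / t1.H) at_top"
    using t1.H_ge_1 by (intro tendsto_divide tendsto_mult t1.exit_prob_asymptotics t2.exit_prob_asymptotics g) auto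
  then have 0: "((\<lambda>u. t2.exit_prob c2 x2 u / t2.envelope (u - x2 + c2 * T) * (t2.envelope (u - x2 + c2 * T) / t1.envelope (u - x1 + c1 * T)) /
      (t1.exit_prob c1 x1 u / t1.envelope (u - x1 + c1 * T))) \<longlongrightarrow> 0) at_top" by simp
  have "eventually (\<lambda>u. 0 < u - x1 + c1 * T) at_top" "eventually (\<lambda>u. 0 < u - x2 + c2 * T) at_top"
    using t1.level_shift t2.level_shift by (simp_all add: filterlim_at_top_dense)
  then have "eventually (\<lambda>u. t2.exit_prob c2 x2 u / t2.envelope (u - x2 + c2 * T) * (t2.envelope (u - x2 + c2 * T) / t1.envelope (u - x1 + c1 * T)) /
      (t1.exit_prob c1 x1 u / t1.envelope (u - x1 + c1 * T)) = t2.exit_prob c2 x2 u / t1.exit_prob c1 x1 u) at_top"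
  proof eventually_elim
    case (elim u)
    have "a / g * (g / h) / (b / h) = a / b" if "0 < g" "0 < h" for a b g h :: real using that by simp
    from this[OF t2.envelope_pos[OF elim(2)] t1.envelope_pos[OF elim(1)]] show ?case .
  qed
  with 0 show ?thesis by (rule Lim_transform_eventually)
qed

lemma tree_succeq_total: "tree_succeq T a b \<or> tree_succeq T b a"
  by (cases a; cases b) (auto simp: Let_def)

lemma tree_succeq_trans: "tree_succeq T a b \<Longrightarrow> tree_succeq T b d \<Longrightarrow> tree_succeq T a d"
  by (cases a; cases b; cases d) (auto simp: Let_def)

theorem theorem3p10:
  fixes \<Omega> :: "'w measure" and \<Omega>' :: "'v measure"
    and T :: real and M :: nat
    and \<eta> :: "nat \<Rightarrow> nat" and \<tau> :: "nat \<Rightarrow> nat \<Rightarrow> real" and N :: "nat \<Rightarrow> nat \<Rightarrow> nat"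
    and c x :: "nat \<Rightarrow> real"
    and B :: "nat \<Rightarrow> nat \<times> nat \<Rightarrow> real \<Rightarrow> 'w \<Rightarrow> real"
    and Bstar :: "nat \<Rightarrow> real \<Rightarrow> 'v \<Rightarrow> real"
  assumes "prob_space \<Omega>" and "prob_space \<Omega>'"
    and "0 < T" and "1 \<le> M"
    and "\<forall>i\<in>{1..M}. branching_structure T (\<eta> i) (\<tau> i) (N i)"
    and "\<forall>i\<in>{1..M}. indep_brownian_motions \<Omega> (driver_index (\<eta> i) (N i)) (B i)"
    and "prob_space.indep_vars \<Omega>
          (\<lambda>i. \<Pi>\<^sub>M p\<in>leaves (\<eta> i) (N i) \<times> {0..T}. borel)
          (\<lambda>i \<omega>. \<lambda>(\<gamma>, t)\<in>leaves (\<eta> i) (N i) \<times> {0..T}.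
             decision_tree (\<eta> i) (\<tau> i) (N i) (B i) \<gamma> t \<omega>)
          {1..M}"
    and "\<forall>i\<in>{1..M}. indep_brownian_motions \<Omega>' {1..num_branches (N i) (\<eta> i)} Bstar"
  shows
    "let W = (\<lambda>i. drifted_tree (\<eta> i) (\<tau> i) (N i) (B i) (c i) (x i));
         \<Gamma> = (\<lambda>i. leaves (\<eta> i) (N i));
         A = maximal_trees T M (\<lambda>i. (\<eta> i, \<tau> i, N i, c i, x i))
     in
       ((\<lambda>u. measure \<Omega> {\<omega> \<in> space \<Omega>. \<exists>i\<in>{1..M}. \<exists>t\<in>{0..T}. \<forall>\<gamma>\<in>\<Gamma> i. W i \<gamma> t \<omega> > u} /
             (\<Sum>i\<in>A. measure \<Omega> {\<omega> \<in> space \<Omega>. \<exists>t\<in>{0..T}. \<forall>\<gamma>\<in>\<Gamma> i. W i \<gamma> t \<omega> > u}))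
         \<longlongrightarrow> 1) at_top \<and>
       (\<forall>i\<in>{1..M}.
         ((\<lambda>u. measure \<Omega> {\<omega> \<in> space \<Omega>. \<exists>t\<in>{0..T}. \<forall>\<gamma>\<in>\<Gamma> i. W i \<gamma> t \<omega> > u} /
               (H_const \<Omega>' Bstar (num_branches (N i) (\<eta> i)) (1 / mu0 T (\<eta> i) (\<tau> i) (N i)) *
                measure \<Omega> {\<omega> \<in> space \<Omega>. \<forall>\<gamma>\<in>\<Gamma> i. W i \<gamma> T \<omega> > u}))
           \<longlongrightarrow> 1) at_top)"
proof -
  interpret \<Omega>: prob_space \<Omega> by fact
  define I where "I = {1..M}"
  define D where "D i = (\<eta> i, \<tau> i, N i, c i, x i)" for i
  define A where "A = maximal_trees T M D"
  define E where "E i u = {\<omega> \<in> space \<Omega>. \<exists>t\<in>{0..T}. \<forall>\<gamma>\<in>leaves (\<eta> i) (N i). drifted_tree (\<eta> i) (\<tau> i) (N i) (B i) (c i) (x i) \<gamma> t \<omega> > u}" for i u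
  define e where "e i u = measure \<Omega> (E i u)" for i u
  have tree: "brownian_tree \<Omega> \<Omega>' T (\<eta> i) (\<tau> i) (N i) (B i) Bstar" if "i \<in> I" for i
    using assms that unfolding brownian_tree_def brownian_tree_axioms_def I_def by blast
  have e_exit: "e i u = brownian_tree.exit_prob \<Omega> T (\<eta> i) (\<tau> i) (N i) (B i) (c i) (x i) u" if "i \<in> I" for i u
    unfolding e_def E_def brownian_tree.exit_prob_def[OF tree[OF that]] brownian_tree.exceeds_def[OF tree[OF that]] ..
  have finI: "finite I" and Ine: "I \<noteq> {}" using assms(4) by (auto simp: I_def)
  have AI: "A \<subseteq> I" by (auto simp: A_def maximal_trees_def I_def)
  have finA: "finite A" using AI finI finite_subset by blast
  obtain m where m: "m \<in> A"
    using finite_total_preorder_has_maximum[OF finI Ine, of "\<lambda>i j. tree_succeq T (D i) (D j)"] tree_succeq_total tree_succeq_trans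
    unfolding A_def maximal_trees_def I_def by blast
  have mI: "m \<in> I" using m AI by blast
  define X where "X i \<omega> = (\<lambda>(\<gamma>, t)\<in>leaves (\<eta> i) (N i) \<times> {0..T}. decision_tree (\<eta> i) (\<tau> i) (N i) (B i) \<gamma> t \<omega>)" for i \<omega>
  define Z where "Z i = (\<Pi>\<^sub>M p\<in>leaves (\<eta> i) (N i) \<times> {0..T}. (borel :: real measure))" for i
  have indX: "\<Omega>.indep_vars Z X I" using assms(7) unfolding X_def[abs_def] Z_def[abs_def] I_def .
  define G where "G i u = brownian_tree.crossing_paths T (\<eta> i) (\<tau> i) (N i) (c i) (x i) u" for i u
  have G: "G i u \<in> sets (Z i)" if "i \<in> I" for i u
    unfolding G_def Z_def by (rule brownian_tree.sets_crossing_paths[OF tree[OF that]])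
  have EG: "E i u = X i -` G i u \<inter> space \<Omega>" if "i \<in> I" for i u
    using brownian_tree.exit_event_eq_crossing_paths[OF tree[OF that], of "c i" "x i" u]
    unfolding E_def X_def G_def brownian_tree.exceeds_def[OF tree[OF that]] .
  have Esets: "E i u \<in> sets \<Omega>" if "i \<in> I" for i u
  proof -
    have "X i \<in> measurable \<Omega> (Z i)" using indX that unfolding \<Omega>.indep_vars_def2 by blast
    then show ?thesis unfolding EG[OF that] by (rule measurable_sets) (rule G[OF that])
  qed
  have union: "{\<omega> \<in> space \<Omega>. \<exists>i\<in>{1..M}. \<exists>t\<in>{0..T}. \<forall>\<gamma>\<in>leaves (\<eta> i) (N i). drifted_tree (\<eta> i) (\<tau> i) (N i) (B i) (c i) (x i) \<gamma> t \<omega> > u} = (\<Union>i\<in>I. E i u)" for u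
    unfolding E_def I_def by blast
  define U where "U u = measure \<Omega> (\<Union>i\<in>I. E i u)" for u
  define s where "s u = (\<Sum>i\<in>I. e i u)" for u
  define a where "a u = (\<Sum>i\<in>A. e i u)" for u
  have e01: "0 \<le> e i u" "e i u \<le> 1" for i u by (auto simp: e_def)
  have U_le: "U u \<le> s u" for u
    unfolding U_def s_def e_def using finI Esets by (intro \<Omega>.finite_measure_subadditive_finite) auto
  \<comment> \<open>By independence the probability of the union is \<open>1\<close> minus the product of the \<open>1 - e i u\<close>.\<close>
  have U_ge: "s u - (s u)\<^sup>2 \<le> U u" for u
  proof -
    have "\<Omega>.prob (\<Inter>i\<in>I. X i -` (space (Z i) - G i u) \<inter> space \<Omega>) = (\<Prod>i\<in>I. \<Omega>.prob (X i -` (space (Z i) - G i u) \<inter> space \<Omega>))"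
      using G by (intro \<Omega>.indep_varsD_finite[OF indX Ine finI]) auto
    moreover have c: "X i -` (space (Z i) - G i u) \<inter> space \<Omega> = space \<Omega> - E i u" if "i \<in> I" for i
      using that indX by (auto simp: EG \<Omega>.indep_vars_def dest: measurable_space)
    moreover have "\<Omega>.prob (space \<Omega> - E i u) = 1 - e i u" if "i \<in> I" for i
      using \<Omega>.prob_compl[OF Esets[OF that]] by (simp add: e_def)
    moreover have "(\<Inter>i\<in>I. X i -` (space (Z i) - G i u) \<inter> space \<Omega>) = space \<Omega> - (\<Union>i\<in>I. E i u)"
      using c Ine by auto
    moreover have "\<Omega>.prob (space \<Omega> - (\<Union>i\<in>I. E i u)) = 1 - U u"
      unfolding U_def using finI Esets by (intro \<Omega>.prob_compl) auto
    ultimately have "1 - U u = (\<Prod>i\<in>I. 1 - e i u)" by simp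
    also have "\<dots> \<le> 1 - s u + (s u)\<^sup>2" unfolding s_def using e01 finI by (intro one_minus_prod_bounds)
    finally show ?thesis by simp
  qed
  have a_ge: "e m u \<le> a u" for u unfolding a_def using m finA e01 by (intro member_le_sum) auto
  have em_pos: "eventually (\<lambda>u. 0 < e m u) at_top"
    using brownian_tree.exit_prob_eventually_pos[OF tree[OF mI], of "c m" "x m"] by (simp add: e_exit[OF mI])
  have negl: "((\<lambda>u. e j u / a u) \<longlongrightarrow> 0) at_top" if j: "j \<in> I - A" for j
  proof -
    have "\<not> tree_succeq T (D j) (D m)"
    proof
      assume jm: "tree_succeq T (D j) (D m)"
      have "tree_succeq T (D m) (D k)" if "k \<in> {1..M}" for k
        using m that by (auto simp: A_def maximal_trees_def)
      then have "j \<in> A" using tree_succeq_trans[OF jm] j by (auto simp: A_def maximal_trees_def I_def)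
      then show False using j by blast
    qed
    then have up: "((\<lambda>u. e j u / e m u) \<longlongrightarrow> 0) at_top"
      using exit_prob_ratio_tendsto_0[OF tree[OF mI] tree[of j], of "c j" "x j" "c m" "x m"] j by (simp add: D_def e_exit[OF mI] e_exit[of j])
    show ?thesis
    proof (rule tendsto_sandwich[OF _ _ tendsto_const up])
      show "eventually (\<lambda>u. 0 \<le> e j u / a u) at_top"
        using e01 by (intro always_eventually allI divide_nonneg_nonneg) (auto simp: a_def intro: sum_nonneg)
      show "eventually (\<lambda>u. e j u / a u \<le> e j u / e m u) at_top"
        using em_pos
      proof eventually_elim
        case (elim u)
        then have "0 < a u" using a_ge[of u] by linarith
        then show ?case using elim a_ge[of u] e01[of j u] by (intro divide_left_mono) auto
      qed
    qed
  qed
  have s_a: "((\<lambda>u. s u / a u) \<longlongrightarrow> 1) at_top"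
  proof -
    have "((\<lambda>u. 1 + (\<Sum>j\<in>I - A. e j u / a u)) \<longlongrightarrow> 1 + (\<Sum>j\<in>I - A. 0)) at_top"
      by (intro tendsto_add tendsto_const tendsto_sum negl)
    then have 1: "((\<lambda>u. 1 + (\<Sum>j\<in>I - A. e j u / a u)) \<longlongrightarrow> 1) at_top" by simp
    have "eventually (\<lambda>u. 1 + (\<Sum>j\<in>I - A. e j u / a u) = s u / a u) at_top"
      using em_pos
    proof eventually_elim
      case (elim u)
      then have "0 < a u" using a_ge[of u] by linarith
      moreover have "s u = (\<Sum>j\<in>I - A. e j u) + a u"
        unfolding s_def a_def using sum.subset_diff[OF AI finI] by blast
      ultimately show ?case by (simp add: sum_divide_distrib[symmetric] add_divide_distrib)
    qed
    with 1 show ?thesis by (rule Lim_transform_eventually)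
  qed
  have s_0: "(s \<longlongrightarrow> 0) at_top"
  proof -
    have "((\<lambda>u. \<Sum>i\<in>I. e i u) \<longlongrightarrow> (\<Sum>i\<in>I. 0)) at_top"
      using brownian_tree.exit_prob_tendsto_0[OF tree] by (intro tendsto_sum) (simp add: e_exit)
    then show ?thesis by (simp add: s_def[abs_def])
  qed
  have first: "((\<lambda>u. U u / a u) \<longlongrightarrow> 1) at_top"
  proof (rule tendsto_sandwich[OF _ _ _ s_a])
    have "((\<lambda>u. s u / a u * (1 - s u)) \<longlongrightarrow> 1 * (1 - 0)) at_top"
      by (intro tendsto_mult tendsto_diff tendsto_const s_a s_0)
    then show "((\<lambda>u. s u / a u * (1 - s u)) \<longlongrightarrow> 1) at_top" by simp
    have a_nn: "0 \<le> a u" for u unfolding a_def using e01 by (intro sum_nonneg)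
    show "eventually (\<lambda>u. s u / a u * (1 - s u) \<le> U u / a u) at_top"
    proof (intro always_eventually allI)
      fix u
      have "s u / a u * (1 - s u) = (s u - (s u)\<^sup>2) / a u" by (simp add: power2_eq_square algebra_simps diff_divide_distrib)
      also have "\<dots> \<le> U u / a u" using U_ge a_nn by (intro divide_right_mono)
      finally show "s u / a u * (1 - s u) \<le> U u / a u" .
    qed
    show "eventually (\<lambda>u. U u / a u \<le> s u / a u) at_top"
      using U_le a_nn by (intro always_eventually allI divide_right_mono)
  qed
  have second: "((\<lambda>u. e i u / (H_const \<Omega>' Bstar (num_branches (N i) (\<eta> i)) (1 / mu0 T (\<eta> i) (\<tau> i) (N i)) *
      measure \<Omega> {\<omega> \<in> space \<Omega>. \<forall>\<gamma>\<in>leaves (\<eta> i) (N i). drifted_tree (\<eta> i) (\<tau> i) (N i) (B i) (c i) (x i) \<gamma> T \<omega> > u})) \<longlongrightarrow> 1) at_top"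
    if i: "i \<in> I" for i
    using brownian_tree.exit_prob_relative[OF tree[OF i], of "c i" "x i"]
    unfolding e_exit[OF i, symmetric] brownian_tree.end_prob_def[OF tree[OF i]] brownian_tree.exceeds_def[OF tree[OF i]] .
  show ?thesis
    using first second
    unfolding Let_def union U_def a_def A_def D_def e_def E_def I_def by blast
qed


end
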